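(* Let $d\ge1$ and let $\mathsf{dist}$ be a generalized distance on $\mathcal P(\mathbb Z_+^d)$ satisfying the decomposition property and the sandwich property. Let $p_n^{\mathsf{emp}}=\frac1n\sum_{i=1}^n\delta_{\boldsymbol Y_i}$ be the empirical distribution of the training sample, and let $\hat G\in\operatorname{argmin}_{Q\in\mathcal P(\mathbb R_+^d)}\mathsf{dist}(p_n^{\mathsf{emp}}\,\|\,f_Q)$ be the unconstrained minimum-distance estimator. For $h>0$ and $n\ge3$ write $K=\min\left\{\max\{1,h\}\frac{\log n}{\log\log n},\ h+\log n\right\}$. Then there exist constants $c_1,c_2>0$ such that for $n\ge3$ the following regret bounds hold whenever $n\ge d$: (i) for all $h>0$, $\displaystyle\mathsf{Regret}(\hat G;\mathcal P([0,h]^d))\le\frac{d\,(c_1K)^{d+2}}{n}$; (ii) if the data-generating prior $G$ belongs to a class $\mathcal G\subset\mathcal P(\mathbb R_+^d)$ such that all (one-dimensional) marginals of every $G\in\mathcal G$ belong to $\mathsf{SubE}(s)$ for some $s>0$, then $\displaystyle\mathsf{Regret}(\hat G;\mathcal G)\le\frac{d\,(c_2\max\{1,s\})^{d+2}}{n}(\log n)^{d+2}$. In addition, when the data-generating distribution $G$ is supported on $[0,h]^d$, the constrained minimum-distance estimator with access to $h$, $\tilde G\in\operatorname{argmin}_{Q\in\mathcal P([0,h]^d)}\mathsf{dist}(p_n^{\mathsf{emp}}\,\|\,f_Q)$, satisfies $$\mathsf{Regret}(\tilde G;\mathcal P([0,h]^d))\le\frac{d\,c_1^{d+2}\max\{1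,h\}}{n}K^{d+1}.$$
   Context: $\mathbb Z_+=\{0,1,2,\dots\}$, $\mathbb R_+=[0,\infty)$; $\mathcal P(\Theta)$ is the set of Borel probability measures on $\Theta$, and $\mathcal P(\mathbb Z_+^d)$ the set of probability mass functions on $\mathbb Z_+^d$. $\mathsf{SubE}(s)=\{G\in\mathcal P(\mathbb R_+):G([t,\infty))\le 2e^{-t/s}\ \forall t>0\}$. For $G\in\mathcal P(\mathbb R_+^d)$, the $d$-dimensional Poisson mixture is $f_G(\boldsymbol y)=\int\prod_{j=1}^d e^{-\theta_j}\frac{\theta_j^{y_j}}{y_j!}\,dG(\boldsymbol\theta)$, $\boldsymbol y\in\mathbb Z_+^d$ (with $0^0=1$). $H^2(p,q)=\sum_{\boldsymbol y}(\sqrt{p(\boldsymbol y)}-\sqrt{q(\boldsymbol y)})^2$; $\chi^2(p\|q)=\sum_{\boldsymbol y}\frac{(p(\boldsymbol y)-q(\boldsymbol y))^2}{q(\boldsymbol y)}$, sums over $\mathbb Z_+^d$. Bayes estimator: $\hat{\boldsymbol\theta}_G=(\hat\theta_{G,1},\dots,\hat\theta_{G,d})$ with $\hat\theta_{G,j}(\boldsymbol y)=\mathbb E_G[\theta_j\mid\boldsymbol y]=(y_j+1)\frac{f_G(\boldsymbol y+\boldsymbol e_j)}{f_G(\boldsymbol y)}$, $\boldsymbol e_j$ the $j$-th coordinate vector, with the convention $\hat\theta_{G,j}(\boldsymbol y)=0$ if $f_G(\boldsymbol y)=0$. Regret: the training sample $\boldsymbol Y_1,\dots,\boldsymbol Y_n$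 and the test point $\boldsymbol Y$ are i.i.d. from $f_G$. For an estimator $\hat G$ computed from the training sample, $\mathsf{Regret}(\hat G;G)=\mathbb E_G\left[\|\hat{\boldsymbol\theta}_{\hat G}(\boldsymbol Y)-\hat{\boldsymbol\theta}_G(\boldsymbol Y)\|^2\right]$ (Euclidean norm, expectation over training sample and test point), and $\mathsf{Regret}(\hat G;\mathcal G)=\sup_{G\in\mathcal G}\mathsf{Regret}(\hat G;G)$. A generalized distance is a map $\mathsf{dist}:\mathcal P(\mathbb Z_+^d)\times\mathcal P(\mathbb Z_+^d)\to[0,\infty]$ with $\mathsf{dist}(p\|q)\ge 0$ and equality if and only if $p=q$. Decomposition property: there exist maps $t:\mathcal P(\mathbb Z_+^d)\to\mathbb R$ and $\ell:[0,\infty)^2\to(-\infty,\infty]$, with $\ell(a,b)$ finite for $b>0$, such that for all $q_1,q_2\in\mathcal P(\mathbb Z_+^d)$, $\mathsf{dist}(q_1\|q_2)=t(q_1)+\sum_{\boldsymbol y\in\mathbb Z_+^d}\ell(q_1(\boldsymbol y),q_2(\boldsymbol y))$, where $b\mapsto\ell(a,b)$ is strictly decreasing and strictly convex (and continuous on $[0,\infty)$ as an extended-real-valued function) for each $a>0$, and $\ell(0,b)=0$ for all $b\ge0$. Sandwich property: there exist absolute constants $\kappa_1,\kappa_2>0$ such that $\kappa_1H^2(q_1,q_2)\le\mathsf{dist}(q_1\|q_2)\le\kappa_2\chi^2(q_1\|q_2)$ for all $q_1,q_2\in\mathcal P(\mathbb Z_+^d)$. The constants $c_1,c_2$ in the claim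 may depend on $\kappa_1,\kappa_2$ but not on $h,s,d,n$. *)

theory Defs
  imports "HOL-Probability.Probability"
begin

text \<open>
  The dimension \<open>d\<close> has to be quantified inside formulas (constants must not depend on it), so it is
  a natural number rather than an index type. Points of d-dimensional space are extensional
  functions on \<open>{..<d}\<close>, coordinates being numbered \<open>0, \<dots>, d - 1\<close>; the Borel sigma-algebra of
  d-dimensional Euclidean space is the finite product \<open>euclidean_space_meas d\<close> of Borel sigma-algebras.
\<close>

abbreviation euclidean_space_meas :: "nat \<Rightarrow> (nat \<Rightarrow> real) measure" where
  "euclidean_space_meas d \<equiv> Pi\<^sub>M {..<d} (\<lambda>_. borel)"

definition orthant :: "nat \<Rightarrow> (nat \<Rightarrow> real) set" where
  "orthant d = {..<d} \<rightarrow>\<^sub>E {0..}"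

definition cube :: "nat \<Rightarrow> real \<Rightarrow> (nat \<Rightarrow> real) set" where
  "cube d h = {..<d} \<rightarrow>\<^sub>E {0..h}"

definition lattice_points :: "nat \<Rightarrow> (nat \<Rightarrow> nat) set" where
  "lattice_points d = {..<d} \<rightarrow>\<^sub>E UNIV"

text \<open>Probability measures on a measurable set \<open>\<Theta>\<close> are identified with the probability measures
  on the ambient space \<open>M\<close> that are concentrated on \<open>\<Theta>\<close>.\<close>

definition probs_on :: "'a measure \<Rightarrow> 'a set \<Rightarrow> 'a measure set" where
  "probs_on M \<Theta> = {G. prob_space G \<and> sets G = sets M \<and> (AE \<theta> in G. \<theta> \<in> \<Theta>)}"

definition lattice_pmfs :: "nat \<Rightarrow> (nat \<Rightarrow> nat) pmf set" where
  "lattice_pmfs d = {p. set_pmf p \<subseteq> lattice_points d}"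

definition SubE :: "real \<Rightarrow> real measure set" where
  "SubE s = {G \<in> probs_on borel {0..}. \<forall>t>0. measure G {t..} \<le> 2 * exp (- t / s)}"

definition marginal :: "(nat \<Rightarrow> real) measure \<Rightarrow> nat \<Rightarrow> real measure" where
  "marginal G j = distr G borel (\<lambda>\<theta>. \<theta> j)"


definition poisson_likelihood :: "nat \<Rightarrow> (nat \<Rightarrow> real) \<Rightarrow> (nat \<Rightarrow> nat) \<Rightarrow> real" where
  "poisson_likelihood d \<theta> y = (\<Prod>j<d. exp (- \<theta> j) * \<theta> j ^ y j / fact (y j))"

text \<open>Lemma \<open>pmf_poisson_mixture\<close> below shows that \<^const>\<open>embed_pmf\<close> is applied to a genuine
  probability mass function whenever \<open>G\<close> is a prior on the orthant.\<close>

definition poisson_mixture :: "nat \<Rightarrow> (nat \<Rightarrow> real) measure \<Rightarrow> (nat \<Rightarrow> nat) pmf" where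
  "poisson_mixture d G =
     embed_pmf (\<lambda>y. if y \<in> lattice_points d then \<integral>\<theta>. poisson_likelihood d \<theta> y \<partial>G else 0)"

lemma countable_lattice_points: "countable (lattice_points d)"
  unfolding lattice_points_def by (intro countable_PiE) auto

lemma orthant_nonneg: "\<theta> \<in> orthant d \<Longrightarrow> j < d \<Longrightarrow> 0 \<le> \<theta> j"
  by (auto simp: orthant_def PiE_def Pi_def)

lemma poisson_likelihood_nonneg: "\<theta> \<in> orthant d \<Longrightarrow> 0 \<le> poisson_likelihood d \<theta> y"
  unfolding poisson_likelihood_def
  by (intro prod_nonneg) (auto intro!: divide_nonneg_nonneg mult_nonneg_nonneg dest: orthant_nonneg)

lemma poisson_likelihood_measurable [measurable]:
  "(\<lambda>\<theta>. poisson_likelihood d \<theta> y) \<in> borel_measurable (euclidean_space_meas d)"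
  unfolding poisson_likelihood_def by measurable

lemma poisson_weight_sum:
  fixes x :: real
  assumes "0 \<le> x"
  shows "(\<integral>\<^sup>+k. ennreal (exp (- x) * x ^ k / fact k) \<partial>count_space UNIV) = 1"
proof -
  have "(\<lambda>k. x ^ k / fact k * exp (- x)) sums (exp x * exp (- x))"
    using exp_converges[of x] by (intro sums_mult2) (simp add: scaleR_conv_of_real field_simps)
  hence s: "(\<lambda>k. exp (- x) * x ^ k / fact k) sums 1"
    by (simp add: exp_minus field_simps)
  show ?thesis
    using assms s by (subst nn_integral_count_space_nat)
      (simp add: suminf_ennreal2 sums_iff)
qed

lemma poisson_likelihood_sum:
  assumes "\<theta> \<in> orthant d"
  shows "(\<integral>\<^sup>+y. ennreal (poisson_likelihood d \<theta> y) \<partial>count_space (lattice_points d)) = 1"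
proof -
  define w where "w j = embed_pmf (\<lambda>k. exp (- \<theta> j) * \<theta> j ^ k / fact k)" for j
  have w: "pmf (w j) k = exp (- \<theta> j) * \<theta> j ^ k / fact k" if "j < d" for j k
    unfolding w_def using orthant_nonneg[OF assms that] poisson_weight_sum[of "\<theta> j"]
    by (intro pmf_embed_pmf) auto
  define P where "P = Pi_pmf {..<d} undefined w"
  have P: "pmf P y = (if y \<in> lattice_points d then poisson_likelihood d \<theta> y else 0)" for y
    unfolding P_def poisson_likelihood_def
    by (subst pmf_Pi) (auto simp: w lattice_points_def PiE_def extensional_def intro!: prod.cong)
  have "(\<integral>\<^sup>+y. ennreal (poisson_likelihood d \<theta> y) \<partial>count_space (lattice_points d)) =
        (\<integral>\<^sup>+y. ennreal (pmf P y) \<partial>count_space (lattice_points d))"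
    by (intro nn_integral_cong) (simp add: P)
  also have "\<dots> = (\<integral>\<^sup>+y. ennreal (pmf P y) \<partial>count_space UNIV)"
    by (intro nn_integral_count_space_eq) (auto simp: P)
  finally show ?thesis
    by (simp add: nn_integral_pmf_eq_1)
qed

lemma pmf_poisson_mixture:
  assumes G: "G \<in> probs_on (euclidean_space_meas d) (orthant d)"
  shows "pmf (poisson_mixture d G) y =
           (if y \<in> lattice_points d then \<integral>\<theta>. poisson_likelihood d \<theta> y \<partial>G else 0)"
proof -
  from G have prob: "prob_space G" and [measurable_cong]: "sets G = sets (euclidean_space_meas d)"
    and ae: "AE \<theta> in G. \<theta> \<in> orthant d"
    by (auto simp: probs_on_def)
  interpret prob_space G by (fact prob)
  have nonneg: "AE \<theta> in G. 0 \<le> poisson_likelihood d \<theta> z" for z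
    using ae by eventually_elim (rule poisson_likelihood_nonneg)
  have le1: "poisson_likelihood d \<theta> z \<le> 1" if "\<theta> \<in> orthant d" "z \<in> lattice_points d" for \<theta> z
  proof -
    have "ennreal (poisson_likelihood d \<theta> z) =
          (\<integral>\<^sup>+x. ennreal (poisson_likelihood d \<theta> x) \<partial>count_space {z})"
      by (simp add: nn_integral_count_space_finite)
    also have "\<dots> = (\<integral>\<^sup>+x. ennreal (poisson_likelihood d \<theta> x) * indicator {z} x
                        \<partial>count_space (lattice_points d))"
      using that by (subst nn_integral_count_space_indicator)
        (auto simp: nn_integral_count_space_indicator indicator_def if_distrib intro!: nn_integral_cong)
    also have "\<dots> \<le> (\<integral>\<^sup>+x. ennreal (poisson_likelihood d \<theta> x) \<partial>count_space (lattice_points d))"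
      by (intro nn_integral_mono) (auto simp: indicator_def)
    finally show ?thesis
      by (simp add: poisson_likelihood_sum[OF that(1)])
  qed
  have int: "integrable G (\<lambda>\<theta>. poisson_likelihood d \<theta> z)" if "z \<in> lattice_points d" for z
  proof (rule integrable_const_bound[where B = 1])
    show "AE \<theta> in G. norm (poisson_likelihood d \<theta> z) \<le> 1"
      using ae by eventually_elim (use le1 that poisson_likelihood_nonneg in auto)
  qed measurable
  let ?f = "\<lambda>z. if z \<in> lattice_points d then \<integral>\<theta>. poisson_likelihood d \<theta> z \<partial>G else 0"
  have "(\<integral>\<^sup>+z. ennreal (?f z) \<partial>count_space UNIV) =
        (\<integral>\<^sup>+z. ennreal (?f z) \<partial>count_space (lattice_points d))"
    by (intro nn_integral_count_space_eq[symmetric]) auto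
  also have "\<dots> = (\<integral>\<^sup>+z. (\<integral>\<^sup>+\<theta>. ennreal (poisson_likelihood d \<theta> z) \<partial>G)
                     \<partial>count_space (lattice_points d))"
    by (intro nn_integral_cong) (simp add: nn_integral_eq_integral[OF int nonneg])
  also have "\<dots> = (\<integral>\<^sup>+\<theta>. (\<integral>\<^sup>+z. ennreal (poisson_likelihood d \<theta> z)
                     \<partial>count_space (lattice_points d)) \<partial>G)"
    using countable_lattice_points by (intro nn_integral_count_space_nn_integral[symmetric]) auto
  also have "\<dots> = (\<integral>\<^sup>+\<theta>. 1 \<partial>G)"
    by (intro nn_integral_cong_AE, use ae in eventually_elim) (rule poisson_likelihood_sum)
  also have "\<dots> = 1"
    by (simp add: emeasure_space_1)
  finally have *: "(\<integral>\<^sup>+z. ennreal (?f z) \<partial>count_space UNIV) = 1" .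
  show ?thesis
    unfolding poisson_mixture_def
    by (rule pmf_embed_pmf[OF _ *]) (auto intro!: integral_nonneg_AE nonneg)
qed

lemma poisson_mixture_in_lattice_pmfs:
  "G \<in> probs_on (euclidean_space_meas d) (orthant d) \<Longrightarrow> poisson_mixture d G \<in> lattice_pmfs d"
  by (auto simp: lattice_pmfs_def set_pmf_iff pmf_poisson_mixture split: if_splits)


text \<open>The convention that the estimate is 0 where the mixture vanishes is \<open>x / 0 = 0\<close>.\<close>

definition bayes_estimator :: "nat \<Rightarrow> (nat \<Rightarrow> real) measure \<Rightarrow> (nat \<Rightarrow> nat) \<Rightarrow> nat \<Rightarrow> real" where
  "bayes_estimator d G y j =
     real (y j + 1) * pmf (poisson_mixture d G) (y(j := y j + 1)) / pmf (poisson_mixture d G) y"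

text \<open>An estimator maps the training sample, a list of observations, to a prior. The sample space is
  countable, so no measurability condition on the estimator is needed.\<close>

type_synonym estimator = "(nat \<Rightarrow> nat) list \<Rightarrow> (nat \<Rightarrow> real) measure"

definition regret :: "nat \<Rightarrow> nat \<Rightarrow> estimator \<Rightarrow> (nat \<Rightarrow> real) measure \<Rightarrow> ennreal" where
  "regret d n Ghat G =
     (\<integral>\<^sup>+(Ys, y). ennreal (\<Sum>j<d. (bayes_estimator d (Ghat Ys) y j - bayes_estimator d G y j)\<^sup>2)
        \<partial>pair_pmf (replicate_pmf n (poisson_mixture d G)) (poisson_mixture d G))"

definition worst_regret ::
    "nat \<Rightarrow> nat \<Rightarrow> estimator \<Rightarrow> (nat \<Rightarrow> real) measure set \<Rightarrow> ennreal" where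
  "worst_regret d n Ghat \<G> = (SUP G\<in>\<G>. regret d n Ghat G)"


type_synonym divergence = "(nat \<Rightarrow> nat) pmf \<Rightarrow> (nat \<Rightarrow> nat) pmf \<Rightarrow> ereal"

definition hellinger_sq :: "nat \<Rightarrow> divergence" where
  "hellinger_sq d p q = (\<Sum>\<^sub>\<infinity>y\<in>lattice_points d. ereal ((sqrt (pmf p y) - sqrt (pmf q y))\<^sup>2))"

text \<open>Division in \<^typ>\<open>ereal\<close> gives \<open>0 / 0 = 0\<close> and \<open>a / 0 = \<infinity>\<close> for \<open>a > 0\<close>, as usual for this divergence.\<close>

definition chi_sq :: "nat \<Rightarrow> divergence" where
  "chi_sq d p q = (\<Sum>\<^sub>\<infinity>y\<in>lattice_points d. ereal ((pmf p y - pmf q y)\<^sup>2) / ereal (pmf q y))"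

definition generalized_distance :: "nat \<Rightarrow> divergence \<Rightarrow> bool" where
  "generalized_distance d D \<longleftrightarrow>
     (\<forall>p\<in>lattice_pmfs d. \<forall>q\<in>lattice_pmfs d. 0 \<le> D p q \<and> (D p q = 0 \<longleftrightarrow> p = q))"

definition strictly_convex_on :: "real set \<Rightarrow> (real \<Rightarrow> ereal) \<Rightarrow> bool" where
  "strictly_convex_on S f \<longleftrightarrow>
     (\<forall>x\<in>S. \<forall>y\<in>S. \<forall>u\<in>{0<..<1}. x \<noteq> y \<longrightarrow>
        f ((1 - u) * x + u * y) < ereal (1 - u) * f x + ereal u * f y)"

text \<open>The sum of \<open>l\<close> is unconditional in the extended reals. Its terms may be negative, so
  its existence is part of the property.\<close>

definition decomposition_property :: "nat \<Rightarrow> divergence \<Rightarrow> bool" where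
  "decomposition_property d D \<longleftrightarrow>
     (\<exists>(t :: (nat \<Rightarrow> nat) pmf \<Rightarrow> real) (l :: real \<Rightarrow> real \<Rightarrow> ereal).
        (\<forall>a\<ge>0. \<forall>b\<ge>0. l a b \<noteq> -\<infinity>) \<and>
        (\<forall>a\<ge>0. \<forall>b>0. l a b \<noteq> \<infinity>) \<and>
        (\<forall>a>0. strict_antimono_on {0..} (l a) \<and> strictly_convex_on {0..} (l a) \<and>
               continuous_on {0..} (l a)) \<and>
        (\<forall>b\<ge>0. l 0 b = 0) \<and>
        (\<forall>q1\<in>lattice_pmfs d. \<forall>q2\<in>lattice_pmfs d.
           (\<lambda>y. l (pmf q1 y) (pmf q2 y)) summable_on lattice_points d \<and>
           D q1 q2 = ereal (t q1) + (\<Sum>\<^sub>\<infinity>y\<in>lattice_points d. l (pmf q1 y) (pmf q2 y))))"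

definition sandwich_property :: "real \<Rightarrow> real \<Rightarrow> nat \<Rightarrow> divergence \<Rightarrow> bool" where
  "sandwich_property \<kappa>1 \<kappa>2 d D \<longleftrightarrow>
     (\<forall>q1\<in>lattice_pmfs d. \<forall>q2\<in>lattice_pmfs d.
        ereal \<kappa>1 * hellinger_sq d q1 q2 \<le> D q1 q2 \<and> D q1 q2 \<le> ereal \<kappa>2 * chi_sq d q1 q2)"

definition empirical :: "(nat \<Rightarrow> nat) list \<Rightarrow> (nat \<Rightarrow> nat) pmf" where
  "empirical Ys = pmf_of_multiset (mset Ys)"

text \<open>Minimisers need not be unique: any selection of a minimiser, one for each sample, counts.\<close>

definition min_distance_estimator ::
    "nat \<Rightarrow> nat \<Rightarrow> divergence \<Rightarrow> (nat \<Rightarrow> real) set \<Rightarrow> estimator \<Rightarrow> bool" where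
  "min_distance_estimator d n D \<Theta> Ghat \<longleftrightarrow>
     (\<forall>Ys. length Ys = n \<and> set Ys \<subseteq> lattice_points d \<longrightarrow>
        is_arg_min (\<lambda>Q. D (empirical Ys) (poisson_mixture d Q))
          (\<lambda>Q. Q \<in> probs_on (euclidean_space_meas d) \<Theta>) (Ghat Ys))"

definition K_rate :: "real \<Rightarrow> nat \<Rightarrow> real" where
  "K_rate h n = min (max 1 h * (ln (real n) / ln (ln (real n)))) (h + ln (real n))"

end

theory Submission
  imports Defs
begin

text \<open>
  For a coordinate \<open>j\<close> the Bayes estimators of \<open>f = f\<^sub>G\<close> and \<open>g = f\<^sub>Q\<close> are the ratios
  \<open>(y\<^sub>j + 1) f(y + e\<^sub>j) / f(y)\<close> and \<open>(y\<^sub>j + 1) g(y + e\<^sub>j) / g(y)\<close>; when \<open>G\<close> and \<open>Q\<close> live on cubes of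
  side \<open>h\<close> and \<open>b\<close> they are bounded by \<open>h\<close> and \<open>b\<close>, and their squared distance in \<open>L\<^sup>2(f)\<close> is at most
  of order \<open>(h + b)(h + b + k) H\<^sup>2(f, g)\<close> plus the mass where \<open>y\<^sub>j \<ge> k\<close>. A general prior \<open>G\<close> is first
  truncated to a cube.

  The sandwich property and minimality bound \<open>H\<^sup>2(f, g)\<close> by a multiple of \<open>\<chi>\<^sup>2\<close> between the empirical
  distribution and \<open>f\<close>. On the event that all observations lie in \<open>{0, \<dots>, k - 1}\<^sup>d\<close> its mean is at most
  \<open>k\<^sup>d / n\<close> plus tail masses, each lattice point of the box contributing a variance of at most
  \<open>1 / n\<close>. The decomposition property forces the unconstrained minimiser to live on the cube spanned
  by the largest observation, so that \<open>b \<le> k\<close> on this event, while off the event \<open>b\<^sup>2\<close> is controlled by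
  the second moment of the tail. With \<open>k\<close> a large multiple of \<open>K\<close>, respectively of \<open>max {1, s} log n\<close>,
  Chernoff bounds make all tails negligible.
\<close>

section \<open>Ratio estimates\<close>

text \<open>The estimators divide by mixture values that may be arbitrarily small, and nothing
  bounds these from below. The substitute is that each ratio is a posterior mean, hence at most the
  side of the cube carrying its prior; this is why the supports of both priors matter throughout.
  The truncated part of \<open>G\<close> is left unnormalised, so that the two parts simply add up
  to \<open>f\<close>. The box event is forced: the contributions of order 1/n would add up to
  infinity whenever \<open>f\<close> charges infinitely many points, whereas on the event the
  empirical distribution vanishes outside the box and the terms there are just \<open>f y\<close>.
  Tail moments of order n^(-3) are required because one factor n is lost to the n observations,
  another to the d <= n coordinates, and 1/n has to remain. The Chernoff parameter is constant for
  the branch h + ln n of \<open>K_rate\<close>, proportional to ln ln n for the other branch, and of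
  order 1 / max {1, s} for subexponential priors. Constants end up in the base of a power whose
  exponent grows with d, which keeps them free of d.\<close>

lemma power2_add_le: "(x + y)\<^sup>2 \<le> 2 * x\<^sup>2 + 2 * (y::real)\<^sup>2"
  using zero_le_power2[of "x - y"] by (simp add: power2_eq_square algebra_simps)

lemma power2_diff_le: "0 \<le> x \<Longrightarrow> 0 \<le> y \<Longrightarrow> (x - y)\<^sup>2 \<le> x\<^sup>2 + (y::real)\<^sup>2"
  by (simp add: power2_eq_square algebra_simps)

text \<open>Turns plain differences into Hellinger terms; the price \<open>a + b\<close> is later
  cancelled by the common denominator of the two ratios.\<close>

lemma diff_sq_le_sqrt_diff_sq:
  assumes "0 \<le> a" "0 \<le> (b::real)"
  shows "(a - b)\<^sup>2 \<le> 2 * (a + b) * (sqrt a - sqrt b)\<^sup>2"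
proof -
  have "a - b = (sqrt a + sqrt b) * (sqrt a - sqrt b)"
    using assms by (simp add: algebra_simps)
  hence "(a - b)\<^sup>2 = (sqrt a + sqrt b)\<^sup>2 * (sqrt a - sqrt b)\<^sup>2"
    by (metis power_mult_distrib)
  also have "\<dots> \<le> (2 * (sqrt a)\<^sup>2 + 2 * (sqrt b)\<^sup>2) * (sqrt a - sqrt b)\<^sup>2"
    by (intro mult_right_mono power2_add_le) auto
  finally show ?thesis using assms by simp
qed

text \<open>Comparing both ratios with the common denominator \<open>a + b\<close> gives
  \<open>N a'/a - N b'/b = (N a'/a + N b'/b) (b - a)/(a + b) + 2 N (a' - b')/(a + b)\<close>.\<close>

lemma ratio_diff_sq_le:
  fixes a b a' b' N hA hB :: real
  assumes nn: "0 \<le> a" "0 \<le> b" "0 \<le> a'" "0 \<le> b'" "0 \<le> N" "0 \<le> hA" "0 \<le> hB"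
    and A: "N * a' \<le> hA * a" and B: "N * b' \<le> hB * b"
  shows "a * (N * b' / b - N * a' / a)\<^sup>2
    \<le> 4 * (hA + hB)\<^sup>2 * (sqrt a - sqrt b)\<^sup>2 + 16 * N * (hA + hB) * (sqrt a' - sqrt b')\<^sup>2"
proof (cases "a = 0")
  case True
  thus ?thesis using nn by (auto intro!: add_nonneg_nonneg mult_nonneg_nonneg)
next
  case False
  with nn have a: "a > 0" by simp
  define u where "u = N * a' / a"
  define v where "v = N * b' / b"
  have u: "0 \<le> u" "u \<le> hA" "u * a = N * a'"
    using nn A a by (auto simp: u_def field_simps)
  have v: "0 \<le> v" "v \<le> hB" "v * b = N * b'"
  proof -
    show "0 \<le> v" using nn by (simp add: v_def)
    show "v \<le> hB" using nn B by (cases "b = 0") (auto simp: v_def field_simps)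
    \<comment> \<open>For \<open>b = 0\<close> the quotient is 0 by convention, and \<open>B\<close>
      forces \<open>N * b' = 0\<close>, so the identity survives.\<close>
    show "v * b = N * b'" using nn B by (cases "b = 0") (auto simp: v_def dest: antisym)
  qed
  define s where "s = a + b"
  have s: "s > 0" "a \<le> s" using a nn by (auto simp: s_def)
  have "(u - v) * s = (u + v) * (b - a) + 2 * (N * (a' - b'))"
    using u(3) v(3) by (simp add: s_def algebra_simps)
  hence eq: "u - v = ((u + v) * (b - a) + 2 * (N * (a' - b'))) / s"
    using s by (simp add: field_simps)
  have "((u + v) * (b - a) + 2 * (N * (a' - b')))\<^sup>2
      \<le> 2 * ((u + v) * (b - a))\<^sup>2 + 2 * (2 * (N * (a' - b')))\<^sup>2"
    by (rule power2_add_le)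
  also have "\<dots> = 2 * (u + v)\<^sup>2 * (a - b)\<^sup>2 + 8 * N\<^sup>2 * (a' - b')\<^sup>2"
    by (simp add: power_mult_distrib power2_commute)
  also have "\<dots> \<le> 2 * (hA + hB)\<^sup>2 * (2 * s * (sqrt a - sqrt b)\<^sup>2)
      + 8 * N\<^sup>2 * (2 * (a' + b') * (sqrt a' - sqrt b')\<^sup>2)"
    unfolding s_def using u v nn
    by (intro add_mono mult_mono diff_sq_le_sqrt_diff_sq power_mono) auto
  \<comment> \<open>One of the two factors \<open>N\<close> is traded, through
    \<open>N * a' = u * a\<close> and \<open>N * b' = v * b\<close>, for the bounded ratios. Only a
    single \<open>N\<close> is left, hence later a factor k instead of its square.\<close>
  also have "8 * N\<^sup>2 * (2 * (a' + b') * (sqrt a' - sqrt b')\<^sup>2)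
      = 16 * N * (u * a + v * b) * (sqrt a' - sqrt b')\<^sup>2"
    unfolding u(3) v(3) by (simp add: power2_eq_square algebra_simps)
  also have "\<dots> \<le> 16 * N * ((hA + hB) * s) * (sqrt a' - sqrt b')\<^sup>2"
  proof -
    have "u * a \<le> (hA + hB) * a" "v * b \<le> (hA + hB) * b"
      using u(1,2) v(1,2) nn by (auto intro!: mult_right_mono)
    thus ?thesis using nn unfolding s_def distrib_left[of "hA + hB" a b]
      by (intro mult_right_mono mult_left_mono, intro add_mono) auto
  qed
  finally have *: "((u + v) * (b - a) + 2 * (N * (a' - b')))\<^sup>2
      \<le> s * (4 * (hA + hB)\<^sup>2 * (sqrt a - sqrt b)\<^sup>2 + 16 * N * (hA + hB) * (sqrt a' - sqrt b')\<^sup>2)"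
    (is "_ \<le> s * ?R") by (simp add: algebra_simps)
  have R: "0 \<le> ?R" using nn by auto
  have "a * (v - u)\<^sup>2 \<le> s * (u - v)\<^sup>2"
    using s by (subst power2_commute) (intro mult_right_mono, auto)
  also have "\<dots> = ((u + v) * (b - a) + 2 * (N * (a' - b')))\<^sup>2 / s"
    unfolding eq using s by (simp add: power2_eq_square)
  also have "\<dots> \<le> ?R"
    using * s by (simp add: divide_le_eq mult.commute)
  finally show ?thesis by (simp add: u_def v_def)
qed

text \<open>Fallback where \<open>N\<close> is too large or the Hellinger distance is not under
  control: the ratios lie in [0, \<open>hA\<close>] and [0, \<open>hB\<close>].\<close>

lemma ratio_diff_sq_le_crude:
  fixes a b a' b' N hA hB :: real
  assumes nn: "0 \<le> a" "0 \<le> b" "0 \<le> a'" "0 \<le> b'" "0 \<le> N" "0 \<le> hA" "0 \<le> hB"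
    and A: "N * a' \<le> hA * a" and B: "N * b' \<le> hB * b"
  shows "(N * b' / b - N * a' / a)\<^sup>2 \<le> (hA + hB)\<^sup>2"
proof -
  have "0 \<le> N * a' / a" "N * a' / a \<le> hA" "0 \<le> N * b' / b" "N * b' / b \<le> hB"
    using assms by (auto simp: divide_le_eq)
  thus ?thesis by (intro power2_le_iff_abs_le[THEN iffD2]) auto
qed

text \<open>Here \<open>a1\<close> and \<open>a2\<close> are the contributions to the mixture of the prior inside and outside a cube;
  \<open>m\<close> and \<open>M\<close> are the first two moments belonging to \<open>a2\<close>, so that \<open>m\<^sup>2 \<le> a2 M\<close>.\<close>

lemma truncated_ratio_diff_sq_le:
  fixes a1 a2 a1' m M N h :: real
  assumes nn: "0 \<le> a1" "0 \<le> a2" "0 \<le> a1'" "0 \<le> m" "0 \<le> M" "0 \<le> N" "0 \<le> h"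
    and A: "N * a1' \<le> h * a1" and m: "m\<^sup>2 \<le> a2 * M"
  shows "(a1 + a2) * ((N * a1' + m) / (a1 + a2) - N * a1' / a1)\<^sup>2 \<le> M + h\<^sup>2 * a2"
proof (cases "a1 + a2 = 0")
  case True
  thus ?thesis using nn by auto
next
  case False
  define s where "s = a1 + a2"
  have s: "s > 0" "a2 \<le> s" using False nn by (auto simp: s_def)
  define u where "u = N * a1' / a1"
  have u: "0 \<le> u" "u \<le> h" using nn A by (auto simp: u_def divide_le_eq)
  have ua: "u * a1 = N * a1'"
    using nn A by (cases "a1 = 0") (auto simp: u_def dest: antisym)
  \<comment> \<open>The contribution of \<open>a1\<close> cancels, so the error carries only
    quantities from outside the cube.\<close>
  have "(N * a1' + m) / s - u = (m - a2 * u) / s"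
    using s unfolding ua[symmetric] by (simp add: field_simps s_def)
  hence "s * ((N * a1' + m) / s - u)\<^sup>2 = (m - a2 * u)\<^sup>2 / s"
    using s by (simp add: power2_eq_square)
  also have "\<dots> \<le> (m\<^sup>2 + (a2 * u)\<^sup>2) / s"
    using s nn u by (intro divide_right_mono power2_diff_le) auto
  also have "\<dots> \<le> (a2 * M + a2 * (a2 * h\<^sup>2)) / s"
  proof -
    have "a2\<^sup>2 * u\<^sup>2 \<le> a2\<^sup>2 * h\<^sup>2"
      using u by (intro mult_left_mono power_mono) auto
    thus ?thesis using s m
      by (intro divide_right_mono add_mono) (auto simp: power2_eq_square mult_ac)
  qed
  also have "\<dots> = (a2 / s) * (M + a2 * h\<^sup>2)" by (simp add: algebra_simps add_divide_distrib)
  also have "\<dots> \<le> 1 * (M + a2 * h\<^sup>2)"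
    using s nn by (intro mult_right_mono) auto
  finally show ?thesis by (simp add: s_def u_def mult.commute)
qed

lemma sqrt_diff_sq_triangle:
  "(sqrt a - sqrt c)\<^sup>2 \<le> 2 * (sqrt a - sqrt b)\<^sup>2 + 2 * (sqrt b - sqrt c)\<^sup>2"
  using power2_add_le[of "sqrt a - sqrt b" "sqrt b - sqrt c"] by simp

text \<open>Expanding the square leaves 2a + b minus a cross term that is at least 2a. It bounds the
  Hellinger distance from the truncated part to the full mixture by the removed mass.\<close>

lemma sqrt_diff_sq_add_le: "0 \<le> a \<Longrightarrow> 0 \<le> b \<Longrightarrow> (sqrt a - sqrt (a + b))\<^sup>2 \<le> b"
proof -
  assume *: "0 \<le> a" "0 \<le> b"
  have "a \<le> sqrt a * sqrt (a + b)"
    using * by (metis add_increasing2 mult_left_mono order_refl real_sqrt_ge_0_iff real_sqrt_le_iff real_sqrt_mult_self abs_of_nonneg)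
  thus ?thesis using * by (simp add: power2_diff)
qed

section \<open>Poisson mixtures\<close>

lemma lattice_points_upd: "y \<in> lattice_points d \<Longrightarrow> j < d \<Longrightarrow> y(j := k) \<in> lattice_points d"
  by (auto simp: lattice_points_def PiE_def extensional_def)

lemma cube_subset_orthant: "cube d h \<subseteq> orthant d"
  by (auto simp: cube_def orthant_def PiE_def)

lemma sets_cube [measurable]: "cube d h \<in> sets (euclidean_space_meas d)"
  unfolding cube_def by (intro sets_PiM_I_finite) auto

lemma sets_orthant [measurable]: "orthant d \<in> sets (euclidean_space_meas d)"
  unfolding orthant_def by (intro sets_PiM_I_finite) auto

lemma poisson_likelihood_le_1:
  assumes "\<theta> \<in> orthant d" "y \<in> lattice_points d"
  shows "poisson_likelihood d \<theta> y \<le> 1"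
proof -
  have "ennreal (poisson_likelihood d \<theta> y) \<le> (\<integral>\<^sup>+x. ennreal (poisson_likelihood d \<theta> x) \<partial>count_space (lattice_points d))"
    using assms(2) by (intro nn_integral_ge_point)
  thus ?thesis by (simp add: poisson_likelihood_sum[OF assms(1)])
qed

text \<open>The Poisson recursion. It trades a factor \<open>\<theta> j\<close> under the integral
  for a lattice shift, which makes the Bayes estimator a posterior mean (Robbins' formula).\<close>

lemma poisson_likelihood_Suc:
  assumes "j < d"
  shows "real (y j + 1) * poisson_likelihood d \<theta> (y(j := y j + 1)) = \<theta> j * poisson_likelihood d \<theta> y"
proof -
  have j: "j \<in> {..<d}" using assms by simp
  have *: "poisson_likelihood d \<theta> z = exp (- \<theta> j) * \<theta> j ^ z j / fact (z j) *
      (\<Prod>i\<in>{..<d}-{j}. exp (- \<theta> i) * \<theta> i ^ z i / fact (z i))" for z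
    unfolding poisson_likelihood_def by (rule prod.remove[OF _ j]) simp
  have "(\<Prod>i\<in>{..<d}-{j}. exp (- \<theta> i) * \<theta> i ^ (y(j := y j + 1)) i / fact ((y(j := y j + 1)) i)) =
      (\<Prod>i\<in>{..<d}-{j}. exp (- \<theta> i) * \<theta> i ^ y i / fact (y i))"
    by (intro prod.cong) auto
  thus ?thesis unfolding * by (simp add: divide_simps) (simp add: algebra_simps)?
qed

lemma nn_integral_pmf_lattice:
  assumes "p \<in> lattice_pmfs d"
  shows "(\<integral>\<^sup>+y. F y \<partial>measure_pmf p) = (\<integral>\<^sup>+y. ennreal (pmf p y) * F y \<partial>count_space (lattice_points d))"
proof -
  have "(\<integral>\<^sup>+y. ennreal (pmf p y) * F y \<partial>count_space UNIV) =
      (\<integral>\<^sup>+y. ennreal (pmf p y) * F y \<partial>count_space (lattice_points d))"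
    using assms by (intro nn_integral_count_space_eq) (auto simp: lattice_pmfs_def set_pmf_iff)
  thus ?thesis by (simp add: nn_integral_measure_pmf)
qed

section \<open>Mixtures under a reweighted prior\<close>

locale poisson_prior =
  fixes d :: nat and G :: "(nat \<Rightarrow> real) measure"
  assumes prior: "G \<in> probs_on (euclidean_space_meas d) (orthant d)"
begin

lemma sets_G [measurable_cong]: "sets G = sets (euclidean_space_meas d)"
  using prior by (simp add: probs_on_def)

lemma AE_orthant: "AE \<theta> in G. \<theta> \<in> orthant d"
  using prior by (simp add: probs_on_def)

sublocale prob_space G
  using prior by (simp add: probs_on_def)

abbreviation f :: "(nat \<Rightarrow> nat) \<Rightarrow> real" where
  "f y \<equiv> pmf (poisson_mixture d G) y"

text \<open>The unnormalised mixture with the prior reweighted by \<open>w\<close>: the constant 1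
  gives \<open>f\<close>, the indicator of a cube its truncated part, and powers of
  \<open>\<theta> j\<close> the moments entering the Bayes estimator.\<close>

definition wmix :: "((nat \<Rightarrow> real) \<Rightarrow> real) \<Rightarrow> (nat \<Rightarrow> nat) \<Rightarrow> real" where
  "wmix w y = (\<integral>\<theta>. w \<theta> * poisson_likelihood d \<theta> y \<partial>G)"

text \<open>Integrability is asked of \<open>w\<close> times the likelihood, because unbounded
  weights such as \<open>(\<theta> j)\<^sup>2\<close> need not be integrable under the prior
  itself.\<close>

definition weight :: "((nat \<Rightarrow> real) \<Rightarrow> real) \<Rightarrow> bool" where
  "weight w \<longleftrightarrow> w \<in> borel_measurable G \<and> (AE \<theta> in G. 0 \<le> w \<theta>) \<and>
     (\<forall>y\<in>lattice_points d. integrable G (\<lambda>\<theta>. w \<theta> * poisson_likelihood d \<theta> y))"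

lemma mixture_in_lattice_pmfs: "poisson_mixture d G \<in> lattice_pmfs d"
  by (rule poisson_mixture_in_lattice_pmfs[OF prior])

lemma measurable_coordinate: "j < d \<Longrightarrow> (\<lambda>\<theta>. \<theta> j) \<in> borel_measurable G"
  by measurable

lemma weight_bounded:
  assumes [measurable]: "w \<in> borel_measurable G" and "\<And>\<theta>. 0 \<le> w \<theta>" "\<And>\<theta>. w \<theta> \<le> 1"
  shows "weight w"
  unfolding weight_def
proof (intro conjI ballI)
  fix y assume y: "y \<in> lattice_points d"
  show "integrable G (\<lambda>\<theta>. w \<theta> * poisson_likelihood d \<theta> y)"
  proof (rule integrable_const_bound[where B = 1])
    show "AE \<theta> in G. norm (w \<theta> * poisson_likelihood d \<theta> y) \<le> 1"
      using AE_orthant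
    proof eventually_elim
      case (elim \<theta>)
      hence "0 \<le> poisson_likelihood d \<theta> y" "poisson_likelihood d \<theta> y \<le> 1"
        using y by (auto intro: poisson_likelihood_nonneg poisson_likelihood_le_1)
      thus ?case using assms(2,3)[of \<theta>] by (simp add: mult_le_one)
    qed
  qed measurable
qed (use assms in auto)

text \<open>By the Poisson recursion the extra factor \<open>\<theta> j\<close> costs only a shift
  of \<open>y\<close>, so no moment assumption on the prior arises.\<close>

lemma weight_times_coordinate:
  assumes w: "weight w" and j: "j < d"
  shows "weight (\<lambda>\<theta>. w \<theta> * \<theta> j)"
proof -
  have [measurable]: "w \<in> borel_measurable G" using w by (simp add: weight_def)
  have "AE \<theta> in G. 0 \<le> w \<theta>" using w by (simp add: weight_def)
  hence "AE \<theta> in G. 0 \<le> w \<theta> * \<theta> j"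
    using AE_orthant by eventually_elim (auto dest: orthant_nonneg[OF _ j])
  moreover have "integrable G (\<lambda>\<theta>. w \<theta> * \<theta> j * poisson_likelihood d \<theta> y)" if y: "y \<in> lattice_points d" for y
  proof -
    have "integrable G (\<lambda>\<theta>. real (y j + 1) * (w \<theta> * poisson_likelihood d \<theta> (y(j := y j + 1))))"
      using w lattice_points_upd[OF y j] by (auto simp: weight_def)
    also have "(\<lambda>\<theta>. real (y j + 1) * (w \<theta> * poisson_likelihood d \<theta> (y(j := y j + 1)))) =
        (\<lambda>\<theta>. w \<theta> * (real (y j + 1) * poisson_likelihood d \<theta> (y(j := y j + 1))))"
      by (simp add: mult_ac)
    finally show ?thesis unfolding poisson_likelihood_Suc[OF j] by (simp add: mult_ac)
  qed
  ultimately show ?thesis using j by (auto simp: weight_def)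
qed

lemma wmix_Suc:
  assumes "j < d"
  shows "real (y j + 1) * wmix w (y(j := y j + 1)) = wmix (\<lambda>\<theta>. w \<theta> * \<theta> j) y"
proof -
  have "real (y j + 1) * wmix w (y(j := y j + 1)) =
      (\<integral>\<theta>. w \<theta> * (real (y j + 1) * poisson_likelihood d \<theta> (y(j := y j + 1))) \<partial>G)"
    unfolding wmix_def by (subst integral_mult_right_zero[symmetric]) (simp add: mult_ac)
  thus ?thesis unfolding poisson_likelihood_Suc[OF assms] by (simp add: wmix_def mult_ac)
qed

lemma wmix_nonneg: "weight w \<Longrightarrow> 0 \<le> wmix w y"
  unfolding wmix_def
proof (rule integral_nonneg_AE)
  assume "weight w"
  hence "AE \<theta> in G. 0 \<le> w \<theta>" by (simp add: weight_def)
  thus "AE \<theta> in G. 0 \<le> w \<theta> * poisson_likelihood d \<theta> y"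
    using AE_orthant by eventually_elim (intro mult_nonneg_nonneg poisson_likelihood_nonneg)
qed

lemma wmix_mono:
  assumes "weight v" "weight w" "AE \<theta> in G. v \<theta> \<le> w \<theta>" "y \<in> lattice_points d"
  shows "wmix v y \<le> wmix w y"
  unfolding wmix_def
proof (rule integral_mono_AE)
  show "AE \<theta> in G. v \<theta> * poisson_likelihood d \<theta> y \<le> w \<theta> * poisson_likelihood d \<theta> y"
    using assms(3) AE_orthant by eventually_elim (auto intro!: mult_right_mono poisson_likelihood_nonneg)
qed (use assms in \<open>auto simp: weight_def\<close>)

lemma wmix_add:
  assumes "weight v" "weight w" "y \<in> lattice_points d"
  shows "wmix (\<lambda>\<theta>. v \<theta> + w \<theta>) y = wmix v y + wmix w y"
  using assms by (simp add: wmix_def weight_def distrib_right)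

lemma wmix_cmult: "wmix (\<lambda>\<theta>. c * w \<theta>) y = c * wmix w y"
  by (simp add: wmix_def mult.assoc)

lemma mixture_eq_wmix: "y \<in> lattice_points d \<Longrightarrow> f y = wmix (\<lambda>_. 1) y"
  by (simp add: pmf_poisson_mixture[OF prior] wmix_def)

text \<open>Tonelli with a free factor \<open>c\<close> in y: the constant 1 gives total masses, an
  exponential of \<open>y j\<close> gives Chernoff bounds.\<close>

lemma nn_integral_wmix_weighted:
  assumes w: "weight w"
  shows "(\<integral>\<^sup>+y. ennreal (wmix w y) * c y \<partial>count_space (lattice_points d)) =
    (\<integral>\<^sup>+\<theta>. ennreal (w \<theta>) * (\<integral>\<^sup>+y. ennreal (poisson_likelihood d \<theta> y) * c y \<partial>count_space (lattice_points d)) \<partial>G)"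
proof -
  have [measurable]: "w \<in> borel_measurable G" using w by (simp add: weight_def)
  have wn: "AE \<theta> in G. 0 \<le> w \<theta>" using w by (simp add: weight_def)
  have "ennreal (wmix w y) = (\<integral>\<^sup>+\<theta>. ennreal (w \<theta>) * ennreal (poisson_likelihood d \<theta> y) \<partial>G)"
    if y: "y \<in> lattice_points d" for y
  proof -
    have "(\<integral>\<^sup>+\<theta>. ennreal (w \<theta> * poisson_likelihood d \<theta> y) \<partial>G) = ennreal (wmix w y)"
      unfolding wmix_def
    proof (rule nn_integral_eq_integral)
      show "AE \<theta> in G. 0 \<le> w \<theta> * poisson_likelihood d \<theta> y"
        using wn AE_orthant by eventually_elim (intro mult_nonneg_nonneg poisson_likelihood_nonneg)
    qed (use w y in \<open>auto simp: weight_def\<close>)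
    moreover have "(\<integral>\<^sup>+\<theta>. ennreal (w \<theta> * poisson_likelihood d \<theta> y) \<partial>G) =
        (\<integral>\<^sup>+\<theta>. ennreal (w \<theta>) * ennreal (poisson_likelihood d \<theta> y) \<partial>G)"
      by (intro nn_integral_cong_AE, use wn in eventually_elim) (simp add: ennreal_mult')
    ultimately show ?thesis by simp
  qed
  hence "(\<integral>\<^sup>+y. ennreal (wmix w y) * c y \<partial>count_space (lattice_points d)) =
      (\<integral>\<^sup>+y. \<integral>\<^sup>+\<theta>. ennreal (w \<theta>) * ennreal (poisson_likelihood d \<theta> y) * c y \<partial>G \<partial>count_space (lattice_points d))"
    by (intro nn_integral_cong) (simp add: nn_integral_multc)
  also have "\<dots> = (\<integral>\<^sup>+\<theta>. \<integral>\<^sup>+y. ennreal (w \<theta>) * ennreal (poisson_likelihood d \<theta> y) * c y \<partial>count_space (lattice_points d) \<partial>G)"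
    using countable_lattice_points by (intro nn_integral_count_space_nn_integral[symmetric]) auto
  also have "\<dots> = (\<integral>\<^sup>+\<theta>. ennreal (w \<theta>) * (\<integral>\<^sup>+y. ennreal (poisson_likelihood d \<theta> y) * c y \<partial>count_space (lattice_points d)) \<partial>G)"
    by (intro nn_integral_cong) (simp add: nn_integral_cmult[symmetric] mult.assoc)
  finally show ?thesis .
qed

lemma nn_integral_wmix:
  assumes w: "weight w"
  shows "(\<integral>\<^sup>+y. ennreal (wmix w y) \<partial>count_space (lattice_points d)) = (\<integral>\<^sup>+\<theta>. ennreal (w \<theta>) \<partial>G)"
proof -
  have "(\<integral>\<^sup>+y. ennreal (wmix w y) * 1 \<partial>count_space (lattice_points d)) = (\<integral>\<^sup>+\<theta>. ennreal (w \<theta>) \<partial>G)"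
    unfolding nn_integral_wmix_weighted[OF w]
    by (intro nn_integral_cong_AE, use AE_orthant in eventually_elim) (simp add: poisson_likelihood_sum)
  thus ?thesis by simp
qed

text \<open>Cauchy-Schwarz for the measure with density \<open>w\<close> times likelihood, obtained
  from the nonnegative quadratic in t given by the integral of
  \<open>(\<theta> j - t)\<^sup>2\<close>.\<close>

lemma wmix_square_le:
  assumes w: "weight w" and j: "j < d" and y: "y \<in> lattice_points d"
  shows "(wmix (\<lambda>\<theta>. w \<theta> * \<theta> j) y)\<^sup>2 \<le> wmix w y * wmix (\<lambda>\<theta>. w \<theta> * (\<theta> j)\<^sup>2) y"
proof -
  define m where "m = wmix (\<lambda>\<theta>. w \<theta> * \<theta> j) y"
  define M where "M = wmix (\<lambda>\<theta>. w \<theta> * (\<theta> j)\<^sup>2) y"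
  define u where "u = wmix w y"
  note w1 = weight_times_coordinate[OF w j]
  have w2: "weight (\<lambda>\<theta>. w \<theta> * (\<theta> j)\<^sup>2)"
    using weight_times_coordinate[OF w1 j] by (simp add: power2_eq_square mult.assoc)
  note ints = w[unfolded weight_def] w1[unfolded weight_def] w2[unfolded weight_def]
  have wn: "AE \<theta> in G. 0 \<le> w \<theta>" using w by (simp add: weight_def)
  have quad: "0 \<le> u * t\<^sup>2 - 2 * t * m + M" for t
  proof -
    have "0 \<le> (\<integral>\<theta>. (\<theta> j - t)\<^sup>2 * (w \<theta> * poisson_likelihood d \<theta> y) \<partial>G)"
      by (rule integral_nonneg_AE, use wn AE_orthant in eventually_elim)
        (auto intro!: mult_nonneg_nonneg poisson_likelihood_nonneg)
    also have "\<dots> = (\<integral>\<theta>. t\<^sup>2 * (w \<theta> * poisson_likelihood d \<theta> y) - 2 * t * (w \<theta> * \<theta> j * poisson_likelihood d \<theta> y)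
        + w \<theta> * (\<theta> j)\<^sup>2 * poisson_likelihood d \<theta> y \<partial>G)"
      by (intro Bochner_Integration.integral_cong) (auto simp: power2_eq_square algebra_simps)
    also have "\<dots> = u * t\<^sup>2 - 2 * t * m + M"
      using ints y by (simp add: u_def m_def M_def wmix_def)
    finally show ?thesis .
  qed
  have un: "0 \<le> u" "0 \<le> M" using wmix_nonneg[OF w] wmix_nonneg[OF w2] by (auto simp: u_def M_def)
  have "m\<^sup>2 \<le> u * M"
  proof (cases "u = 0")
    case True
    \<comment> \<open>The quadratic degenerates to the affine function M - 2tm, which stays
      nonnegative only if its slope vanishes.\<close>
    have "m = 0"
    proof (rule ccontr)
      assume "m \<noteq> 0"
      define t where "t = (M + 1) / (2 * m)"
      have "2 * t * m = M + 1" using \<open>m \<noteq> 0\<close> by (simp add: t_def)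
      thus False using quad[of t] True by simp
    qed
    thus ?thesis using True by simp
  next
    case False
    hence "0 \<le> u * (u * (m/u)\<^sup>2 - 2 * (m/u) * m + M)"
      by (intro mult_nonneg_nonneg quad un(1))
    also have "\<dots> = u * M - m\<^sup>2" using False by (simp add: power2_eq_square field_simps)
    finally show ?thesis by simp
  qed
  thus ?thesis by (simp add: m_def M_def u_def)
qed

end

text \<open>Stated for arbitrary functions, since the truncated part of a mixture is not a
  probability mass function; values in \<open>ennreal\<close> suit the integrals over the
  sample.\<close>

definition hellinger :: "nat \<Rightarrow> ((nat \<Rightarrow> nat) \<Rightarrow> real) \<Rightarrow> ((nat \<Rightarrow> nat) \<Rightarrow> real) \<Rightarrow> ennreal" where
  "hellinger d a b = (\<integral>\<^sup>+y. ennreal ((sqrt (a y) - sqrt (b y))\<^sup>2) \<partial>count_space (lattice_points d))"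

lemma hellinger_triangle: "hellinger d a c \<le> 2 * hellinger d a b + 2 * hellinger d b c"
proof -
  have "hellinger d a c \<le> (\<integral>\<^sup>+y. 2 * ennreal ((sqrt (a y) - sqrt (b y))\<^sup>2)
      + 2 * ennreal ((sqrt (b y) - sqrt (c y))\<^sup>2) \<partial>count_space (lattice_points d))"
    unfolding hellinger_def
  proof (intro nn_integral_mono)
    fix y
    have "ennreal ((sqrt (a y) - sqrt (c y))\<^sup>2) \<le>
        ennreal (2 * (sqrt (a y) - sqrt (b y))\<^sup>2 + 2 * (sqrt (b y) - sqrt (c y))\<^sup>2)"
      by (intro ennreal_leI sqrt_diff_sq_triangle)
    thus "ennreal ((sqrt (a y) - sqrt (c y))\<^sup>2) \<le> 2 * ennreal ((sqrt (a y) - sqrt (b y))\<^sup>2)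
      + 2 * ennreal ((sqrt (b y) - sqrt (c y))\<^sup>2)"
      by (simp add: ennreal_plus ennreal_mult)
  qed
  thus ?thesis by (simp add: hellinger_def nn_integral_add nn_integral_cmult)
qed

lemma hellinger_commute: "hellinger d a b = hellinger d b a"
  by (simp add: hellinger_def power2_commute)

text \<open>The shift is injective and maps the lattice into itself, so the Hellinger terms at y +
  e_j sum to at most the whole Hellinger distance.\<close>

lemma nn_integral_lattice_shift_le:
  assumes j: "j < d"
  shows "(\<integral>\<^sup>+y. F (y(j := y j + 1)) \<partial>count_space (lattice_points d)) \<le> (\<integral>\<^sup>+y. F y \<partial>count_space (lattice_points d))"
proof -
  let ?s = "\<lambda>y::nat\<Rightarrow>nat. y(j := y j + 1)"
  have "inj_on ?s (lattice_points d)"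
  proof (rule inj_onI)
    fix x y :: "nat \<Rightarrow> nat" assume eq: "?s x = ?s y"
    have "x i = y i" for i using fun_cong[OF eq, of i] by (cases "i = j") auto
    thus "x = y" by auto
  qed
  hence "bij_betw ?s (lattice_points d) (?s ` lattice_points d)" by (simp add: bij_betw_def)
  hence "(\<integral>\<^sup>+y. F (?s y) \<partial>count_space (lattice_points d)) = (\<integral>\<^sup>+y. F y \<partial>count_space (?s ` lattice_points d))"
    by (rule nn_integral_bij_count_space)
  also have "\<dots> \<le> (\<integral>\<^sup>+y. F y \<partial>count_space (lattice_points d))"
  proof -
    define B where "B = ?s ` lattice_points d"
    have "B \<subseteq> lattice_points d" using j by (auto simp: B_def intro: lattice_points_upd)
    hence "(\<integral>\<^sup>+y. F y \<partial>count_space B) \<le> (\<integral>\<^sup>+y. F y \<partial>count_space (lattice_points d))"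
      by (simp add: nn_integral_count_space_indicator) (intro nn_integral_mono, auto simp: indicator_def)
    thus ?thesis by (simp add: B_def)
  qed
  finally show ?thesis .
qed

text \<open>If \<open>y j < k\<close>, the factor \<open>y j + 1\<close> is at most \<open>k\<close>
  and the refined ratio bound applies. From \<open>k\<close> on only the crude bound is left, paid
  for by the tail mass of \<open>a\<close>.\<close>

lemma ratio_diff_sq_sum_le:
  fixes a b :: "(nat \<Rightarrow> nat) \<Rightarrow> real" and hA hB :: real
  assumes nn: "\<And>y. y \<in> lattice_points d \<Longrightarrow> 0 \<le> a y" "\<And>y. y \<in> lattice_points d \<Longrightarrow> 0 \<le> b y" "0 \<le> hA" "0 \<le> hB"
    and A: "\<And>y. y \<in> lattice_points d \<Longrightarrow> real (y j + 1) * a (y(j := y j + 1)) \<le> hA * a y"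
    and B: "\<And>y. y \<in> lattice_points d \<Longrightarrow> real (y j + 1) * b (y(j := y j + 1)) \<le> hB * b y"
    and j: "j < d"
  shows "(\<integral>\<^sup>+y. ennreal (a y * (real (y j + 1) * b (y(j := y j + 1)) / b y - real (y j + 1) * a (y(j := y j + 1)) / a y)\<^sup>2)
        \<partial>count_space (lattice_points d))
      \<le> ennreal (4 * (hA + hB)\<^sup>2 + 16 * real k * (hA + hB)) * hellinger d a b +
        ennreal ((hA + hB)\<^sup>2) * (\<integral>\<^sup>+y. ennreal (a y) * indicator {y. k \<le> y j} y \<partial>count_space (lattice_points d))"
proof -
  let ?e = "\<lambda>y. ennreal ((sqrt (a y) - sqrt (b y))\<^sup>2)"
  have "(\<integral>\<^sup>+y. ennreal (a y * (real (y j + 1) * b (y(j := y j + 1)) / b y - real (y j + 1) * a (y(j := y j + 1)) / a y)\<^sup>2)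
        \<partial>count_space (lattice_points d))
      \<le> (\<integral>\<^sup>+y. ennreal (4 * (hA + hB)\<^sup>2) * ?e y + ennreal (16 * real k * (hA + hB)) * ?e (y(j := y j + 1))
         + ennreal ((hA + hB)\<^sup>2) * (ennreal (a y) * indicator {y. k \<le> y j} y) \<partial>count_space (lattice_points d))"
  proof (intro nn_integral_mono)
    fix y assume "y \<in> space (count_space (lattice_points d))"
    hence y: "y \<in> lattice_points d" by simp
    let ?y = "y(j := y j + 1)"
    have y': "?y \<in> lattice_points d" using y j by (rule lattice_points_upd)
    let ?D = "real (y j + 1) * b ?y / b y - real (y j + 1) * a ?y / a y"
    show "ennreal (a y * ?D\<^sup>2) \<le> ennreal (4 * (hA + hB)\<^sup>2) * ?e y + ennreal (16 * real k * (hA + hB)) * ?e ?y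
         + ennreal ((hA + hB)\<^sup>2) * (ennreal (a y) * indicator {y. k \<le> y j} y)"
    proof (cases "k \<le> y j")
      case True
      have "a y * ?D\<^sup>2 \<le> (hA + hB)\<^sup>2 * a y"
        using nn y y' A[OF y] B[OF y]
        by (subst mult.commute, intro mult_right_mono ratio_diff_sq_le_crude) auto
      hence "ennreal (a y * ?D\<^sup>2) \<le> ennreal ((hA + hB)\<^sup>2 * a y)" by (rule ennreal_leI)
      thus ?thesis using True nn y by (simp add: ennreal_mult add_increasing)
    next
      case False
      have "a y * ?D\<^sup>2 \<le> 4 * (hA + hB)\<^sup>2 * (sqrt (a y) - sqrt (b y))\<^sup>2
          + 16 * real (y j + 1) * (hA + hB) * (sqrt (a ?y) - sqrt (b ?y))\<^sup>2"
        using nn y y' A[OF y] B[OF y] by (intro ratio_diff_sq_le) auto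
      also have "\<dots> \<le> 4 * (hA + hB)\<^sup>2 * (sqrt (a y) - sqrt (b y))\<^sup>2
          + 16 * real k * (hA + hB) * (sqrt (a ?y) - sqrt (b ?y))\<^sup>2"
        using False nn(3,4) by (intro add_left_mono mult_right_mono mult_left_mono) auto
      finally have "ennreal (a y * ?D\<^sup>2) \<le> ennreal (4 * (hA + hB)\<^sup>2 * (sqrt (a y) - sqrt (b y))\<^sup>2
          + 16 * real k * (hA + hB) * (sqrt (a ?y) - sqrt (b ?y))\<^sup>2)" by (rule ennreal_leI)
      also have "\<dots> = ennreal (4 * (hA + hB)\<^sup>2) * ?e y + ennreal (16 * real k * (hA + hB)) * ?e ?y"
        using nn(3,4) by (simp only: ennreal_plus ennreal_mult mult_nonneg_nonneg zero_le_power2 add_nonneg_nonneg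
          of_nat_0_le_iff zero_le_numeral)
      finally show ?thesis using False by simp
    qed
  qed
  also have "\<dots> = ennreal (4 * (hA + hB)\<^sup>2) * hellinger d a b
      + ennreal (16 * real k * (hA + hB)) * (\<integral>\<^sup>+y. ?e (y(j := y j + 1)) \<partial>count_space (lattice_points d))
      + ennreal ((hA + hB)\<^sup>2) * (\<integral>\<^sup>+y. ennreal (a y) * indicator {y. k \<le> y j} y \<partial>count_space (lattice_points d))"
    by (simp add: nn_integral_add nn_integral_cmult hellinger_def)
  also have "\<dots> \<le> ennreal (4 * (hA + hB)\<^sup>2) * hellinger d a b
      + ennreal (16 * real k * (hA + hB)) * hellinger d a b
      + ennreal ((hA + hB)\<^sup>2) * (\<integral>\<^sup>+y. ennreal (a y) * indicator {y. k \<le> y j} y \<partial>count_space (lattice_points d))"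
    unfolding hellinger_def by (intro add_mono mult_left_mono nn_integral_lattice_shift_le[OF j] order.refl) auto
  finally show ?thesis
    using nn(3,4) by (simp add: ennreal_plus distrib_right)
qed

section \<open>Coordinate regret in terms of Hellinger distance and truncation error\<close>

context poisson_prior
begin

text \<open>The restricted prior only sees \<open>\<theta> j \<le> h\<close>, so its posterior mean
  is at most \<open>h\<close>.\<close>

lemma wmix_indicator_cube:
  assumes "0 \<le> h" "y \<in> lattice_points d" "j < d"
  shows "real (y j + 1) * wmix (indicator (cube d h)) (y(j := y j + 1)) \<le> h * wmix (indicator (cube d h)) y"
proof -
  have w: "weight (indicator (cube d h))" "weight (\<lambda>\<theta>. h * indicator (cube d h) \<theta>)"
    using weight_bounded[of "indicator (cube d h)"] by (auto simp: weight_def mult.assoc assms(1))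
  have "wmix (\<lambda>\<theta>. indicator (cube d h) \<theta> * \<theta> j) y \<le> wmix (\<lambda>\<theta>. h * indicator (cube d h) \<theta>) y"
    using assms by (intro wmix_mono weight_times_coordinate w)
      (auto simp: indicator_def cube_def PiE_def Pi_def intro!: AE_I2)
  thus ?thesis unfolding wmix_Suc[OF assms(3)] wmix_cmult .
qed

lemma mixture_split:
  assumes "A \<in> sets G" "y \<in> lattice_points d"
  shows "f y = wmix (indicator A) y + wmix (indicator (- A)) y"
proof -
  have [measurable]: "A \<in> sets G" by fact
  have "f y = wmix (\<lambda>\<theta>. indicator A \<theta> + indicator (- A) \<theta>) y"
    unfolding mixture_eq_wmix[OF assms(2)] by (intro arg_cong2[where f = wmix]) (auto simp: indicator_def)
  also have "\<dots> = wmix (indicator A) y + wmix (indicator (- A)) y"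
    using assms by (intro wmix_add weight_bounded) (auto simp: indicator_def)
  finally show ?thesis .
qed

lemma mixture_Suc_le:
  assumes "AE \<theta> in G. \<theta> \<in> cube d b" "0 \<le> b" "y \<in> lattice_points d" "j < d"
  shows "real (y j + 1) * f (y(j := y j + 1)) \<le> b * f y"
proof -
  have "f z = wmix (indicator (cube d b)) z" if "z \<in> lattice_points d" for z
    unfolding mixture_eq_wmix[OF that] wmix_def using assms(1)
    by (intro integral_cong_AE) (auto simp: indicator_def elim!: eventually_mono)
  thus ?thesis using wmix_indicator_cube[OF assms(2-)] assms(3,4) by (simp add: lattice_points_upd del: fun_upd_apply)
qed

text \<open>The ratio \<open>t1\<close> of the truncated part is put between the two estimators: its
  distance to that of \<open>G\<close> costs the mass and second moment outside the cube, its
  distance to that of \<open>Q\<close> is a comparison of two bounded ratios. The fine bound is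
  meant for samples in the box, the crude one for all others.\<close>

lemma bayes_regret_le:
  fixes h b :: real
  assumes Q: "Q \<in> probs_on (euclidean_space_meas d) (cube d b)" and hb: "0 \<le> h" "0 \<le> b" and j: "j < d"
  defines "\<delta> \<equiv> \<integral>\<^sup>+\<theta>. indicator (- cube d h) \<theta> \<partial>G"
    and "m \<equiv> \<integral>\<^sup>+\<theta>. ennreal ((\<theta> j)\<^sup>2) * indicator (- cube d h) \<theta> \<partial>G"
    and "R \<equiv> \<integral>\<^sup>+y. ennreal ((bayes_estimator d Q y j - bayes_estimator d G y j)\<^sup>2) \<partial>measure_pmf (poisson_mixture d G)"
  shows "R \<le> ennreal (8 * (h + b)\<^sup>2 + 32 * real k * (h + b)) * (2 * hellinger d f (pmf (poisson_mixture d Q)) + 2 * \<delta>)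
      + ennreal (2 * (h + b)\<^sup>2) * (\<integral>\<^sup>+y. ennreal (f y) * indicator {y. k \<le> y j} y \<partial>count_space (lattice_points d))
      + ennreal (2 * (h + b)\<^sup>2) * \<delta> + (2 * m + ennreal (2 * h\<^sup>2) * \<delta>)" (is ?fine)
    and "R \<le> ennreal (2 * (h + b)\<^sup>2) + (2 * m + ennreal (2 * h\<^sup>2) * \<delta>)" (is ?crude)
proof -
  let ?L = "lattice_points d"
  interpret Q: poisson_prior d Q
    using Q cube_subset_orthant by unfold_locales (auto simp: probs_on_def elim!: eventually_mono)
  let ?A = "cube d h"
  have sA: "?A \<in> sets G" by measurable
  have wA: "weight (indicator ?A)" and wB: "weight (indicator (- ?A))"
    by (auto intro!: weight_bounded)
  note wB1 = weight_times_coordinate[OF wB j]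
  have wB2: "weight (\<lambda>\<theta>. indicator (- ?A) \<theta> * (\<theta> j)\<^sup>2)"
    using weight_times_coordinate[OF wB1 j] by (simp add: power2_eq_square mult.assoc)
  define f1 where "f1 = wmix (indicator ?A)"
  define f2 where "f2 = wmix (indicator (- ?A))"
  define M where "M = wmix (\<lambda>\<theta>. indicator (- ?A) \<theta> * (\<theta> j)\<^sup>2)"
  define t1 where "t1 = (\<lambda>y. real (y j + 1) * f1 (y(j := y j + 1)) / f1 y)"
  define g where "g = pmf (poisson_mixture d Q)"
  let ?tQ = "\<lambda>y. bayes_estimator d Q y j" and ?tG = "\<lambda>y. bayes_estimator d G y j"
  have nn: "0 \<le> f1 y" "0 \<le> f2 y" "0 \<le> M y" for y
    using wmix_nonneg wA wB wB2 by (auto simp: f1_def f2_def M_def)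
  have f: "f y = f1 y + f2 y" if "y \<in> ?L" for y
    using mixture_split[OF sA that] by (simp add: f1_def f2_def)
  have gS: "real (y j + 1) * g (y(j := y j + 1)) \<le> b * g y" if "y \<in> ?L" for y
    using Q.mixture_Suc_le[OF _ hb(2) that j] Q by (simp add: g_def probs_on_def)
  have f1S: "real (y j + 1) * f1 (y(j := y j + 1)) \<le> h * f1 y" if "y \<in> ?L" for y
    using wmix_indicator_cube[OF hb(1) that j] by (simp add: f1_def)
  have sum_f2: "(\<integral>\<^sup>+y. ennreal (f2 y) \<partial>count_space ?L) = \<delta>"
    unfolding f2_def \<delta>_def nn_integral_wmix[OF wB] by (intro nn_integral_cong) (simp add: ennreal_indicator)
  have sum_M: "(\<integral>\<^sup>+y. ennreal (M y) \<partial>count_space ?L) = m"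
    unfolding M_def m_def nn_integral_wmix[OF wB2]
    by (intro nn_integral_cong) (simp add: ennreal_mult'' ennreal_indicator mult.commute)
  have sum_f: "(\<integral>\<^sup>+y. ennreal (f y) \<partial>count_space ?L) = 1"
    using nn_integral_pmf_lattice[OF mixture_in_lattice_pmfs, of "\<lambda>_. 1"] by (simp add: measure_pmf.emeasure_space_1)
  have trunc: "f y * (t1 y - ?tG y)\<^sup>2 \<le> M y + h\<^sup>2 * f2 y" if y: "y \<in> ?L" for y
  proof -
    define mm where "mm = wmix (\<lambda>\<theta>. indicator (- ?A) \<theta> * \<theta> j) y"
    have "?tG y = (real (y j + 1) * f1 (y(j := y j + 1)) + mm) / (f1 y + f2 y)"
      unfolding bayes_estimator_def f[OF y] f[OF lattice_points_upd[OF y j]] mm_def wmix_Suc[OF j, symmetric]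
      by (simp add: f2_def distrib_left del: fun_upd_apply)
    moreover have "mm\<^sup>2 \<le> f2 y * M y"
      unfolding mm_def f2_def M_def using wmix_square_le[OF wB j y] .
    moreover have "0 \<le> mm" unfolding mm_def by (rule wmix_nonneg[OF wB1])
    ultimately show ?thesis
      using truncated_ratio_diff_sq_le[of "f1 y" "f2 y" "f1 (y(j := y j + 1))" mm "M y" "real (y j + 1)" h]
        nn f1S[OF y] hb unfolding f[OF y] t1_def by (simp add: power2_commute)
  qed
  have tQ: "?tQ y = real (y j + 1) * g (y(j := y j + 1)) / g y" for y
    by (simp add: bayes_estimator_def g_def)
  have crude1: "(?tQ y - t1 y)\<^sup>2 \<le> (h + b)\<^sup>2" if y: "y \<in> ?L" for y
    unfolding tQ t1_def using nn hb f1S[OF y] gS[OF y] by (intro ratio_diff_sq_le_crude) (auto simp: g_def)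
  have split: "f y * (?tQ y - ?tG y)\<^sup>2 \<le> 2 * (f y * (?tQ y - t1 y)\<^sup>2) + 2 * (M y + h\<^sup>2 * f2 y)" if y: "y \<in> ?L" for y
  proof -
    have "(?tQ y - ?tG y)\<^sup>2 \<le> 2 * (?tQ y - t1 y)\<^sup>2 + 2 * (t1 y - ?tG y)\<^sup>2"
      using power2_add_le[of "?tQ y - t1 y" "t1 y - ?tG y"] by simp
    hence "f y * (?tQ y - ?tG y)\<^sup>2 \<le> f y * (2 * (?tQ y - t1 y)\<^sup>2 + 2 * (t1 y - ?tG y)\<^sup>2)"
      by (intro mult_left_mono) auto
    thus ?thesis using trunc[OF y] by (simp add: algebra_simps)
  qed
  have R: "R = (\<integral>\<^sup>+y. ennreal (f y * (?tQ y - ?tG y)\<^sup>2) \<partial>count_space ?L)"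
    unfolding R_def nn_integral_pmf_lattice[OF mixture_in_lattice_pmfs]
    by (intro nn_integral_cong) (simp add: ennreal_mult)
  have rest: "(\<integral>\<^sup>+y. ennreal (2 * (M y + h\<^sup>2 * f2 y)) \<partial>count_space ?L) = 2 * m + ennreal (2 * h\<^sup>2) * \<delta>"
  proof -
    have "(\<integral>\<^sup>+y. ennreal (2 * (M y + h\<^sup>2 * f2 y)) \<partial>count_space ?L) =
        (\<integral>\<^sup>+y. 2 * ennreal (M y) + ennreal (2 * h\<^sup>2) * ennreal (f2 y) \<partial>count_space ?L)"
      using nn by (intro nn_integral_cong) (simp add: ennreal_plus ennreal_mult distrib_left mult.assoc)
    thus ?thesis by (simp add: nn_integral_add nn_integral_cmult sum_M sum_f2)
  qed
  show ?crude
  proof -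
    have "R \<le> (\<integral>\<^sup>+y. ennreal (2 * (h + b)\<^sup>2) * ennreal (f y) + ennreal (2 * (M y + h\<^sup>2 * f2 y)) \<partial>count_space ?L)"
      unfolding R
    proof (intro nn_integral_mono)
      fix y assume "y \<in> space (count_space ?L)"
      hence y: "y \<in> ?L" by simp
      have "f y * (?tQ y - ?tG y)\<^sup>2 \<le> 2 * (h + b)\<^sup>2 * f y + 2 * (M y + h\<^sup>2 * f2 y)"
        using split[OF y] mult_left_mono[OF crude1[OF y], of "f y"] by (simp add: algebra_simps)
      hence "ennreal (f y * (?tQ y - ?tG y)\<^sup>2) \<le> ennreal (2 * (h + b)\<^sup>2 * f y + 2 * (M y + h\<^sup>2 * f2 y))"
        by (rule ennreal_leI)
      thus "ennreal (f y * (?tQ y - ?tG y)\<^sup>2) \<le> ennreal (2 * (h + b)\<^sup>2) * ennreal (f y) + ennreal (2 * (M y + h\<^sup>2 * f2 y))"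
        using nn by (simp add: ennreal_plus ennreal_mult)
    qed
    thus ?thesis by (simp add: nn_integral_add nn_integral_cmult sum_f rest del: distrib_left_numeral)
  qed
  show ?fine
  proof -
    let ?S = "\<integral>\<^sup>+y. ennreal (f1 y * (?tQ y - t1 y)\<^sup>2) \<partial>count_space ?L"
    let ?\<tau> = "\<integral>\<^sup>+y. ennreal (f y) * indicator {y. k \<le> y j} y \<partial>count_space ?L"
    \<comment> \<open>The weight \<open>f\<close> is split as well: only its part \<open>f1\<close>
      fits the ratio bound for \<open>t1\<close>, and the part \<open>f2\<close> is small enough for
      the crude bound.\<close>
    have "R \<le> (\<integral>\<^sup>+y. 2 * ennreal (f1 y * (?tQ y - t1 y)\<^sup>2) + ennreal (2 * (h + b)\<^sup>2) * ennreal (f2 y)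
        + ennreal (2 * (M y + h\<^sup>2 * f2 y)) \<partial>count_space ?L)"
      unfolding R
    proof (intro nn_integral_mono)
      fix y assume "y \<in> space (count_space ?L)"
      hence y: "y \<in> ?L" by simp
      have "f y * (?tQ y - ?tG y)\<^sup>2 \<le> 2 * (f1 y * (?tQ y - t1 y)\<^sup>2) + 2 * (h + b)\<^sup>2 * f2 y + 2 * (M y + h\<^sup>2 * f2 y)"
        using split[OF y] mult_left_mono[OF crude1[OF y] nn(2)[of y]] by (simp add: f[OF y] algebra_simps)
      hence "ennreal (f y * (?tQ y - ?tG y)\<^sup>2)
          \<le> ennreal (2 * (f1 y * (?tQ y - t1 y)\<^sup>2) + 2 * (h + b)\<^sup>2 * f2 y + 2 * (M y + h\<^sup>2 * f2 y))"
        by (rule ennreal_leI)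
      thus "ennreal (f y * (?tQ y - ?tG y)\<^sup>2) \<le> 2 * ennreal (f1 y * (?tQ y - t1 y)\<^sup>2)
          + ennreal (2 * (h + b)\<^sup>2) * ennreal (f2 y) + ennreal (2 * (M y + h\<^sup>2 * f2 y))"
        using nn by (simp add: ennreal_plus ennreal_mult)
    qed
    also have "\<dots> = 2 * ?S + ennreal (2 * (h + b)\<^sup>2) * \<delta> + (2 * m + ennreal (2 * h\<^sup>2) * \<delta>)"
      by (simp add: nn_integral_add nn_integral_cmult sum_f2 rest del: distrib_left_numeral)
    also have "?S \<le> ennreal (4 * (h + b)\<^sup>2 + 16 * real k * (h + b)) * hellinger d f1 g
        + ennreal ((h + b)\<^sup>2) * (\<integral>\<^sup>+y. ennreal (f1 y) * indicator {y. k \<le> y j} y \<partial>count_space ?L)"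
      unfolding tQ t1_def using nn hb f1S gS j by (intro ratio_diff_sq_sum_le) (auto simp: g_def)
    also have "(\<integral>\<^sup>+y. ennreal (f1 y) * indicator {y. k \<le> y j} y \<partial>count_space ?L) \<le> ?\<tau>"
      using nn by (intro nn_integral_mono mult_right_mono ennreal_leI) (auto simp: f)
    \<comment> \<open>The detour through \<open>f\<close> is needed because minimality controls the
      distance from \<open>g\<close> to the full mixture only.\<close>
    also have "hellinger d f1 g \<le> 2 * hellinger d f1 f + 2 * hellinger d f g"
      by (rule hellinger_triangle)
    also have "hellinger d f1 f \<le> \<delta>"
      unfolding hellinger_def sum_f2[symmetric] using nn
      by (intro nn_integral_mono ennreal_leI) (auto simp: f intro!: sqrt_diff_sq_add_le)
    finally have "R \<le> 2 * (ennreal (4 * (h + b)\<^sup>2 + 16 * real k * (h + b)) * (2 * \<delta> + 2 * hellinger d f g) + ennreal ((h + b)\<^sup>2) * ?\<tau>)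
        + ennreal (2 * (h + b)\<^sup>2) * \<delta> + (2 * m + ennreal (2 * h\<^sup>2) * \<delta>)"
      by (simp add: add_mono mult_left_mono)
    also have "\<dots> = ennreal (2 * (4 * (h + b)\<^sup>2 + 16 * real k * (h + b))) * (2 * hellinger d f g + 2 * \<delta>)
        + ennreal (2 * (h + b)\<^sup>2) * ?\<tau> + ennreal (2 * (h + b)\<^sup>2) * \<delta> + (2 * m + ennreal (2 * h\<^sup>2) * \<delta>)"
    proof -
      have two: "ennreal (2 * x) = 2 * ennreal x" if "0 \<le> x" for x
        using that by (simp add: ennreal_mult)
      have "0 \<le> 4 * (h + b)\<^sup>2 + 16 * real k * (h + b)" using hb by simp
      from two[OF this] two[of "(h + b)\<^sup>2"] show ?thesis
        by (simp only: zero_le_power2 distrib_left mult.assoc add.commute simp_thms)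
    qed
    also have "2 * (4 * (h + b)\<^sup>2 + 16 * real k * (h + b)) = 8 * (h + b)\<^sup>2 + 32 * real k * (h + b)"
      by simp
    finally show ?thesis unfolding g_def .
  qed
qed

end

section \<open>The empirical distribution\<close>

text \<open>Commuting the binds puts the new observation innermost, with the rest of the sample
  fixed.\<close>

lemma nn_integral_replicate_pmf_Suc:
  "(\<integral>\<^sup>+xs. F xs \<partial>measure_pmf (replicate_pmf (Suc n) p)) =
    (\<integral>\<^sup>+xs. \<integral>\<^sup>+x. F (x # xs) \<partial>measure_pmf p \<partial>measure_pmf (replicate_pmf n p))"
proof -
  have "replicate_pmf (Suc n) p = bind_pmf (replicate_pmf n p) (\<lambda>xs. bind_pmf p (\<lambda>x. return_pmf (x # xs)))"
    by (simp, rule bind_commute_pmf)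
  thus ?thesis by (simp del: replicate_pmf.simps)
qed

lemma nn_integral_replicate_pmf_sum_list:
  fixes F :: "'a \<Rightarrow> ennreal"
  shows "(\<integral>\<^sup>+xs. (\<Sum>x\<leftarrow>xs. F x) \<partial>measure_pmf (replicate_pmf n p)) = of_nat n * (\<integral>\<^sup>+x. F x \<partial>measure_pmf p)"
proof (induction n)
  case (Suc n)
  show ?case unfolding nn_integral_replicate_pmf_Suc
    by (simp add: nn_integral_add Suc distrib_right measure_pmf.emeasure_space_1)
qed simp

text \<open>Variances of independent summands add up: in the induction step the cross term vanishes,
  the new observation having mean zero.\<close>

lemma nn_integral_replicate_pmf_centered_square:
  fixes X :: "'a \<Rightarrow> real"
  assumes bnd: "\<And>x. \<bar>X x\<bar> \<le> 1" and mean: "measure_pmf.expectation p X = 0"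
  shows "(\<integral>\<^sup>+xs. ennreal ((\<Sum>x\<leftarrow>xs. X x)\<^sup>2) \<partial>measure_pmf (replicate_pmf n p))
    = of_nat n * ennreal (measure_pmf.expectation p (\<lambda>x. (X x)\<^sup>2))"
proof (induction n)
  case (Suc n)
  let ?V = "measure_pmf.expectation p (\<lambda>x. (X x)\<^sup>2)"
  have int: "integrable (measure_pmf p) X" "integrable (measure_pmf p) (\<lambda>x. (X x)\<^sup>2)"
    using bnd by (auto intro!: measure_pmf.integrable_const_bound[where B = 1] simp: abs_square_le_1)
  have step: "(\<integral>\<^sup>+x. ennreal ((X x + s)\<^sup>2) \<partial>measure_pmf p) = ennreal ?V + ennreal (s\<^sup>2)" for s
  proof -
    have eq: "(X x + s)\<^sup>2 = (X x)\<^sup>2 + 2 * s * X x + s\<^sup>2" for x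
      by (simp add: power2_eq_square algebra_simps)
    have "(\<integral>\<^sup>+x. ennreal ((X x + s)\<^sup>2) \<partial>measure_pmf p) = ennreal (measure_pmf.expectation p (\<lambda>x. (X x + s)\<^sup>2))"
    proof (rule nn_integral_eq_integral)
      show "integrable (measure_pmf p) (\<lambda>x. (X x + s)\<^sup>2)" unfolding eq using int by simp
    qed simp
    also have "measure_pmf.expectation p (\<lambda>x. (X x + s)\<^sup>2) = ?V + s\<^sup>2"
      unfolding eq using int mean by (simp add: measure_pmf.prob_space)
    finally show ?thesis by (simp add: ennreal_plus)
  qed
  show ?case unfolding nn_integral_replicate_pmf_Suc
    by (simp add: step nn_integral_add Suc distrib_right measure_pmf.emeasure_space_1)
qed simp

lemma pmf_empirical:
  "Ys \<noteq> [] \<Longrightarrow> pmf (empirical Ys) y = (\<Sum>Y\<leftarrow>Ys. indicator {y} Y) / real (length Ys)"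
proof -
  assume "Ys \<noteq> []"
  moreover have "real (count (mset Ys) y) = (\<Sum>Y\<leftarrow>Ys. indicator {y} Y)"
    by (induction Ys) auto
  ultimately show ?thesis by (simp add: empirical_def)
qed

text \<open>A relative frequency has variance q (1 - q) / n; division by q leaves a bound uniform in
  the point and in \<open>p\<close>. At points of mass zero the quotient is 0 by convention.\<close>

lemma empirical_square_error:
  assumes "n > 0"
  shows "(\<integral>\<^sup>+Ys. ennreal ((pmf (empirical Ys) y - pmf p y)\<^sup>2 / pmf p y) \<partial>measure_pmf (replicate_pmf n p)) \<le> ennreal (1 / n)"
proof (cases "pmf p y = 0")
  case False
  define q where "q = pmf p y"
  have q: "0 < q" "q \<le> 1" using False pmf_nonneg[of p y] pmf_le_1[of p y] by (auto simp: q_def less_le)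
  define X where "X = (\<lambda>x. indicator {y} x - q)"
  have ind: "integrable (measure_pmf p) (indicator {y} :: _ \<Rightarrow> real)"
    by (intro measure_pmf.integrable_const_bound[where B = 1]) (auto simp: indicator_def)
  have E: "measure_pmf.expectation p (indicator {y}) = q"
    by (simp add: q_def pmf.rep_eq)
  have mean: "measure_pmf.expectation p X = 0"
    unfolding X_def using ind E by (simp add: measure_pmf.prob_space)
  have sq: "(X x)\<^sup>2 = (1 - 2 * q) * indicator {y} x + q\<^sup>2" for x
    by (simp add: X_def indicator_def power2_eq_square algebra_simps)
  have V: "measure_pmf.expectation p (\<lambda>x. (X x)\<^sup>2) = q - q\<^sup>2"
    unfolding sq using ind E by (simp add: measure_pmf.prob_space power2_eq_square algebra_simps)
  have sum: "(\<Sum>x\<leftarrow>xs. X x) = (\<Sum>x\<leftarrow>xs. indicator {y} x) - real (length xs) * q" for xs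
    by (induction xs) (auto simp: X_def algebra_simps)
  have "(\<integral>\<^sup>+Ys. ennreal ((pmf (empirical Ys) y - q)\<^sup>2 / q) \<partial>measure_pmf (replicate_pmf n p))
      = (\<integral>\<^sup>+Ys. ennreal (1 / (real n ^ 2 * q)) * ennreal ((\<Sum>x\<leftarrow>Ys. X x)\<^sup>2) \<partial>measure_pmf (replicate_pmf n p))"
  proof (intro nn_integral_cong_AE AE_pmfI)
    fix Ys assume "Ys \<in> set_pmf (replicate_pmf n p)"
    hence n: "length Ys = n" by (simp add: set_replicate_pmf)
    hence "Ys \<noteq> []" using assms by auto
    hence "pmf (empirical Ys) y - q = (\<Sum>x\<leftarrow>Ys. X x) / n"
      using assms by (simp add: pmf_empirical sum n field_simps)
    hence "(pmf (empirical Ys) y - q)\<^sup>2 / q = 1 / (real n ^ 2 * q) * (\<Sum>x\<leftarrow>Ys. X x)\<^sup>2"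
      by (simp add: power_divide)
    thus "ennreal ((pmf (empirical Ys) y - q)\<^sup>2 / q) = ennreal (1 / (real n ^ 2 * q)) * ennreal ((\<Sum>x\<leftarrow>Ys. X x)\<^sup>2)"
      using q by (simp only:) (subst ennreal_mult, auto)
  qed
  also have "\<dots> = ennreal (1 / (real n ^ 2 * q)) * (of_nat n * ennreal (q - q\<^sup>2))"
  proof -
    have "\<bar>X x\<bar> \<le> 1" for x using q by (auto simp: X_def indicator_def)
    thus ?thesis
      by (simp add: nn_integral_cmult nn_integral_replicate_pmf_centered_square[OF _ mean] V)
  qed
  also have "\<dots> = ennreal (1 / (real n ^ 2 * q) * (n * (q - q\<^sup>2)))"
  proof -
    have "q * q \<le> q" using q by (simp add: mult_le_one)
    hence "0 \<le> q - q\<^sup>2" by (simp add: power2_eq_square)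
    thus ?thesis using q
      by (simp only: ennreal_of_nat_eq_real_of_nat) (subst ennreal_mult[symmetric], auto)+
  qed
  also have "1 / (real n ^ 2 * q) * (n * (q - q\<^sup>2)) = (1 - q) / n"
    using q assms by (simp add: power2_eq_square field_simps)
  also have "ennreal ((1 - q) / n) \<le> ennreal (1 / n)"
    using q by (intro ennreal_leI divide_right_mono) auto
  finally show ?thesis by (simp add: q_def)
qed simp

definition lattice_box :: "nat \<Rightarrow> nat \<Rightarrow> (nat \<Rightarrow> nat) set" where
  "lattice_box d k = {..<d} \<rightarrow>\<^sub>E {..<k}"

lemma lattice_box_subset: "lattice_box d k \<subseteq> lattice_points d"
  by (auto simp: lattice_box_def lattice_points_def)

lemma not_in_lattice_boxE:
  assumes "y \<in> lattice_points d" "y \<notin> lattice_box d k"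
  obtains j where "j < d" "k \<le> y j"
  using assms by (force simp: lattice_box_def lattice_points_def PiE_def Pi_def)

text \<open>Each of the k^d points of the box costs 1/n. At a point outside, the empirical mass is
  zero on the event, the term equals \<open>pmf p y\<close>, and some coordinate is at least
  \<open>k\<close>.\<close>

lemma expected_chi_square_le:
  assumes n: "n > 0"
  shows "(\<integral>\<^sup>+Ys. (if set Ys \<subseteq> lattice_box d k then
        \<integral>\<^sup>+y. ennreal ((pmf (empirical Ys) y - pmf p y)\<^sup>2 / pmf p y) \<partial>count_space (lattice_points d) else 0)
        \<partial>measure_pmf (replicate_pmf n p))
    \<le> ennreal (real k ^ d / n) +
      (\<Sum>j<d. \<integral>\<^sup>+y. ennreal (pmf p y) * indicator {y. k \<le> y j} y \<partial>count_space (lattice_points d))"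
proof -
  let ?L = "lattice_points d"
  let ?e = "\<lambda>Ys y. ennreal ((pmf (empirical Ys) y - pmf p y)\<^sup>2 / pmf p y)"
  let ?t = "\<lambda>j y. ennreal (pmf p y) * indicator {y. k \<le> y j} y"
  have "(\<integral>\<^sup>+Ys. (if set Ys \<subseteq> lattice_box d k then \<integral>\<^sup>+y. ?e Ys y \<partial>count_space ?L else 0) \<partial>measure_pmf (replicate_pmf n p))
      = (\<integral>\<^sup>+Ys. \<integral>\<^sup>+y. (if set Ys \<subseteq> lattice_box d k then ?e Ys y else 0) \<partial>count_space ?L \<partial>measure_pmf (replicate_pmf n p))"
    by (intro nn_integral_cong) simp
  also have "\<dots> = (\<integral>\<^sup>+y. \<integral>\<^sup>+Ys. (if set Ys \<subseteq> lattice_box d k then ?e Ys y else 0) \<partial>measure_pmf (replicate_pmf n p) \<partial>count_space ?L)"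
    using countable_lattice_points by (intro nn_integral_count_space_nn_integral) auto
  also have "\<dots> \<le> (\<integral>\<^sup>+y. ennreal (1 / n) * indicator (lattice_box d k) y + (\<Sum>j<d. ?t j y) \<partial>count_space ?L)"
  proof (intro nn_integral_mono)
    fix y assume "y \<in> space (count_space ?L)"
    hence y: "y \<in> ?L" by simp
    show "(\<integral>\<^sup>+Ys. (if set Ys \<subseteq> lattice_box d k then ?e Ys y else 0) \<partial>measure_pmf (replicate_pmf n p))
        \<le> ennreal (1 / n) * indicator (lattice_box d k) y + (\<Sum>j<d. ?t j y)"
    proof (cases "y \<in> lattice_box d k")
      case True
      have "(\<integral>\<^sup>+Ys. (if set Ys \<subseteq> lattice_box d k then ?e Ys y else 0) \<partial>measure_pmf (replicate_pmf n p))
          \<le> (\<integral>\<^sup>+Ys. ?e Ys y \<partial>measure_pmf (replicate_pmf n p))"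
        by (intro nn_integral_mono) auto
      also have "\<dots> \<le> ennreal (1 / n)" by (rule empirical_square_error[OF n])
      finally show ?thesis using True by (simp add: add_increasing2)
    next
      case False
      then obtain j where j: "j < d" "k \<le> y j" using not_in_lattice_boxE[OF y False] by blast
      have "(\<integral>\<^sup>+Ys. (if set Ys \<subseteq> lattice_box d k then ?e Ys y else 0) \<partial>measure_pmf (replicate_pmf n p))
          \<le> (\<integral>\<^sup>+Ys. ennreal (pmf p y) \<partial>measure_pmf (replicate_pmf n p))"
      proof (intro nn_integral_mono_AE AE_pmfI)
        fix Ys assume "Ys \<in> set_pmf (replicate_pmf n p)"
        hence "Ys \<noteq> []" using n by (auto simp: set_replicate_pmf)
        moreover have "(\<Sum>Y\<leftarrow>Ys. indicator {y} Y) = (0::real)" if "set Ys \<subseteq> lattice_box d k"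
          using that False by (induction Ys) (auto simp: indicator_def)
        ultimately show "(if set Ys \<subseteq> lattice_box d k then ?e Ys y else 0) \<le> ennreal (pmf p y)"
          by (auto simp: pmf_empirical power2_eq_square)
      qed
      also have "\<dots> = ?t j y" using j by (simp add: measure_pmf.emeasure_space_1)
      also have "\<dots> \<le> (\<Sum>j<d. ?t j y)" using j by (intro member_le_sum) auto
      finally show ?thesis using False by simp
    qed
  qed
  also have "\<dots> = ennreal (1 / n) * emeasure (count_space ?L) (lattice_box d k) + (\<Sum>j<d. \<integral>\<^sup>+y. ?t j y \<partial>count_space ?L)"
    using lattice_box_subset[of d k]
    by (subst nn_integral_add, simp, simp, subst nn_integral_sum, simp, subst nn_integral_cmult_indicator) auto
  also have "emeasure (count_space ?L) (lattice_box d k) = of_nat (k ^ d)"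
    using lattice_box_subset[of d k]
    by (subst emeasure_count_space_finite) (auto simp: lattice_box_def card_PiE intro!: finite_PiE)
  also have "ennreal (1 / n) * of_nat (k ^ d) = ennreal (real k ^ d / n)"
    unfolding ennreal_of_nat_eq_real_of_nat by (subst ennreal_mult[symmetric]) (auto simp: mult.commute)
  finally show ?thesis .
qed

section \<open>Minimum-distance estimators\<close>

text \<open>The sum \<open>infsum\<close> of nonnegative terms is the same supremum of finite sums;
  this links the sums defining the divergences to integrals.\<close>

lemma nn_integral_count_space_eq_SUP:
  assumes A: "countable A"
  shows "(\<integral>\<^sup>+x. F x \<partial>count_space A) = (SUP S\<in>{S. finite S \<and> S \<subseteq> A}. sum F S)"
proof (rule antisym)
  have sub: "sum F S \<le> (\<integral>\<^sup>+x. F x \<partial>count_space A)" if "finite S" "S \<subseteq> A" for S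
  proof -
    have "sum F S = (\<integral>\<^sup>+x. F x \<partial>count_space S)" using that by (simp add: nn_integral_count_space_finite)
    also have "\<dots> \<le> (\<integral>\<^sup>+x. F x \<partial>count_space A)"
      using that by (simp add: nn_integral_count_space_indicator) (intro nn_integral_mono, auto simp: indicator_def)
    finally show ?thesis .
  qed
  thus "(SUP S\<in>{S. finite S \<and> S \<subseteq> A}. sum F S) \<le> (\<integral>\<^sup>+x. F x \<partial>count_space A)"
    by (intro SUP_least) auto
  show "(\<integral>\<^sup>+x. F x \<partial>count_space A) \<le> (SUP S\<in>{S. finite S \<and> S \<subseteq> A}. sum F S)"
  proof (cases "finite A")
    case True
    thus ?thesis by (intro SUP_upper2[of A]) (auto simp: nn_integral_count_space_finite)
  next
    case False
    then obtain e where e: "bij_betw e (UNIV :: nat set) A"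
      using A bij_betw_from_nat_into by blast
    have "(\<integral>\<^sup>+x. F x \<partial>count_space A) = (\<integral>\<^sup>+i. F (e i) \<partial>count_space UNIV)"
      by (rule nn_integral_bij_count_space[OF e, symmetric])
    also have "\<dots> = (SUP n. \<Sum>i<n. F (e i))"
      by (simp add: nn_integral_count_space_nat suminf_eq_SUP)
    also have "\<dots> \<le> (SUP S\<in>{S. finite S \<and> S \<subseteq> A}. sum F S)"
    proof (rule SUP_least)
      fix n :: nat
      have "inj_on e {..<n}" using e by (auto simp: bij_betw_def intro: inj_on_subset)
      hence "(\<Sum>i<n. F (e i)) = sum F (e ` {..<n})" by (simp add: sum.reindex)
      also have "\<dots> \<le> (SUP S\<in>{S. finite S \<and> S \<subseteq> A}. sum F S)"
        using e by (intro SUP_upper) (auto simp: bij_betw_def)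
      finally show "(\<Sum>i<n. F (e i)) \<le> (SUP S\<in>{S. finite S \<and> S \<subseteq> A}. sum F S)" .
    qed
    finally show ?thesis .
  qed
qed

lemma infsum_ereal_eq_nn_integral:
  assumes "countable A" and nn: "\<And>x. x \<in> A \<Longrightarrow> 0 \<le> F x"
  shows "(\<Sum>\<^sub>\<infinity>x\<in>A. ereal (F x)) = enn2ereal (\<integral>\<^sup>+x. ennreal (F x) \<partial>count_space A)"
proof -
  let ?C = "{S. finite S \<and> S \<subseteq> A}"
  have sum: "enn2ereal (\<Sum>x\<in>S. ennreal (F x)) = (\<Sum>x\<in>S. ereal (F x))" if "S \<in> ?C" for S
  proof -
    have "(\<Sum>x\<in>S. ennreal (F x)) = ennreal (\<Sum>x\<in>S. F x)" using that nn by (intro sum_ennreal) auto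
    moreover have "0 \<le> (\<Sum>x\<in>S. F x)" using that nn by (intro sum_nonneg) auto
    ultimately show ?thesis by (simp add: enn2ereal_ennreal)
  qed
  have "(\<Sum>\<^sub>\<infinity>x\<in>A. ereal (F x)) = (SUP S\<in>?C. \<Sum>x\<in>S. ereal (F x))"
    using nn by (intro nonneg_infsum_complete) auto
  also have "\<dots> = (SUP S\<in>?C. enn2ereal (\<Sum>x\<in>S. ennreal (F x)))"
    by (intro SUP_cong refl sum[symmetric])
  \<comment> \<open>Suprema in \<open>ennreal\<close> are represented with \<open>sup 0\<close>,
    guarding against the empty family; here the supremum is already nonnegative.\<close>
  also have "\<dots> = sup 0 (Sup (enn2ereal ` (\<lambda>S. \<Sum>x\<in>S. ennreal (F x)) ` ?C))"
  proof -
    have "0 \<le> (SUP S\<in>?C. enn2ereal (\<Sum>x\<in>S. ennreal (F x)))"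
      by (rule SUP_upper2[of "{}"]) auto
    thus ?thesis by (simp add: image_image sup_absorb2)
  qed
  also have "\<dots> = enn2ereal (SUP S\<in>?C. \<Sum>x\<in>S. ennreal (F x))"
    by (simp add: Sup_ennreal.rep_eq)
  finally show ?thesis by (simp add: nn_integral_count_space_eq_SUP[OF assms(1)])
qed

lemma hellinger_sq_eq: "hellinger_sq d p q = enn2ereal (hellinger d (pmf p) (pmf q))"
  unfolding hellinger_sq_def hellinger_def
  by (intro infsum_ereal_eq_nn_integral countable_lattice_points) auto

text \<open>The inclusion of supports excludes a / 0 with a > 0, the one case in which the quotients
  in \<open>ereal\<close> and in the reals disagree.\<close>

lemma chi_sq_eq:
  assumes "set_pmf p \<subseteq> set_pmf q"
  shows "chi_sq d p q = enn2ereal (\<integral>\<^sup>+y. ennreal ((pmf p y - pmf q y)\<^sup>2 / pmf q y) \<partial>count_space (lattice_points d))"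
proof -
  have "ereal ((pmf p y - pmf q y)\<^sup>2) / ereal (pmf q y) = ereal ((pmf p y - pmf q y)\<^sup>2 / pmf q y)" for y
  proof (cases "pmf q y = 0")
    case True
    hence "pmf p y = 0" using assms by (auto simp: set_pmf_iff)
    thus ?thesis using True by (simp add: divide_ereal_def)
  qed (simp add: divide_ereal_def divide_inverse)
  thus ?thesis unfolding chi_sq_def
    by (simp add: infsum_ereal_eq_nn_integral[OF countable_lattice_points])
qed

text \<open>The sandwich and minimality bound the Hellinger distances from \<open>p\<close> to
  \<open>q\<close> and to \<open>r\<close> alike by (\<kappa>2 / \<kappa>1) times chi-square; the
  squared triangle inequality through \<open>p\<close> gives 4 = 2 + 2.\<close>

lemma min_distance_hellinger_le:
  assumes kpos: "\<kappa>1 > 0" "\<kappa>2 > 0" and sw: "sandwich_property \<kappa>1 \<kappa>2 d D"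
    and pmfs: "p \<in> lattice_pmfs d" "q \<in> lattice_pmfs d" "r \<in> lattice_pmfs d"
    and min: "D p r \<le> D p q" and sub: "set_pmf p \<subseteq> set_pmf q"
  shows "hellinger d (pmf q) (pmf r) \<le> ennreal (4 * (\<kappa>2 / \<kappa>1)) *
    (\<integral>\<^sup>+y. ennreal ((pmf p y - pmf q y)\<^sup>2 / pmf q y) \<partial>count_space (lattice_points d))"
proof -
  define X where "X = (\<integral>\<^sup>+y. ennreal ((pmf p y - pmf q y)\<^sup>2 / pmf q y) \<partial>count_space (lattice_points d))"
  have up: "D p q \<le> ereal \<kappa>2 * enn2ereal X"
    using sw pmfs unfolding sandwich_property_def X_def chi_sq_eq[OF sub, of d, symmetric] by blast
  have *: "hellinger d (pmf p) (pmf s) \<le> ennreal (\<kappa>2 / \<kappa>1) * X"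
    if "s \<in> lattice_pmfs d" "D p s \<le> D p q" for s
  proof -
    have "ereal \<kappa>1 * enn2ereal (hellinger d (pmf p) (pmf s)) \<le> D p s"
      using sw pmfs that(1) by (auto simp: sandwich_property_def hellinger_sq_eq)
    also note that(2)
    also note up
    finally have "enn2ereal (ennreal \<kappa>1 * hellinger d (pmf p) (pmf s)) \<le> enn2ereal (ennreal \<kappa>2 * X)"
      using kpos by (simp add: times_ennreal.rep_eq enn2ereal_ennreal)
    hence "ennreal \<kappa>1 * hellinger d (pmf p) (pmf s) \<le> ennreal \<kappa>2 * X"
      by (simp add: less_eq_ennreal.rep_eq)
    hence "ennreal (1 / \<kappa>1) * (ennreal \<kappa>1 * hellinger d (pmf p) (pmf s)) \<le> ennreal (1 / \<kappa>1) * (ennreal \<kappa>2 * X)"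
      by (rule mult_left_mono) simp
    thus ?thesis using kpos by (simp flip: ennreal_mult mult.assoc)
  qed
  have "hellinger d (pmf q) (pmf r) \<le> 2 * hellinger d (pmf q) (pmf p) + 2 * hellinger d (pmf p) (pmf r)"
    by (rule hellinger_triangle)
  also have "\<dots> \<le> 2 * (ennreal (\<kappa>2 / \<kappa>1) * X) + 2 * (ennreal (\<kappa>2 / \<kappa>1) * X)"
    using *[OF pmfs(2)] *[OF pmfs(3) min] hellinger_commute[of d "pmf q" "pmf p"]
    by (intro add_mono mult_left_mono) auto
  also have "\<dots> = 4 * (ennreal (\<kappa>2 / \<kappa>1) * X)"
    by (simp flip: distrib_right)
  also have "\<dots> = ennreal (4 * (\<kappa>2 / \<kappa>1)) * X"
    using kpos by (subst ennreal_mult) (auto simp: mult.assoc)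
  finally show ?thesis by (simp add: X_def)
qed

section \<open>Support of the unconstrained minimiser\<close>

text \<open>As a function of its rate, the Poisson weight at y peaks at rate y; to the right of the
  mode strict decrease comes from ln x < x - 1.\<close>

lemma poisson_weight_strict_antimono:
  fixes y :: nat and b t :: real
  assumes "y \<le> b" "b < t"
  shows "exp (- t) * t ^ y < exp (- b) * b ^ y"
proof (cases "y = 0")
  case True
  thus ?thesis using assms by simp
next
  case False
  hence b: "b > 0" using assms by linarith
  have "y * ln (t / b) < y * (t / b - 1)"
    using ln_add_one_self_less_self[of "t / b - 1"] assms b False
    by (intro mult_strict_left_mono) auto
  also have "\<dots> \<le> b * (t / b - 1)"
    using assms b by (intro mult_right_mono) auto
  also have "\<dots> = t - b" using b by (simp add: field_simps)
  finally have "y * ln t - t < y * ln b - b"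
    using assms b by (simp add: ln_div algebra_simps)
  hence "exp (y * ln t - t) < exp (y * ln b - b)" by simp
  moreover have "exp (y * ln z - z) = exp (- z) * z ^ y" if "z > 0" for z
    using that by (simp add: exp_diff exp_minus exp_of_nat_mult field_simps)
  ultimately show ?thesis using b assms by simp
qed

text \<open>A coordinate above \<open>b\<close> lies to the right of the mode \<open>y j\<close> of
  its factor, so lowering it to \<open>b\<close> increases that factor. Strictness needs the other
  factors to be nonzero, hence the positivity condition.\<close>

lemma poisson_likelihood_clamp:
  assumes \<theta>: "\<theta> \<in> orthant d" and y: "\<And>j. j < d \<Longrightarrow> real (y j) \<le> b"
  defines "\<theta>' \<equiv> \<lambda>j\<in>{..<d}. min (\<theta> j) b"
  shows "poisson_likelihood d \<theta> y \<le> poisson_likelihood d \<theta>' y"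
    and "\<theta> \<notin> cube d b \<Longrightarrow> 0 < poisson_likelihood d \<theta> y \<Longrightarrow>
      poisson_likelihood d \<theta> y < poisson_likelihood d \<theta>' y"
proof -
  define w where "w = (\<lambda>\<theta> j. exp (- \<theta> j) * \<theta> j ^ y j / fact (y j) :: real)"
  have lt: "w \<theta> j < w \<theta>' j" if "j < d" "b < \<theta> j" for j
    using poisson_weight_strict_antimono[OF y[OF that(1)] that(2)] that
    by (simp add: w_def \<theta>'_def divide_strict_right_mono)
  have le: "w \<theta> j \<le> w \<theta>' j" if "j < d" for j
    using lt[OF that] that by (cases "b < \<theta> j") (auto simp: w_def \<theta>'_def min_def)
  have nn: "0 \<le> w \<theta> j" if "j < d" for j
    using orthant_nonneg[OF \<theta> that] by (simp add: w_def)
  have prod: "poisson_likelihood d x y = (\<Prod>j<d. w x j)" for x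
    by (simp add: poisson_likelihood_def w_def)
  show "poisson_likelihood d \<theta> y \<le> poisson_likelihood d \<theta>' y"
    unfolding prod using le nn by (intro prod_mono) auto
  assume "\<theta> \<notin> cube d b" and pos: "0 < poisson_likelihood d \<theta> y"
  then obtain i where i: "i < d" "b < \<theta> i"
    using \<theta> by (force simp: cube_def orthant_def PiE_def Pi_def)
  have split: "(\<Prod>j<d. w x j) = w x i * (\<Prod>j\<in>{..<d}-{i}. w x j)" for x
    using i by (intro prod.remove) auto
  have "0 \<le> (\<Prod>j\<in>{..<d}-{i}. w \<theta> j)" using nn by (intro prod_nonneg) auto
  hence pos': "0 < (\<Prod>j\<in>{..<d}-{i}. w \<theta> j)"
    using pos unfolding prod split by (auto simp: less_le)
  have "w \<theta> i * (\<Prod>j\<in>{..<d}-{i}. w \<theta> j) < w \<theta>' i * (\<Prod>j\<in>{..<d}-{i}. w \<theta> j)"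
    using lt[OF i] pos' by (intro mult_strict_right_mono) auto
  also have "\<dots> \<le> w \<theta>' i * (\<Prod>j\<in>{..<d}-{i}. w \<theta>' j)"
    using le nn nn[OF i(1)] le[OF i(1)] by (intro mult_left_mono prod_mono) auto
  finally show "poisson_likelihood d \<theta> y < poisson_likelihood d \<theta>' y"
    unfolding prod split .
qed

lemma poisson_likelihood_pos:
  assumes "\<And>j. j < d \<Longrightarrow> y j = 0 \<or> 0 < \<theta> j"
  shows "0 < poisson_likelihood d \<theta> y"
  unfolding poisson_likelihood_def
proof (rule prod_pos)
  fix j assume "j \<in> {..<d}"
  hence "y j = 0 \<or> 0 < \<theta> j" using assms by simp
  thus "0 < exp (- \<theta> j) * \<theta> j ^ y j / fact (y j)" by auto
qed

context
  fixes d :: nat and D :: divergence and Ys :: "(nat \<Rightarrow> nat) list" and Q :: "(nat \<Rightarrow> real) measure"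
  assumes dec: "decomposition_property d D"
    and Ys: "Ys \<noteq> []" "set Ys \<subseteq> lattice_points d"
    and min: "is_arg_min (\<lambda>Q. D (empirical Ys) (poisson_mixture d Q))
          (\<lambda>Q. Q \<in> probs_on (euclidean_space_meas d) (orthant d)) Q"
begin

lemma minimiser_prior: "Q \<in> probs_on (euclidean_space_meas d) (orthant d)"
  using min by (simp add: is_arg_min_def)

lemma set_pmf_empirical: "set_pmf (empirical Ys) = set Ys"
  using Ys by (simp add: empirical_def)

lemma unit_point_prior:
  "return (euclidean_space_meas d) (\<lambda>j\<in>{..<d}. 1) \<in> probs_on (euclidean_space_meas d) (orthant d)"
proof -
  have "(\<lambda>j\<in>{..<d}. 1::real) \<in> orthant d" by (auto simp: orthant_def)
  moreover have "(\<lambda>j\<in>{..<d}. 1::real) \<in> space (euclidean_space_meas d)" by (auto simp: space_PiM)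
  moreover have "Measurable.pred (euclidean_space_meas d) (\<lambda>\<theta>. \<theta> \<in> orthant d)"
    by measurable
  ultimately show ?thesis
    by (auto simp: probs_on_def AE_return intro!: prob_space_return)
qed

text \<open>Replacing the minimiser by a prior with a pointwise larger likelihood on the sample cannot
  strictly increase the likelihood of any sample point, because \<open>l a\<close> is strictly decreasing.\<close>

lemma minimiser_likelihood_maximal:
  assumes R: "R \<in> probs_on (euclidean_space_meas d) (orthant d)"
    and le: "\<And>y. y \<in> set Ys \<Longrightarrow> pmf (poisson_mixture d Q) y \<le> pmf (poisson_mixture d R) y"
    and y: "y \<in> set Ys"
  shows "pmf (poisson_mixture d R) y = pmf (poisson_mixture d Q) y"
proof (rule ccontr)
  assume neq: "\<not> ?thesis"
  define p where "p = empirical Ys"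
  obtain t l where l: "\<forall>a\<ge>0. \<forall>b\<ge>0. l a b \<noteq> (-\<infinity>::ereal)" "\<forall>a\<ge>0. \<forall>b>0. l a b \<noteq> \<infinity>"
      "\<forall>a>0. strict_antimono_on {0..} (l a)" "\<forall>b\<ge>0. l 0 b = 0"
    and D: "\<And>q1 q2. q1 \<in> lattice_pmfs d \<Longrightarrow> q2 \<in> lattice_pmfs d \<Longrightarrow>
      D q1 q2 = ereal (t q1) + (\<Sum>\<^sub>\<infinity>y\<in>lattice_points d. l (pmf q1 y) (pmf q2 y))"
    using dec unfolding decomposition_property_def by blast
  have p: "p \<in> lattice_pmfs d" and ppos: "\<And>x. x \<in> set Ys \<Longrightarrow> 0 < pmf p x"
    and p0: "\<And>x. x \<notin> set Ys \<Longrightarrow> pmf p x = 0"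
    using Ys set_pmf_empirical by (auto simp: lattice_pmfs_def p_def pmf_positive_iff set_pmf_iff)
  \<comment> \<open>As \<open>l 0 b = 0\<close>, only the finitely many sample points
    contribute.\<close>
  have Dsum: "D p (poisson_mixture d S) = ereal (t p) + (\<Sum>x\<in>set Ys. l (pmf p x) (pmf (poisson_mixture d S) x))"
    if "S \<in> probs_on (euclidean_space_meas d) (orthant d)" for S
  proof -
    have "(\<Sum>\<^sub>\<infinity>x\<in>lattice_points d. l (pmf p x) (pmf (poisson_mixture d S) x)) =
        (\<Sum>\<^sub>\<infinity>x\<in>set Ys. l (pmf p x) (pmf (poisson_mixture d S) x))"
      using l(4) p0 Ys by (intro infsum_cong_neutral) auto
    thus ?thesis
      using D[OF p poisson_mixture_in_lattice_pmfs[OF that]] by simp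
  qed
  let ?l = "\<lambda>S x. l (pmf p x) (pmf (poisson_mixture d S) x)"
  have minle: "(\<Sum>x\<in>set Ys. ?l Q x) \<le> (\<Sum>x\<in>set Ys. ?l S x)"
    if S: "S \<in> probs_on (euclidean_space_meas d) (orthant d)" for S
  proof -
    have "D p (poisson_mixture d Q) \<le> D p (poisson_mixture d S)"
      using min S by (auto simp: is_arg_min_def p_def not_less)
    thus ?thesis unfolding Dsum[OF minimiser_prior] Dsum[OF S]
      by (simp add: ereal_add_le_add_iff)
  qed
  have ninf: "?l S x \<noteq> -\<infinity>" for S x using l(1) by simp
  \<comment> \<open>\<open>l a 0\<close> may be infinite, and then a strict decrease of another term
    would not show in the sum. The unit point prior charges every sample point, so its sum is
    finite, and so is that of the minimiser.\<close>
  define U where "U = return (euclidean_space_meas d) (\<lambda>j\<in>{..<d}. 1::real)"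
  have U: "U \<in> probs_on (euclidean_space_meas d) (orthant d)" unfolding U_def by (rule unit_point_prior)
  have "?l U x \<noteq> \<infinity>" if "x \<in> set Ys" for x
  proof -
    have "pmf (poisson_mixture d U) x = poisson_likelihood d (\<lambda>j\<in>{..<d}. 1) x"
      using that Ys unfolding pmf_poisson_mixture[OF U] unfolding U_def
      by (subst integral_return) (auto simp: space_PiM)
    also have "\<dots> > 0" by (intro poisson_likelihood_pos) auto
    finally show ?thesis using l(2) by simp
  qed
  hence "(\<Sum>x\<in>set Ys. ?l U x) \<noteq> \<infinity>" by (simp add: sum_Pinfty)
  hence "(\<Sum>x\<in>set Ys. ?l Q x) \<noteq> \<infinity>" using minle[OF U] by auto
  hence finQ: "?l Q x \<noteq> \<infinity>" if "x \<in> set Ys" for x using that by (auto simp: sum_Pinfty)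
  have lt: "?l R x < ?l Q x"
    if "x \<in> set Ys" "pmf (poisson_mixture d Q) x < pmf (poisson_mixture d R) x" for x
    using l(3) ppos[OF that(1)] that(2) by (auto simp: monotone_on_def)
  have leR: "?l R x \<le> ?l Q x" if "x \<in> set Ys" for x
    using le[OF that] lt[OF that] by (cases "pmf (poisson_mixture d Q) x = pmf (poisson_mixture d R) x") auto
  have realQ: "ereal (real_of_ereal (?l Q x)) = ?l Q x" if "x \<in> set Ys" for x
    using finQ[OF that] ninf[where S = Q and x = x] by (cases "?l Q x") auto
  have realR: "ereal (real_of_ereal (?l R x)) = ?l R x" if "x \<in> set Ys" for x
    using finQ[OF that] leR[OF that] ninf[where S = R and x = x] by (cases "?l R x") auto
  have "(\<Sum>x\<in>set Ys. real_of_ereal (?l R x)) < (\<Sum>x\<in>set Ys. real_of_ereal (?l Q x))"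
  proof (rule sum_strict_mono_ex1)
    show "\<forall>x\<in>set Ys. real_of_ereal (?l R x) \<le> real_of_ereal (?l Q x)"
      using leR realQ realR by (metis ereal_less_eq(3))
    show "\<exists>x\<in>set Ys. real_of_ereal (?l R x) < real_of_ereal (?l Q x)"
    proof
      have "?l R y < ?l Q y" using lt[OF y] le[OF y] neq by simp
      thus "real_of_ereal (?l R y) < real_of_ereal (?l Q y)"
        using realQ[OF y] realR[OF y] by (metis less_ereal.simps(1))
    qed (fact y)
  qed simp
  moreover have "(\<Sum>x\<in>set Ys. ?l S x) = ereal (\<Sum>x\<in>set Ys. real_of_ereal (?l S x))"
    if "\<And>x. x \<in> set Ys \<Longrightarrow> ereal (real_of_ereal (?l S x)) = ?l S x" for S
    using that by (simp flip: sum_ereal)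
  ultimately show False using minle[OF R] realQ realR by simp
qed

text \<open>Mass outside the cube is moved to the cube by clamping the coordinates, which increases every
  likelihood on the sample. Clamping may leave all these likelihoods zero; such mass is moved to a
  sample point instead.\<close>

lemma minimiser_support:
  assumes b: "\<And>y j. y \<in> set Ys \<Longrightarrow> j < d \<Longrightarrow> real (y j) \<le> b"
  shows "AE \<theta> in Q. \<theta> \<in> cube d b"
proof -
  interpret Q: poisson_prior d Q using minimiser_prior by unfold_locales
  let ?E = "euclidean_space_meas d"
  \<comment> \<open>The total sample likelihood: one function that increases strictly wherever mass
    is moved.\<close>
  define S where "S = (\<lambda>\<theta>. \<Sum>y\<in>set Ys. poisson_likelihood d \<theta> y)"
  define c :: "nat \<Rightarrow> real" where "c = (\<lambda>j\<in>{..<d}. real (hd Ys j))"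
  define \<Phi> where "\<Phi> = (\<lambda>\<theta>. if \<theta> \<in> cube d b then \<theta> else if 0 < S \<theta> then (\<lambda>j\<in>{..<d}. min (\<theta> j) b) else c)"
  have [measurable]: "S \<in> borel_measurable ?E" unfolding S_def by measurable
  have cE [measurable]: "c \<in> space ?E" by (auto simp: c_def space_PiM)
  have \<Phi>m [measurable]: "\<Phi> \<in> measurable ?E ?E" unfolding \<Phi>_def by measurable
  \<comment> \<open>For \<open>d = 0\<close> nothing bounds \<open>b\<close> from below, but then
    there is no coordinate to clamp.\<close>
  have b0: "0 \<le> b" if "0 < d" using b[of "hd Ys" 0] Ys that by (cases Ys) auto
  have \<Phi>O: "\<Phi> \<theta> \<in> orthant d" if "\<theta> \<in> orthant d" for \<theta>
    using that b0 by (auto simp: \<Phi>_def c_def orthant_def cube_def PiE_def Pi_def extensional_def split: if_splits)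
  have Lnn: "0 \<le> poisson_likelihood d \<theta> y" if "\<theta> \<in> orthant d" for \<theta> y
    by (rule poisson_likelihood_nonneg[OF that])
  have ge: "poisson_likelihood d \<theta> y \<le> poisson_likelihood d (\<Phi> \<theta>) y" if "\<theta> \<in> orthant d" "y \<in> set Ys" for \<theta> y
  proof -
    consider "\<theta> \<in> cube d b" | "\<theta> \<notin> cube d b" "0 < S \<theta>" | "\<theta> \<notin> cube d b" "\<not> 0 < S \<theta>" by blast
    thus ?thesis
    proof cases
      case 2
      thus ?thesis using poisson_likelihood_clamp(1)[OF that(1) b[OF that(2)]] by (simp add: \<Phi>_def)
    next
      case 3
      have "poisson_likelihood d \<theta> y \<le> S \<theta>"
        unfolding S_def using that Lnn by (intro member_le_sum) auto
      thus ?thesis using 3 Lnn[OF \<Phi>O[OF that(1)], of y] by linarith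
    qed (simp add: \<Phi>_def)
  qed
  have gt: "S \<theta> < S (\<Phi> \<theta>)" if "\<theta> \<in> orthant d" "\<theta> \<notin> cube d b" for \<theta>
  proof (cases "0 < S \<theta>")
    case True
    note nn = Lnn[OF that(1)]
    from True obtain y where y: "y \<in> set Ys" "0 < poisson_likelihood d \<theta> y"
      unfolding S_def using nn by (metis linorder_not_le sum_nonpos)
    show ?thesis unfolding S_def
    proof (rule sum_strict_mono_ex1)
      show "\<exists>y\<in>set Ys. poisson_likelihood d \<theta> y < poisson_likelihood d (\<Phi> \<theta>) y"
        using poisson_likelihood_clamp(2)[OF that(1) b[OF y(1)] that(2) y(2)] y(1) True that(2)
        by (intro bexI[of _ y]) (simp_all add: \<Phi>_def)
    qed (use ge that in auto)
  next
    case False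
    have "0 < poisson_likelihood d c (hd Ys)"
      by (intro poisson_likelihood_pos) (auto simp: c_def)
    also have "\<dots> = poisson_likelihood d (\<Phi> \<theta>) (hd Ys)" using False that by (simp add: \<Phi>_def)
    also have "\<dots> \<le> S (\<Phi> \<theta>)"
      unfolding S_def using Ys Lnn[OF \<Phi>O[OF that(1)]] by (intro member_le_sum) auto
    finally show ?thesis using False by simp
  qed
  define R where "R = distr Q ?E \<Phi>"
  have \<Phi>Q: "\<Phi> \<in> measurable Q ?E" by measurable
  have "AE \<theta> in R. \<theta> \<in> orthant d"
    unfolding R_def using Q.AE_orthant
    by (subst AE_distr_iff[OF \<Phi>Q]) (auto elim!: eventually_mono intro: \<Phi>O)
  hence R: "R \<in> probs_on ?E (orthant d)"
    unfolding probs_on_def R_def using Q.prob_space_distr[OF \<Phi>Q] by simp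
  have fR: "pmf (poisson_mixture d R) y = (\<integral>\<theta>. poisson_likelihood d (\<Phi> \<theta>) y \<partial>Q)" if "y \<in> lattice_points d" for y
    using that unfolding pmf_poisson_mixture[OF R] unfolding R_def by (simp add: integral_distr[OF \<Phi>Q])
  have fQ: "pmf (poisson_mixture d Q) y = (\<integral>\<theta>. poisson_likelihood d \<theta> y \<partial>Q)" if "y \<in> lattice_points d" for y
    using that unfolding pmf_poisson_mixture[OF minimiser_prior] by simp
  have int: "integrable Q (\<lambda>\<theta>. poisson_likelihood d \<theta> y)" "integrable Q (\<lambda>\<theta>. poisson_likelihood d (\<Phi> \<theta>) y)"
    if "y \<in> lattice_points d" for y
  proof -
    have *: "AE \<theta> in Q. norm (poisson_likelihood d \<theta> y) \<le> 1" "AE \<theta> in Q. norm (poisson_likelihood d (\<Phi> \<theta>) y) \<le> 1"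
      using Q.AE_orthant Lnn \<Phi>O poisson_likelihood_le_1[OF _ that]
      by (auto elim!: eventually_mono)
    show "integrable Q (\<lambda>\<theta>. poisson_likelihood d \<theta> y)"
      by (rule Q.integrable_const_bound[OF *(1)]) measurable
    show "integrable Q (\<lambda>\<theta>. poisson_likelihood d (\<Phi> \<theta>) y)"
      by (rule Q.integrable_const_bound[OF *(2)]) measurable
  qed
  have le: "pmf (poisson_mixture d Q) y \<le> pmf (poisson_mixture d R) y" if "y \<in> set Ys" for y
  proof -
    have yL: "y \<in> lattice_points d" using that Ys by auto
    show ?thesis unfolding fR[OF yL] fQ[OF yL]
      using int[OF yL] by (rule integral_mono_AE) (use Q.AE_orthant ge[OF _ that] in \<open>auto elim!: eventually_mono\<close>)
  qed
  \<comment> \<open>The gain in \<open>S\<close> is nonnegative and, by maximality, has integral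
    zero, so it vanishes almost everywhere; outside the cube it is positive.\<close>
  have "(\<integral>\<theta>. S (\<Phi> \<theta>) - S \<theta> \<partial>Q) = (\<Sum>y\<in>set Ys. pmf (poisson_mixture d R) y - pmf (poisson_mixture d Q) y)"
    unfolding S_def using Ys int fR fQ
    by (subst Bochner_Integration.integral_diff) (auto simp: sum_subtractf subset_iff)
  also have "\<dots> = 0"
    using minimiser_likelihood_maximal[OF R le] by simp
  finally have zero: "(\<integral>\<theta>. S (\<Phi> \<theta>) - S \<theta> \<partial>Q) = 0" .
  have "AE \<theta> in Q. S (\<Phi> \<theta>) - S \<theta> = 0"
  proof (rule integral_nonneg_eq_0_iff_AE[THEN iffD1, OF _ _ zero])
    show "integrable Q (\<lambda>\<theta>. S (\<Phi> \<theta>) - S \<theta>)"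
      unfolding S_def using Ys int by (intro Bochner_Integration.integrable_diff Bochner_Integration.integrable_sum) auto
    show "AE \<theta> in Q. 0 \<le> S (\<Phi> \<theta>) - S \<theta>"
      using Q.AE_orthant by eventually_elim (auto simp: S_def intro!: sum_mono ge)
  qed
  thus ?thesis using Q.AE_orthant
    by eventually_elim (use gt in force)
qed

end

section \<open>Tails of Poisson mixtures\<close>

text \<open>Exponential tilting: \<open>exp (\<beta> * real (y j))\<close> times the likelihood is a
  multiple of the likelihood with \<open>\<theta> j\<close> scaled by \<open>exp \<beta>\<close>,
  and that one sums to 1.\<close>

lemma poisson_exponential_moment:
  assumes \<theta>: "\<theta> \<in> orthant d" and j: "j < d"
  shows "(\<integral>\<^sup>+y. ennreal (poisson_likelihood d \<theta> y) * ennreal (exp (\<beta> * real (y j))) \<partial>count_space (lattice_points d))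
    = ennreal (exp (\<theta> j * (exp \<beta> - 1)))"
proof -
  define \<theta>' where "\<theta>' = \<theta>(j := exp \<beta> * \<theta> j)"
  have \<theta>': "\<theta>' \<in> orthant d"
    using \<theta> j by (auto simp: \<theta>'_def orthant_def PiE_def Pi_def extensional_def)
  have tilt: "poisson_likelihood d \<theta> y * exp (\<beta> * real (y j)) = exp (\<theta> j * (exp \<beta> - 1)) * poisson_likelihood d \<theta>' y" for y
  proof -
    let ?w = "\<lambda>x i. exp (- x i) * x i ^ y i / fact (y i) :: real"
    have split: "(\<Prod>i<d. ?w x i) = ?w x j * (\<Prod>i\<in>{..<d}-{j}. ?w x i)" for x
      using j by (intro prod.remove) auto
    have "(\<Prod>i\<in>{..<d}-{j}. ?w \<theta>' i) = (\<Prod>i\<in>{..<d}-{j}. ?w \<theta> i)"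
      by (intro prod.cong) (auto simp: \<theta>'_def)
    moreover have "?w \<theta> j * exp (\<beta> * real (y j)) = exp (\<theta> j * (exp \<beta> - 1)) * ?w \<theta>' j"
    proof -
      have "exp (- \<theta> j) = exp (\<theta> j * (exp \<beta> - 1)) * exp (- (exp \<beta> * \<theta> j))"
        by (simp add: algebra_simps flip: exp_add)
      moreover have "exp (\<beta> * real (y j)) = exp \<beta> ^ y j" by (simp add: exp_of_nat2_mult)
      ultimately show ?thesis by (simp add: \<theta>'_def power_mult_distrib)
    qed
    ultimately show ?thesis unfolding poisson_likelihood_def split by (simp add: mult_ac)
  qed
  have "(\<integral>\<^sup>+y. ennreal (poisson_likelihood d \<theta> y) * ennreal (exp (\<beta> * real (y j))) \<partial>count_space (lattice_points d))
      = (\<integral>\<^sup>+y. ennreal (exp (\<theta> j * (exp \<beta> - 1))) * ennreal (poisson_likelihood d \<theta>' y) \<partial>count_space (lattice_points d))"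
    using poisson_likelihood_nonneg[OF \<theta>] poisson_likelihood_nonneg[OF \<theta>']
    by (intro nn_integral_cong) (simp add: tilt flip: ennreal_mult)
  thus ?thesis by (simp add: nn_integral_cmult poisson_likelihood_sum[OF \<theta>'])
qed

lemma square_le_exp:
  fixes x \<alpha> :: real
  assumes "0 \<le> x" "0 < \<alpha>"
  shows "x\<^sup>2 \<le> 2 / \<alpha>\<^sup>2 * exp (\<alpha> * x)"
proof -
  have "1 + \<alpha> * x + (\<alpha> * x)\<^sup>2 / 2 \<le> exp (\<alpha> * x)"
    using assms by (intro exp_lower_Taylor_quadratic) auto
  moreover have "0 \<le> \<alpha> * x" using assms by simp
  ultimately have "(\<alpha> * x)\<^sup>2 \<le> 2 * exp (\<alpha> * x)" by linarith
  thus ?thesis using assms by (simp add: power_mult_distrib field_simps)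
qed

text \<open>One exponential factor absorbs the square, a second one, available since
  \<open>t \<le> x\<close>, produces the decay in \<open>t\<close>.\<close>

lemma square_tail_le_exp:
  fixes x \<alpha> t :: real
  assumes "0 \<le> x" "0 < \<alpha>" "t \<le> x"
  shows "x\<^sup>2 \<le> 2 / \<alpha>\<^sup>2 * exp (- (\<alpha> * t)) * exp (2 * \<alpha> * x)"
proof -
  have "x\<^sup>2 \<le> 2 / \<alpha>\<^sup>2 * exp (\<alpha> * x)" using assms by (intro square_le_exp)
  also have "\<dots> \<le> 2 / \<alpha>\<^sup>2 * exp (- (\<alpha> * t) + 2 * \<alpha> * x)"
    using assms by (intro mult_left_mono) auto
  finally show ?thesis by (simp only: exp_add mult.assoc)
qed

context poisson_prior
begin

definition tail_prob :: "nat \<Rightarrow> nat \<Rightarrow> ennreal" where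
  "tail_prob k j = (\<integral>\<^sup>+y. ennreal (f y) * indicator {y. k \<le> y j} y \<partial>count_space (lattice_points d))"

text \<open>A second moment instead of a probability: off the box event the cube of the estimator
  has the largest observed coordinate as side, and its square enters the regret.\<close>

definition tail_moment :: "nat \<Rightarrow> nat \<Rightarrow> ennreal" where
  "tail_moment k j = (\<integral>\<^sup>+y. ennreal (f y) * (ennreal ((real (y j))\<^sup>2) * indicator {y. k \<le> y j} y) \<partial>count_space (lattice_points d))"

lemma tail_prob_le: "ennreal ((real k)\<^sup>2) * tail_prob k j \<le> tail_moment k j"
proof -
  have "ennreal ((real k)\<^sup>2) * tail_prob k j =
      (\<integral>\<^sup>+y. ennreal (f y) * (ennreal ((real k)\<^sup>2) * indicator {y. k \<le> y j} y) \<partial>count_space (lattice_points d))"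
    unfolding tail_prob_def by (simp add: mult_ac flip: nn_integral_cmult)
  also have "\<dots> \<le> tail_moment k j"
    unfolding tail_moment_def
    by (intro nn_integral_mono mult_left_mono) (auto simp: indicator_def intro!: ennreal_leI power_mono)
  finally show ?thesis .
qed

lemma tail_prob_le_real:
  assumes k: "k > 0" and T: "tail_moment k j \<le> ennreal (c * (real k)\<^sup>2)" and c: "0 \<le> c"
  shows "tail_prob k j \<le> ennreal c"
proof -
  have "ennreal (1 / (real k)\<^sup>2) * (ennreal ((real k)\<^sup>2) * tail_prob k j) \<le> ennreal (1 / (real k)\<^sup>2) * ennreal (c * (real k)\<^sup>2)"
    using order_trans[OF tail_prob_le T] by (intro mult_left_mono) auto
  moreover have "ennreal (1 / (real k)\<^sup>2) * (ennreal ((real k)\<^sup>2) * tail_prob k j) = tail_prob k j"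
    using k by (simp flip: mult.assoc ennreal_mult)
  moreover have "ennreal (1 / (real k)\<^sup>2) * ennreal (c * (real k)\<^sup>2) = ennreal c"
    using k c by (simp flip: ennreal_mult)
  ultimately show ?thesis by simp
qed

text \<open>Chernoff bound. What remains is an exponential moment of the prior, the only place where
  cube priors and subexponential priors are treated differently for this tail.\<close>

lemma tail_moment_le:
  assumes j: "j < d" and \<alpha>: "0 < \<alpha>"
  shows "tail_moment k j \<le> ennreal (2 / \<alpha>\<^sup>2 * exp (- (\<alpha> * k))) * (\<integral>\<^sup>+\<theta>. ennreal (exp (\<theta> j * (exp (2 * \<alpha>) - 1))) \<partial>G)"
proof -
  let ?c = "2 / \<alpha>\<^sup>2 * exp (- (\<alpha> * k))"
  have w: "weight (\<lambda>_. 1)" by (rule weight_bounded) auto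
  have "tail_moment k j \<le> (\<integral>\<^sup>+y. ennreal ?c * (ennreal (f y) * ennreal (exp (2 * \<alpha> * real (y j)))) \<partial>count_space (lattice_points d))"
    unfolding tail_moment_def
  proof (intro nn_integral_mono)
    fix y
    have "ennreal ((real (y j))\<^sup>2) * indicator {y. k \<le> y j} y \<le> ennreal (?c * exp (2 * \<alpha> * real (y j)))"
      using square_tail_le_exp[of "real (y j)" \<alpha> "real k"] \<alpha> by (auto simp: indicator_def intro!: ennreal_leI)
    also have "\<dots> = ennreal ?c * ennreal (exp (2 * \<alpha> * real (y j)))"
      by (rule ennreal_mult) auto
    finally have "ennreal (f y) * (ennreal ((real (y j))\<^sup>2) * indicator {y. k \<le> y j} y)
        \<le> ennreal (f y) * (ennreal ?c * ennreal (exp (2 * \<alpha> * real (y j))))"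
      by (rule mult_left_mono) simp
    thus "ennreal (f y) * (ennreal ((real (y j))\<^sup>2) * indicator {y. k \<le> y j} y)
        \<le> ennreal ?c * (ennreal (f y) * ennreal (exp (2 * \<alpha> * real (y j))))"
      by (simp only: mult_ac)
  qed
  also have "\<dots> = ennreal ?c * (\<integral>\<^sup>+y. ennreal (wmix (\<lambda>_. 1) y) * ennreal (exp (2 * \<alpha> * real (y j))) \<partial>count_space (lattice_points d))"
    by (subst nn_integral_cmult, simp) (intro arg_cong2[where f = "(*)"] refl nn_integral_cong, simp add: mixture_eq_wmix)
  also have "(\<integral>\<^sup>+y. ennreal (wmix (\<lambda>_. 1) y) * ennreal (exp (2 * \<alpha> * real (y j))) \<partial>count_space (lattice_points d))
      = (\<integral>\<^sup>+\<theta>. ennreal (exp (\<theta> j * (exp (2 * \<alpha>) - 1))) \<partial>G)"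
    unfolding nn_integral_wmix_weighted[OF w]
    by (intro nn_integral_cong_AE, use AE_orthant in eventually_elim) (simp add: poisson_exponential_moment[OF _ j])
  finally show ?thesis .
qed

end

section \<open>Regret of minimum-distance estimators\<close>

context poisson_prior
begin

definition chi_square_error :: "(nat \<Rightarrow> nat) list \<Rightarrow> ennreal" where
  "chi_square_error Ys = (\<integral>\<^sup>+y. ennreal ((pmf (empirical Ys) y - f y)\<^sup>2 / f y) \<partial>count_space (lattice_points d))"

definition coordinate_regret :: "(nat \<Rightarrow> real) measure \<Rightarrow> nat \<Rightarrow> ennreal" where
  "coordinate_regret Q j =
    (\<integral>\<^sup>+y. ennreal ((bayes_estimator d Q y j - bayes_estimator d G y j)\<^sup>2) \<partial>measure_pmf (poisson_mixture d G))"

text \<open>Dominates the square of the largest coordinate whenever that is at least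
  \<open>k\<close>, and as a sum it has an explicit mean.\<close>

definition sample_tail :: "nat \<Rightarrow> (nat \<Rightarrow> nat) list \<Rightarrow> ennreal" where
  "sample_tail k Ys = (\<Sum>Y\<leftarrow>Ys. \<Sum>i<d. ennreal ((real (Y i))\<^sup>2) * indicator {y. k \<le> y i} Y)"

lemma expected_sample_tail:
  "(\<integral>\<^sup>+Ys. sample_tail k Ys \<partial>measure_pmf (replicate_pmf n (poisson_mixture d G))) = of_nat n * (\<Sum>i<d. tail_moment k i)"
proof -
  have "(\<integral>\<^sup>+Y. (\<Sum>i<d. ennreal ((real (Y i))\<^sup>2) * indicator {y. k \<le> y i} Y) \<partial>measure_pmf (poisson_mixture d G))
      = (\<Sum>i<d. tail_moment k i)"
    by (subst nn_integral_sum) (simp_all add: nn_integral_pmf_lattice[OF mixture_in_lattice_pmfs] tail_moment_def)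
  thus ?thesis unfolding sample_tail_def nn_integral_replicate_pmf_sum_list by simp
qed

lemma sample_in_lattice:
  assumes "Ys \<in> set_pmf (replicate_pmf n (poisson_mixture d G))"
  shows "length Ys = n" "set Ys \<subseteq> set_pmf (poisson_mixture d G)" "set Ys \<subseteq> lattice_points d"
  using assms mixture_in_lattice_pmfs by (auto simp: set_replicate_pmf lattice_pmfs_def)

lemma sample_tail_ge:
  assumes "Y \<in> set Ys" "i < d" "k \<le> Y i"
  shows "ennreal ((real (Y i))\<^sup>2) \<le> sample_tail k Ys"
proof -
  let ?F = "\<lambda>Y. \<Sum>i<d. ennreal ((real (Y i))\<^sup>2) * indicator {y. k \<le> y i} Y"
  have "ennreal ((real (Y i))\<^sup>2) = ennreal ((real (Y i))\<^sup>2) * indicator {y. k \<le> y i} Y"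
    using assms by simp
  also have "\<dots> \<le> ?F Y" using assms by (intro member_le_sum) auto
  also have "\<dots> \<le> (\<Sum>Y\<leftarrow>Ys. ?F Y)"
    using assms(1) by (intro member_le_sum_list) auto
  finally show ?thesis by (simp add: sample_tail_def)
qed

text \<open>Interface shared by both estimators: a bound for a fixed sample is integrated over the
  sample.\<close>

lemma regret_le:
  assumes n: "n > 0"
    and R: "\<And>Ys j. length Ys = n \<Longrightarrow> set Ys \<subseteq> lattice_points d \<Longrightarrow> set Ys \<subseteq> set_pmf (poisson_mixture d G) \<Longrightarrow> j < d \<Longrightarrow>
      coordinate_regret (Ghat Ys) j \<le> ennreal a * (if set Ys \<subseteq> lattice_box d k then chi_square_error Ys else 0)
        + ennreal b * sample_tail k Ys + ennreal c"
  shows "regret d n Ghat G \<le> of_nat d * (ennreal a * (ennreal (real k ^ d / n) + (\<Sum>j<d. tail_prob k j))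
      + ennreal b * (of_nat n * (\<Sum>j<d. tail_moment k j)) + ennreal c)"
proof -
  let ?P = "measure_pmf (replicate_pmf n (poisson_mixture d G))"
  have "regret d n Ghat G = (\<integral>\<^sup>+Ys. (\<Sum>j<d. coordinate_regret (Ghat Ys) j) \<partial>?P)"
    unfolding regret_def nn_integral_pair_pmf' coordinate_regret_def
    by (subst nn_integral_sum[symmetric]) (auto simp: sum_ennreal intro!: nn_integral_cong)
  also have "\<dots> \<le> (\<integral>\<^sup>+Ys. of_nat d * (ennreal a * (if set Ys \<subseteq> lattice_box d k then chi_square_error Ys else 0)
        + ennreal b * sample_tail k Ys + ennreal c) \<partial>?P)"
  proof (intro nn_integral_mono_AE AE_pmfI)
    fix Ys assume "Ys \<in> set_pmf (replicate_pmf n (poisson_mixture d G))"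
    from sample_in_lattice[OF this] have "(\<Sum>j<d. coordinate_regret (Ghat Ys) j) \<le> of_nat (card {..<d}) *
       (ennreal a * (if set Ys \<subseteq> lattice_box d k then chi_square_error Ys else 0) + ennreal b * sample_tail k Ys + ennreal c)"
      by (intro sum_bounded_above R) auto
    thus "(\<Sum>j<d. coordinate_regret (Ghat Ys) j) \<le> of_nat d *
       (ennreal a * (if set Ys \<subseteq> lattice_box d k then chi_square_error Ys else 0) + ennreal b * sample_tail k Ys + ennreal c)"
      by (simp only: card_lessThan)
  qed
  also have "\<dots> = of_nat d * (ennreal a * (\<integral>\<^sup>+Ys. (if set Ys \<subseteq> lattice_box d k then chi_square_error Ys else 0) \<partial>?P)
      + ennreal b * (of_nat n * (\<Sum>j<d. tail_moment k j)) + ennreal c)"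
    by (simp add: nn_integral_add nn_integral_cmult expected_sample_tail measure_pmf.emeasure_space_1)
  also have "\<dots> \<le> of_nat d * (ennreal a * (ennreal (real k ^ d / n) + (\<Sum>j<d. tail_prob k j))
      + ennreal b * (of_nat n * (\<Sum>j<d. tail_moment k j)) + ennreal c)"
    unfolding chi_square_error_def tail_prob_def
    by (intro mult_left_mono add_mono order.refl expected_chi_square_le[OF n]) auto
  finally show ?thesis .
qed

text \<open>Summing over n observations and d <= n coordinates turns n^(-3) into 1/n, so the tails
  do not exceed the order of the main term.\<close>

lemma regret_le_real:
  assumes n: "n > 0" "d \<le> n" and k: "k > 0" and c0: "1 \<le> c0" and abc: "0 \<le> a" "0 \<le> b" "0 \<le> c"
    and T: "\<And>j. j < d \<Longrightarrow> tail_moment k j \<le> ennreal (c0 * (real k)\<^sup>2 / real n ^ 3)"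
    and R: "\<And>Ys j. length Ys = n \<Longrightarrow> set Ys \<subseteq> lattice_points d \<Longrightarrow> set Ys \<subseteq> set_pmf (poisson_mixture d G) \<Longrightarrow> j < d \<Longrightarrow>
      coordinate_regret (Ghat Ys) j \<le> ennreal a * (if set Ys \<subseteq> lattice_box d k then chi_square_error Ys else 0)
        + ennreal b * sample_tail k Ys + ennreal c"
  shows "regret d n Ghat G \<le> ennreal (real d * (2 * c0 * a * real k ^ d + c0 * b * (real k)\<^sup>2 + c * n) / n)"
proof -
  have k1: "1 \<le> real k ^ d" using k by simp
  have n1: "1 \<le> real n" using n by simp
  have dn: "real d \<le> real n" using n by simp
  have "(\<Sum>j<d. tail_moment k j) \<le> of_nat (card {..<d}) * ennreal (c0 * (real k)\<^sup>2 / real n ^ 3)"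
    by (intro sum_bounded_above T) auto
  hence "of_nat n * (\<Sum>j<d. tail_moment k j) \<le> of_nat n * (of_nat d * ennreal (c0 * (real k)\<^sup>2 / real n ^ 3))"
    by (intro mult_left_mono) auto
  also have "\<dots> = ennreal (real n * (real d * (c0 * (real k)\<^sup>2 / real n ^ 3)))"
    using c0 by (simp add: ennreal_of_nat_eq_real_of_nat ennreal_mult[symmetric])
  also have "\<dots> \<le> ennreal (real n * (real n * (c0 * (real k)\<^sup>2 / real n ^ 3)))"
    using c0 dn by (intro ennreal_leI mult_left_mono mult_right_mono) auto
  also have "real n * (real n * (c0 * (real k)\<^sup>2 / real n ^ 3)) = c0 * (real k)\<^sup>2 / n"
    using n by (simp add: power3_eq_cube field_simps)
  finally have Tn: "of_nat n * (\<Sum>j<d. tail_moment k j) \<le> ennreal (c0 * (real k)\<^sup>2 / n)" .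
  have tp: "tail_prob k j \<le> ennreal (c0 / real n ^ 3)" if "j < d" for j
    using T[OF that] c0 by (intro tail_prob_le_real[OF k]) auto
  have "(\<Sum>j<d. tail_prob k j) \<le> of_nat (card {..<d}) * ennreal (c0 / real n ^ 3)"
    by (intro sum_bounded_above tp) auto
  also have "\<dots> = ennreal (real d * (c0 / real n ^ 3))"
    using c0 by (simp add: ennreal_of_nat_eq_real_of_nat ennreal_mult[symmetric])
  also have "\<dots> \<le> ennreal (c0 * real k ^ d / n)"
  proof (rule ennreal_leI)
    have "real d * (c0 / real n ^ 3) \<le> real n * (c0 / real n ^ 3)"
      using dn c0 by (intro mult_right_mono) auto
    also have "\<dots> = c0 / n * (1 / n)" using n by (simp add: power3_eq_cube)
    also have "\<dots> \<le> c0 / n * real k ^ d"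
      using n1 k1 c0 by (intro mult_left_mono) (auto intro: order_trans[of _ 1])
    finally show "real d * (c0 / real n ^ 3) \<le> c0 * real k ^ d / n" by simp
  qed
  finally have tps: "(\<Sum>j<d. tail_prob k j) \<le> ennreal (c0 * real k ^ d / n)" .
  have "regret d n Ghat G \<le> of_nat d * (ennreal a * (ennreal (real k ^ d / n) + (\<Sum>j<d. tail_prob k j))
      + ennreal b * (of_nat n * (\<Sum>j<d. tail_moment k j)) + ennreal c)"
    by (rule regret_le[OF n(1) R])
  also have "\<dots> \<le> of_nat d * (ennreal a * (ennreal (c0 * real k ^ d / n) + ennreal (c0 * real k ^ d / n))
      + ennreal b * ennreal (c0 * (real k)\<^sup>2 / n) + ennreal c)"
  proof -
    have "real k ^ d / n \<le> c0 * real k ^ d / n"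
      using mult_right_mono[of 1 c0 "real k ^ d"] c0 k1 by (intro divide_right_mono) auto
    thus ?thesis by (intro mult_left_mono add_mono tps Tn order.refl ennreal_leI) auto
  qed
  also have "\<dots> = ennreal (real d * (a * (c0 * real k ^ d / n + c0 * real k ^ d / n) + b * (c0 * (real k)\<^sup>2 / n) + c))"
    using abc c0 by (simp add: ennreal_of_nat_eq_real_of_nat ennreal_plus[symmetric] ennreal_mult[symmetric] del: ennreal_plus)
  also have "real d * (a * (c0 * real k ^ d / n + c0 * real k ^ d / n) + b * (c0 * (real k)\<^sup>2 / n) + c)
      = real d * (2 * c0 * a * real k ^ d + c0 * b * (real k)\<^sup>2 + c * n) / n"
    using n by (simp add: field_simps)
  finally show ?thesis .
qed

text \<open>The true prior is itself a competitor in the minimisation, and the sample lies in the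
  support of its mixture, as the chi-square bound requires.\<close>

lemma hellinger_estimator_le:
  assumes kpos: "\<kappa>1 > 0" "\<kappa>2 > 0" and sw: "sandwich_property \<kappa>1 \<kappa>2 d D"
    and Ys: "Ys \<noteq> []" "set Ys \<subseteq> lattice_points d" "set Ys \<subseteq> set_pmf (poisson_mixture d G)"
    and \<Theta>: "\<Theta> \<subseteq> orthant d" and G: "AE \<theta> in G. \<theta> \<in> \<Theta>"
    and min: "is_arg_min (\<lambda>Q. D (empirical Ys) (poisson_mixture d Q)) (\<lambda>Q. Q \<in> probs_on (euclidean_space_meas d) \<Theta>) Q"
  shows "hellinger d f (pmf (poisson_mixture d Q)) \<le> ennreal (4 * (\<kappa>2 / \<kappa>1)) * chi_square_error Ys"
  unfolding chi_square_error_def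
proof (rule min_distance_hellinger_le[OF kpos sw])
  have Q: "Q \<in> probs_on (euclidean_space_meas d) \<Theta>" using min by (simp add: is_arg_min_def)
  hence "Q \<in> probs_on (euclidean_space_meas d) (orthant d)"
    using \<Theta> by (auto simp: probs_on_def elim!: eventually_mono)
  thus "poisson_mixture d Q \<in> lattice_pmfs d" by (rule poisson_mixture_in_lattice_pmfs)
  show "empirical Ys \<in> lattice_pmfs d" "set_pmf (empirical Ys) \<subseteq> set_pmf (poisson_mixture d G)"
    using Ys by (auto simp: lattice_pmfs_def empirical_def)
  have "G \<in> probs_on (euclidean_space_meas d) \<Theta>" using prior G by (simp add: probs_on_def)
  thus "D (empirical Ys) (poisson_mixture d Q) \<le> D (empirical Ys) (poisson_mixture d G)"
    using min by (auto simp: is_arg_min_def not_less)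
qed (rule mixture_in_lattice_pmfs)

text \<open>The prefactor is abstracted to \<open>A\<close> because it is a multiple of k^2 for the
  unconstrained and of h k for the constrained estimator.\<close>

lemma coordinate_regret_le_chi_square:
  fixes h b \<rho> :: real
  assumes Q: "Q \<in> probs_on (euclidean_space_meas d) (cube d b)" and hb: "0 \<le> h" "0 \<le> b" and j: "j < d"
    and H: "hellinger d f (pmf (poisson_mixture d Q)) \<le> ennreal (4 * \<rho>) * X" and \<rho>: "0 \<le> \<rho>"
    and \<tau>: "tail_prob k j \<le> ennreal t" "0 \<le> t"
    and \<delta>: "(\<integral>\<^sup>+\<theta>. indicator (- cube d h) \<theta> \<partial>G) \<le> ennreal e" "0 \<le> e"
    and m: "(\<integral>\<^sup>+\<theta>. ennreal ((\<theta> j)\<^sup>2) * indicator (- cube d h) \<theta> \<partial>G) \<le> ennreal m" "0 \<le> m"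
    and A: "8 * (h + b)\<^sup>2 + 32 * real k * (h + b) \<le> A"
  shows "coordinate_regret Q j \<le> ennreal (8 * \<rho> * A) * X
    + ennreal (2 * A * e + 2 * (h + b)\<^sup>2 * (t + e) + 2 * m + 2 * h\<^sup>2 * e)"
proof -
  have A0: "0 \<le> A" using A hb by (intro order_trans[OF _ A]) auto
  have "coordinate_regret Q j \<le> ennreal A * (2 * (ennreal (4 * \<rho>) * X) + 2 * ennreal e)
      + ennreal (2 * (h + b)\<^sup>2) * ennreal t
      + ennreal (2 * (h + b)\<^sup>2) * ennreal e + (2 * ennreal m + ennreal (2 * h\<^sup>2) * ennreal e)"
    unfolding coordinate_regret_def
    by (rule order_trans[OF bayes_regret_le(1)[OF Q hb j, where k = k]])
      (intro add_mono mult_mono ennreal_leI A H \<delta> m \<tau>[unfolded tail_prob_def]; simp)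
  also have "\<dots> = ennreal A * (2 * (ennreal (4 * \<rho>) * X)) + (ennreal A * (2 * ennreal e)
      + ennreal (2 * (h + b)\<^sup>2) * ennreal t
      + ennreal (2 * (h + b)\<^sup>2) * ennreal e + (2 * ennreal m + ennreal (2 * h\<^sup>2) * ennreal e))"
    by (simp only: distrib_left add.assoc)
  also have "ennreal A * (2 * (ennreal (4 * \<rho>) * X)) = ennreal (8 * \<rho> * A) * X"
  proof -
    have "ennreal A * (2 * (ennreal (4 * \<rho>) * X)) = (ennreal A * ennreal 2 * ennreal (4 * \<rho>)) * X"
      by (simp add: mult.assoc)
    also have "ennreal A * ennreal 2 * ennreal (4 * \<rho>) = ennreal (8 * \<rho> * A)"
      using A0 \<rho> by (subst ennreal_mult[symmetric], simp, simp)+ (simp add: mult_ac)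
    finally show ?thesis .
  qed
  also have "ennreal A * (2 * ennreal e) + ennreal (2 * (h + b)\<^sup>2) * ennreal t
      + ennreal (2 * (h + b)\<^sup>2) * ennreal e + (2 * ennreal m + ennreal (2 * h\<^sup>2) * ennreal e)
      = ennreal (A * (2 * e) + 2 * (h + b)\<^sup>2 * t + 2 * (h + b)\<^sup>2 * e + (2 * m + 2 * h\<^sup>2 * e))"
    using A0 \<tau>(2) \<delta>(2) m(2)
    by (simp only: ennreal_plus ennreal_mult mult_nonneg_nonneg zero_le_power2 add_nonneg_nonneg
          zero_le_numeral ennreal_numeral)
  also have "A * (2 * e) + 2 * (h + b)\<^sup>2 * t + 2 * (h + b)\<^sup>2 * e + (2 * m + 2 * h\<^sup>2 * e)
      = 2 * A * e + 2 * (h + b)\<^sup>2 * (t + e) + 2 * m + 2 * h\<^sup>2 * e"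
    by (simp add: algebra_simps)
  finally show ?thesis .
qed

lemma coordinate_regret_le_crude:
  fixes h b :: real
  assumes Q: "Q \<in> probs_on (euclidean_space_meas d) (cube d b)" and hb: "0 \<le> h" "0 \<le> b" and j: "j < d"
    and \<delta>: "(\<integral>\<^sup>+\<theta>. indicator (- cube d h) \<theta> \<partial>G) \<le> ennreal e" "0 \<le> e"
    and m: "(\<integral>\<^sup>+\<theta>. ennreal ((\<theta> j)\<^sup>2) * indicator (- cube d h) \<theta> \<partial>G) \<le> ennreal m" "0 \<le> m"
  shows "coordinate_regret Q j \<le> ennreal (2 * (h + b)\<^sup>2) + ennreal (2 * m + 2 * h\<^sup>2 * e)"
proof -
  have "coordinate_regret Q j \<le> ennreal (2 * (h + b)\<^sup>2) + (2 * ennreal m + ennreal (2 * h\<^sup>2) * ennreal e)"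
    unfolding coordinate_regret_def
    by (rule order_trans[OF bayes_regret_le(2)[OF Q hb j]]) (intro add_mono mult_left_mono \<delta> m; simp)
  also have "2 * ennreal m + ennreal (2 * h\<^sup>2) * ennreal e = ennreal (2 * m + 2 * h\<^sup>2 * e)"
    using \<delta>(2) m(2)
    by (simp only: ennreal_plus ennreal_mult mult_nonneg_nonneg zero_le_power2 zero_le_numeral ennreal_numeral)
  finally show ?thesis .
qed

lemma unconstrained_regret_le:
  fixes h :: real
  assumes kpos: "\<kappa>1 > 0" "\<kappa>2 > 0" and sw: "sandwich_property \<kappa>1 \<kappa>2 d D" and dec: "decomposition_property d D"
    and est: "min_distance_estimator d n D (orthant d) Ghat"
    and n: "n > 0" "d \<le> n" and k: "k > 0" and c0: "1 \<le> c0" and h: "0 \<le> h" "h \<le> k"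
    and T: "\<And>j. j < d \<Longrightarrow> tail_moment k j \<le> ennreal (c0 * (real k)\<^sup>2 / real n ^ 3)"
    and \<delta>: "(\<integral>\<^sup>+\<theta>. indicator (- cube d h) \<theta> \<partial>G) \<le> ennreal (c0 / n)"
    and m: "\<And>j. j < d \<Longrightarrow> (\<integral>\<^sup>+\<theta>. ennreal ((\<theta> j)\<^sup>2) * indicator (- cube d h) \<theta> \<partial>G) \<le> ennreal (c0 * (real k)\<^sup>2 / n)"
  shows "regret d n Ghat G \<le> ennreal (real d * ((1536 * (\<kappa>2 / \<kappa>1) + 220) * c0 * real k ^ (d + 2)) / n)"
proof -
  define \<rho> where "\<rho> = \<kappa>2 / \<kappa>1"
  have \<rho>: "0 \<le> \<rho>" using kpos by (simp add: \<rho>_def)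
  have k1: "1 \<le> real k" using k by simp
  have n1: "1 \<le> real n" using n by simp
  define u where "u = (real k)\<^sup>2"
  have u: "1 \<le> u" using k1 by (simp add: u_def)
  have hk: "h\<^sup>2 \<le> u" unfolding u_def using h by (intro power_mono) auto
  have n3: "real n \<le> real n ^ 3" using n1 by (rule self_le_power) simp
  have \<tau>: "tail_prob k j \<le> ennreal (c0 / n)" if "j < d" for j
  proof (rule tail_prob_le_real[OF k])
    have "c0 * (real k)\<^sup>2 / real n ^ 3 \<le> c0 / n * (real k)\<^sup>2"
      using n3 n1 c0 by (simp add: frac_le)
    thus "tail_moment k j \<le> ennreal (c0 / n * (real k)\<^sup>2)"
      using T[OF that] by (meson ennreal_leI order_trans)
  qed (use c0 in auto)
  \<comment> \<open>In the box case \<open>h\<close> and the side b = k are at most k, so the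
    prefactor is at most 8 (2k)^2 + 32 k (2k) = 96 k^2, and 768 = 8 * 96. The errors in c0 k^2 / n
    add up to 212 = 192 + 16 + 2 + 2. Outside the box the crude bound 2 (2b)^2 gives the factor
    8.\<close>
  have R: "coordinate_regret (Ghat Ys) j \<le> ennreal (768 * \<rho> * u) * (if set Ys \<subseteq> lattice_box d k then chi_square_error Ys else 0)
        + ennreal 8 * sample_tail k Ys + ennreal (212 * c0 * u / n)"
    if Ys: "length Ys = n" "set Ys \<subseteq> lattice_points d" "set Ys \<subseteq> set_pmf (poisson_mixture d G)" and j: "j < d" for Ys j
  proof -
    have ne: "Ys \<noteq> []" using Ys n by auto
    have min: "is_arg_min (\<lambda>Q. D (empirical Ys) (poisson_mixture d Q))
          (\<lambda>Q. Q \<in> probs_on (euclidean_space_meas d) (orthant d)) (Ghat Ys)"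
      using est Ys by (simp add: min_distance_estimator_def)
    hence QO: "Ghat Ys \<in> probs_on (euclidean_space_meas d) (orthant d)" by (simp add: is_arg_min_def)
    have Qcube: "Ghat Ys \<in> probs_on (euclidean_space_meas d) (cube d b)"
      if "\<And>y j. y \<in> set Ys \<Longrightarrow> j < d \<Longrightarrow> real (y j) \<le> b" for b
      using minimiser_support[where b = b, OF dec ne Ys(2) min] that QO by (simp add: probs_on_def)
    show ?thesis
    proof (cases "set Ys \<subseteq> lattice_box d k")
      case True
      have Q: "Ghat Ys \<in> probs_on (euclidean_space_meas d) (cube d (real k))"
        using True by (intro Qcube) (fastforce simp: lattice_box_def PiE_def Pi_def intro: less_imp_le)
      have H: "hellinger d f (pmf (poisson_mixture d (Ghat Ys))) \<le> ennreal (4 * \<rho>) * chi_square_error Ys"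
        unfolding \<rho>_def by (rule hellinger_estimator_le[OF kpos sw ne Ys(2,3) _ AE_orthant min]) simp
      have hk2: "(h + k)\<^sup>2 \<le> (2 * real k)\<^sup>2" using h by (intro power_mono) auto
      have "32 * real k * (h + k) \<le> 32 * real k * (2 * real k)" using h by (intro mult_left_mono) auto
      hence A: "8 * (h + real k)\<^sup>2 + 32 * real k * (h + real k) \<le> 96 * u"
        using hk2 by (simp add: u_def power2_eq_square)
      have "coordinate_regret (Ghat Ys) j \<le> ennreal (8 * \<rho> * (96 * u)) * chi_square_error Ys
          + ennreal (2 * (96 * u) * (c0 / n) + 2 * (h + real k)\<^sup>2 * (c0 / n + c0 / n) + 2 * (c0 * (real k)\<^sup>2 / n) + 2 * h\<^sup>2 * (c0 / n))"
        by (rule coordinate_regret_le_chi_square[OF Q h(1) _ j H \<rho> \<tau>[OF j] _ \<delta> _ m[OF j] _ A]) (use c0 in auto)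
      also have "\<dots> \<le> ennreal (8 * \<rho> * (96 * u)) * chi_square_error Ys + ennreal (212 * c0 * u / n)"
      proof (intro add_left_mono ennreal_leI)
        have "2 * (h + real k)\<^sup>2 * (c0 / n + c0 / n) \<le> 2 * (4 * u) * (c0 / n + c0 / n)"
          using hk2 c0 by (intro mult_right_mono) (auto simp: u_def power_mult_distrib)
        moreover have "2 * h\<^sup>2 * (c0 / n) \<le> 2 * u * (c0 / n)"
          using hk c0 by (intro mult_right_mono) auto
        moreover have "2 * (96 * u) * (c0 / n) + 2 * (4 * u) * (c0 / n + c0 / n) + 2 * (c0 * u / n) + 2 * u * (c0 / n) = 212 * c0 * u / n"
          using n1 by (simp add: field_simps)
        ultimately show "2 * (96 * u) * (c0 / n) + 2 * (h + real k)\<^sup>2 * (c0 / n + c0 / n) + 2 * (c0 * (real k)\<^sup>2 / n) + 2 * h\<^sup>2 * (c0 / n) \<le> 212 * c0 * u / n"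
          unfolding u_def by linarith
      qed
      also have "\<dots> \<le> ennreal (768 * \<rho> * u) * (if set Ys \<subseteq> lattice_box d k then chi_square_error Ys else 0)
        + ennreal 8 * sample_tail k Ys + ennreal (212 * c0 * u / n)"
        using True by (intro add_right_mono) (simp add: mult_ac)
      finally show ?thesis .
    next
      case False
      then obtain Y0 where Y0: "Y0 \<in> set Ys" "Y0 \<notin> lattice_box d k" by auto
      then obtain i0 where i0: "i0 < d" "k \<le> Y0 i0" using Ys(2) not_in_lattice_boxE by blast
      \<comment> \<open>The maximum of \<open>E\<close> is the largest coordinate in the whole
        sample, the side of the cube carrying the minimiser; here it is at least
        \<open>k\<close>.\<close>
      define E where "E = (\<lambda>(Y, i). Y i) ` (set Ys \<times> {..<d})"
      have fin: "finite E" by (simp add: E_def)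
      have "Y0 i0 \<in> E" using Y0 i0 by (force simp: E_def)
      hence ge: "Y0 i0 \<le> Max E" and "Max E \<in> E" using fin by (auto intro: Max_in)
      then obtain Y i where Yi: "Y \<in> set Ys" "i < d" "Y i = Max E" by (auto simp: E_def)
      have kY: "k \<le> Y i" using ge i0 Yi by simp
      have Q: "Ghat Ys \<in> probs_on (euclidean_space_meas d) (cube d (real (Y i)))"
      proof (rule Qcube)
        fix y j assume "y \<in> set Ys" "j < d"
        hence "y j \<in> E" by (force simp: E_def)
        thus "real (y j) \<le> real (Y i)" using Yi fin by simp
      qed
      have "coordinate_regret (Ghat Ys) j \<le> ennreal (2 * (h + real (Y i))\<^sup>2) + ennreal (2 * (c0 * (real k)\<^sup>2 / n) + 2 * h\<^sup>2 * (c0 / n))"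
        by (rule coordinate_regret_le_crude[OF Q h(1) _ j \<delta> _ m[OF j]]) (use c0 in auto)
      also have "\<dots> \<le> ennreal (8 * (real (Y i))\<^sup>2) + ennreal (212 * c0 * u / n)"
      proof (intro add_mono ennreal_leI)
        have "(h + real (Y i))\<^sup>2 \<le> (2 * real (Y i))\<^sup>2" using h kY by (intro power_mono) auto
        thus "2 * (h + real (Y i))\<^sup>2 \<le> 8 * (real (Y i))\<^sup>2" by (simp add: power_mult_distrib)
        have "2 * h\<^sup>2 * (c0 / n) \<le> 2 * u * (c0 / n)"
          using hk c0 by (intro mult_right_mono) auto
        moreover have "2 * (c0 * u / n) + 2 * u * (c0 / n) \<le> 212 * c0 * u / n"
          using c0 u n1 by (simp add: field_simps)
        ultimately show "2 * (c0 * (real k)\<^sup>2 / n) + 2 * h\<^sup>2 * (c0 / n) \<le> 212 * c0 * u / n"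
          unfolding u_def by linarith
      qed
      also have "ennreal (8 * (real (Y i))\<^sup>2) = ennreal 8 * ennreal ((real (Y i))\<^sup>2)"
        by (rule ennreal_mult) auto
      also have "\<dots> + ennreal (212 * c0 * u / n) \<le> ennreal 8 * sample_tail k Ys + ennreal (212 * c0 * u / n)"
        by (intro add_right_mono mult_left_mono sample_tail_ge Yi kY) simp
      finally show ?thesis using False by simp
    qed
  qed
  have "regret d n Ghat G \<le> ennreal (real d * (2 * c0 * (768 * \<rho> * u) * real k ^ d + c0 * 8 * (real k)\<^sup>2 + 212 * c0 * u / n * n) / n)"
    by (rule regret_le_real[OF n k c0 _ _ _ T R]) (use c0 \<rho> u in auto)
  also have "\<dots> \<le> ennreal (real d * ((1536 * \<rho> + 220) * c0 * real k ^ (d + 2)) / n)"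
  proof (intro ennreal_leI divide_right_mono mult_left_mono)
    have "u \<le> real k ^ (d + 2)" unfolding u_def using k1 by (intro power_increasing) auto
    hence "220 * c0 * u \<le> 220 * c0 * real k ^ (d + 2)" using c0 by (intro mult_left_mono) auto
    thus "2 * c0 * (768 * \<rho> * u) * real k ^ d + c0 * 8 * (real k)\<^sup>2 + 212 * c0 * u / n * n \<le> (1536 * \<rho> + 220) * c0 * real k ^ (d + 2)"
      using n by (simp add: u_def power_add power2_eq_square algebra_simps)
  qed auto
  finally show ?thesis by (simp add: \<rho>_def)
qed

text \<open>Both priors live on the cube of side h <= k, so the prefactor is 32 h^2 + 64 h k <= 96 h
  k: one factor k improves to h. Outside the box the regret is at most 8 h^2 <= (8 h / k) k^2, which
  explains the weight of \<open>sample_tail\<close>.\<close>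

lemma constrained_regret_le:
  fixes h :: real
  assumes kpos: "\<kappa>1 > 0" "\<kappa>2 > 0" and sw: "sandwich_property \<kappa>1 \<kappa>2 d D"
    and est: "min_distance_estimator d n D (cube d h) Ghat"
    and n: "n > 0" "d \<le> n" and k: "k > 0" and c0: "1 \<le> c0" and h: "0 \<le> h" "h \<le> k"
    and T: "\<And>j. j < d \<Longrightarrow> tail_moment k j \<le> ennreal (c0 * (real k)\<^sup>2 / real n ^ 3)"
    and G: "AE \<theta> in G. \<theta> \<in> cube d h"
  shows "regret d n Ghat G \<le> ennreal (real d * ((1536 * (\<kappa>2 / \<kappa>1) + 16) * c0 * h * real k ^ (d + 1)) / n)"
proof -
  define \<rho> where "\<rho> = \<kappa>2 / \<kappa>1"
  have \<rho>: "0 \<le> \<rho>" using kpos by (simp add: \<rho>_def)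
  have k1: "1 \<le> real k" using k by simp
  have n1: "1 \<le> real n" using n by simp
  have n3: "real n \<le> real n ^ 3" using n1 by (rule self_le_power) simp
  have hh: "h\<^sup>2 \<le> h * k" using h by (simp add: power2_eq_square mult_left_mono)
  have hk: "0 \<le> h * k" using h by simp
  have \<tau>: "tail_prob k j \<le> ennreal (c0 / n)" if "j < d" for j
  proof (rule tail_prob_le_real[OF k])
    have "c0 * (real k)\<^sup>2 / real n ^ 3 \<le> c0 / n * (real k)\<^sup>2"
      using n3 n1 c0 by (simp add: frac_le)
    thus "tail_moment k j \<le> ennreal (c0 / n * (real k)\<^sup>2)"
      using T[OF that] by (meson ennreal_leI order_trans)
  qed (use c0 in auto)
  have ind0: "AE \<theta> in G. indicator (- cube d h) \<theta> = (0 :: ennreal)"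
    using G by eventually_elim simp
  have \<delta>: "(\<integral>\<^sup>+\<theta>. indicator (- cube d h) \<theta> \<partial>G) \<le> ennreal 0"
    using ind0 by (subst nn_integral_cong_AE[where v = "\<lambda>_. 0"]) auto
  have m: "(\<integral>\<^sup>+\<theta>. ennreal ((\<theta> j)\<^sup>2) * indicator (- cube d h) \<theta> \<partial>G) \<le> ennreal 0" for j
    using ind0 by (subst nn_integral_cong_AE[where v = "\<lambda>_. 0"]) (auto elim!: eventually_mono)
  have R: "coordinate_regret (Ghat Ys) j \<le> ennreal (768 * \<rho> * (h * k)) * (if set Ys \<subseteq> lattice_box d k then chi_square_error Ys else 0)
        + ennreal (8 * h / k) * sample_tail k Ys + ennreal (8 * (h * k) * c0 / n)"
    if Ys: "length Ys = n" "set Ys \<subseteq> lattice_points d" "set Ys \<subseteq> set_pmf (poisson_mixture d G)" and j: "j < d" for Ys j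
  proof -
    have ne: "Ys \<noteq> []" using Ys n by auto
    have min: "is_arg_min (\<lambda>Q. D (empirical Ys) (poisson_mixture d Q))
          (\<lambda>Q. Q \<in> probs_on (euclidean_space_meas d) (cube d h)) (Ghat Ys)"
      using est Ys by (simp add: min_distance_estimator_def)
    hence Q: "Ghat Ys \<in> probs_on (euclidean_space_meas d) (cube d h)" by (simp add: is_arg_min_def)
    show ?thesis
    proof (cases "set Ys \<subseteq> lattice_box d k")
      case True
      have H: "hellinger d f (pmf (poisson_mixture d (Ghat Ys))) \<le> ennreal (4 * \<rho>) * chi_square_error Ys"
        unfolding \<rho>_def by (rule hellinger_estimator_le[OF kpos sw ne Ys(2,3) cube_subset_orthant G min])
      have A: "8 * (h + h)\<^sup>2 + 32 * real k * (h + h) \<le> 96 * (h * k)"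
        using hh by (simp add: power2_eq_square algebra_simps)
      have "coordinate_regret (Ghat Ys) j \<le> ennreal (8 * \<rho> * (96 * (h * k))) * chi_square_error Ys
          + ennreal (2 * (96 * (h * k)) * 0 + 2 * (h + h)\<^sup>2 * (c0 / n + 0) + 2 * 0 + 2 * h\<^sup>2 * 0)"
        by (rule coordinate_regret_le_chi_square[OF Q h(1) h(1) j H \<rho> \<tau>[OF j] _ \<delta> _ m _ A]) (use c0 in auto)
      also have "\<dots> \<le> ennreal (8 * \<rho> * (96 * (h * k))) * chi_square_error Ys + ennreal (8 * (h * k) * c0 / n)"
      proof (intro add_left_mono ennreal_leI)
        have "8 * h\<^sup>2 * (c0 / n) \<le> 8 * (h * k) * (c0 / n)"
          using hh c0 by (intro mult_right_mono) auto
        thus "2 * (96 * (h * k)) * 0 + 2 * (h + h)\<^sup>2 * (c0 / n + 0) + 2 * 0 + 2 * h\<^sup>2 * 0 \<le> 8 * (h * k) * c0 / n"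
          by (simp add: power2_eq_square)
      qed
      also have "\<dots> \<le> ennreal (768 * \<rho> * (h * k)) * (if set Ys \<subseteq> lattice_box d k then chi_square_error Ys else 0)
        + ennreal (8 * h / k) * sample_tail k Ys + ennreal (8 * (h * k) * c0 / n)"
        using True by (intro add_right_mono) (simp add: mult_ac)
      finally show ?thesis .
    next
      case False
      then obtain Y where Y: "Y \<in> set Ys" "Y \<notin> lattice_box d k" by auto
      then obtain i where i: "i < d" "k \<le> Y i" using Ys(2) not_in_lattice_boxE by blast
      have "coordinate_regret (Ghat Ys) j \<le> ennreal (2 * (h + h)\<^sup>2) + ennreal (2 * 0 + 2 * h\<^sup>2 * 0)"
        by (rule coordinate_regret_le_crude[OF Q h(1) h(1) j \<delta> _ m]) auto
      also have "\<dots> = ennreal (8 * h\<^sup>2)" by (simp add: power2_eq_square)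
      also have "\<dots> \<le> ennreal (8 * h / k * (real (Y i))\<^sup>2)"
      proof (rule ennreal_leI)
        have "8 * h\<^sup>2 \<le> 8 * h / k * (real k)\<^sup>2" using hh k1 by (simp add: power2_eq_square)
        also have "\<dots> \<le> 8 * h / k * (real (Y i))\<^sup>2"
          using i h by (intro mult_left_mono power_mono) auto
        finally show "8 * h\<^sup>2 \<le> 8 * h / k * (real (Y i))\<^sup>2" .
      qed
      also have "\<dots> = ennreal (8 * h / k) * ennreal ((real (Y i))\<^sup>2)"
        using h by (intro ennreal_mult) auto
      also have "\<dots> \<le> ennreal (8 * h / k) * sample_tail k Ys"
        by (intro mult_left_mono sample_tail_ge Y i) simp
      finally show ?thesis using False by (simp add: add_increasing2)
    qed
  qed
  have "regret d n Ghat G \<le> ennreal (real d * (2 * c0 * (768 * \<rho> * (h * k)) * real k ^ d + c0 * (8 * h / k) * (real k)\<^sup>2 + 8 * (h * k) * c0 / n * n) / n)"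
    by (rule regret_le_real[OF n k c0 _ _ _ T R]) (use c0 \<rho> h in auto)
  also have "\<dots> \<le> ennreal (real d * ((1536 * \<rho> + 16) * c0 * h * real k ^ (d + 1)) / n)"
  proof (intro ennreal_leI divide_right_mono mult_left_mono)
    have "real k ^ 1 \<le> real k ^ (d + 1)" using k1 by (intro power_increasing) auto
    hence "16 * c0 * h * real k \<le> 16 * c0 * h * real k ^ (d + 1)" using c0 h by (intro mult_left_mono) auto
    thus "2 * c0 * (768 * \<rho> * (h * k)) * real k ^ d + c0 * (8 * h / k) * (real k)\<^sup>2 + 8 * (h * k) * c0 / n * n \<le> (1536 * \<rho> + 16) * c0 * h * real k ^ (d + 1)"
      using n k by (simp add: power2_eq_square algebra_simps)
  qed auto
  finally show ?thesis by (simp add: \<rho>_def)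
qed

end

section \<open>Priors on a cube\<close>

context poisson_prior
begin

text \<open>The hypothesis on \<open>k\<close> says that the Chernoff exponent beats the exponential
  moment at \<open>h\<close> by 3 ln n.\<close>

lemma tail_moment_cube_le:
  fixes h \<alpha> :: real
  assumes G: "AE \<theta> in G. \<theta> \<in> cube d h" and j: "j < d" and \<alpha>: "0 < \<alpha>" and c: "0 \<le> c" "2 / \<alpha>\<^sup>2 \<le> c"
    and n: "n > 0" and k: "h * (exp (2 * \<alpha>) - 1) + 3 * ln n \<le> \<alpha> * real k"
  shows "tail_moment k j \<le> ennreal (c / real n ^ 3)"
proof -
  have "(\<integral>\<^sup>+\<theta>. ennreal (exp (\<theta> j * (exp (2 * \<alpha>) - 1))) \<partial>G) \<le> (\<integral>\<^sup>+\<theta>. ennreal (exp (h * (exp (2 * \<alpha>) - 1))) \<partial>G)"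
  proof (rule nn_integral_mono_AE, use G in eventually_elim)
    case (elim \<theta>)
    hence "\<theta> j \<le> h" using j by (auto simp: cube_def PiE_def Pi_def)
    thus ?case using \<alpha> by (intro ennreal_leI) (auto intro!: mult_right_mono)
  qed
  hence E: "(\<integral>\<^sup>+\<theta>. ennreal (exp (\<theta> j * (exp (2 * \<alpha>) - 1))) \<partial>G) \<le> ennreal (exp (h * (exp (2 * \<alpha>) - 1)))"
    by (simp add: emeasure_space_1)
  have "tail_moment k j \<le> ennreal (2 / \<alpha>\<^sup>2 * exp (- (\<alpha> * k))) * ennreal (exp (h * (exp (2 * \<alpha>) - 1)))"
    by (rule order_trans[OF tail_moment_le[OF j \<alpha>]]) (intro mult_left_mono E; simp)
  also have "\<dots> = ennreal (2 / \<alpha>\<^sup>2 * exp (- (\<alpha> * k) + h * (exp (2 * \<alpha>) - 1)))"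
    by (subst ennreal_mult[symmetric]) (simp_all only: exp_add mult.assoc, auto)
  also have "\<dots> \<le> ennreal (c * exp (- (3 * ln n)))"
    using k c by (intro ennreal_leI mult_mono) auto
  also have "exp (- (3 * ln (real n))) = 1 / real n ^ 3"
  proof -
    have "exp (3 * ln (real n)) = exp (ln (real n)) ^ 3" by (rule exp_of_nat_mult[of 3, simplified])
    thus ?thesis using n by (simp add: exp_minus divide_inverse)
  qed
  finally show ?thesis by simp
qed

end

text \<open>Dominates 2 / \<alpha>^2 for both Chernoff parameters in use, \<alpha> = 1/4 and
  \<alpha> = ln (ln n) / 4 with n >= 3.\<close>

definition cube_const :: real where
  "cube_const = 32 + 32 / (ln (ln 3))\<^sup>2"

lemma ln_ln_bounds:
  assumes "n \<ge> (3::nat)"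
  shows "1 \<le> ln (real n)" "0 < ln (ln 3 :: real)" "ln (ln 3) \<le> ln (ln (real n))" "ln (ln (real n)) \<le> ln (real n)"
proof -
  have *: "ln 3 \<le> ln (real n)" using assms by simp
  show "1 \<le> ln (real n)" using ln3_gt_1 * by linarith
  show "0 < ln (ln 3 :: real)" using ln3_gt_1 by simp
  show "ln (ln 3) \<le> ln (ln (real n))" using * ln3_gt_1 by simp
  show "ln (ln (real n)) \<le> ln (real n)"
    using ln_le_minus_one[of "ln (real n)"] * ln3_gt_1 by linarith
qed

lemma K_rate_ge:
  assumes "n \<ge> 3" "0 < h"
  shows "h \<le> K_rate h n" "1 \<le> K_rate h n"
proof -
  note L = ln_ln_bounds[OF assms(1)]
  have "1 \<le> ln (real n) / ln (ln (real n))" using L by (simp add: le_divide_eq)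
  hence "max 1 h * 1 \<le> max 1 h * (ln (real n) / ln (ln (real n)))"
    by (intro mult_left_mono) auto
  thus "h \<le> K_rate h n" "1 \<le> K_rate h n" using L assms by (auto simp: K_rate_def)
qed

text \<open>Each branch of the minimum has its own Chernoff parameter. For h + ln n it is 1/4, since
  k/4 is at least 5 (h + ln n). For the other branch it is ln (ln n) / 4, for which exp (2 \<alpha>)
  is the square root of ln n, and \<alpha> k is at least 5 max {1, h} ln n, covering both the
  exponential moment and 3 ln n.\<close>

lemma (in poisson_prior) tail_moment_K_rate_le:
  assumes G: "AE \<theta> in G. \<theta> \<in> cube d h" and h: "0 < h" and j: "j < d" and n: "n \<ge> 3"
    and k: "20 * K_rate h n \<le> real k"
  shows "tail_moment k j \<le> ennreal (cube_const / real n ^ 3)"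
proof -
  note L = ln_ln_bounds[OF n]
  define l where "l = ln (real n)"
  define ll where "ll = ln l"
  have l: "1 \<le> l" "0 < ll" "ln (ln 3) \<le> ll" using L by (auto simp: l_def ll_def)
  have c0: "0 \<le> cube_const" by (simp add: cube_const_def)
  show ?thesis
  proof (cases "K_rate h n = h + l")
    case True
    show ?thesis
    proof (rule tail_moment_cube_le[OF G j _ c0, where \<alpha> = "1/4"])
      have "exp (1/2) \<le> 1 + 1/2 + (1/2 :: real)\<^sup>2" by (rule exp_bound) auto
      hence "exp (1/2) - 1 \<le> (1 :: real)" by (simp add: power2_eq_square)
      hence "h * (exp (1/2) - 1) \<le> h * 1" using h by (intro mult_left_mono) auto
      hence "h * (exp (2 * (1/4)) - 1) \<le> h" by simp
      also have "h \<le> 1/4 * real k - 3 * ln (real n)"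
        using k True l h unfolding l_def by linarith
      finally show "h * (exp (2 * (1/4)) - 1) + 3 * ln (real n) \<le> 1/4 * real k"
        by (simp only: le_diff_eq)
    qed (use n in \<open>auto simp: cube_const_def power2_eq_square\<close>)
  next
    case False
    define H where "H = max 1 h"
    have H: "1 \<le> H" "h \<le> H" by (auto simp: H_def)
    have K: "20 * (H * (l / ll)) \<le> real k" using k False by (auto simp: K_rate_def l_def ll_def H_def min_def split: if_splits)
    show ?thesis
    proof (rule tail_moment_cube_le[OF G j _ c0, where \<alpha> = "ll / 4"])
      show "2 / (ll / 4)\<^sup>2 \<le> cube_const"
      proof -
        have "32 / ll\<^sup>2 \<le> 32 / (ln (ln 3))\<^sup>2"
          using l(3) L(2) by (intro frac_le power_mono zero_less_power) auto
        thus ?thesis by (simp add: cube_const_def power_divide)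
      qed
      have "exp (2 * (ll / 4)) \<le> exp ll" using l by simp
      also have "\<dots> = l" using l by (simp add: ll_def)
      finally have "h * (exp (2 * (ll / 4)) - 1) \<le> H * l"
        using h H l by (intro mult_mono) auto
      also have "H * l \<le> ll / 4 * real k - 3 * ln (real n)"
      proof -
        have "ll / 4 * (20 * (H * (l / ll))) \<le> ll / 4 * real k"
          using K l by (intro mult_left_mono) auto
        hence "5 * (H * l) \<le> ll / 4 * real k" using l by simp
        moreover have "1 * l \<le> H * l" using H l by (intro mult_right_mono) auto
        ultimately show ?thesis using l unfolding l_def by linarith
      qed
      finally show "h * (exp (2 * (ll / 4)) - 1) + 3 * ln (real n) \<le> ll / 4 * real k"
        by (simp only: le_diff_eq)
    qed (use n l in auto)
  qed
qed

text \<open>Rounding up costs at most 1 <= x, whence 20 becomes 21 and 24 becomes 25.\<close>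

lemma nat_ceiling_bounds:
  fixes x :: real
  assumes "1 \<le> x" "0 \<le> c"
  shows "c * x \<le> real (nat \<lceil>c * x\<rceil>)" "real (nat \<lceil>c * x\<rceil>) \<le> (c + 1) * x"
proof -
  have 0: "0 \<le> c * x" using assms by simp
  show "c * x \<le> real (nat \<lceil>c * x\<rceil>)" by (rule real_nat_ceiling_ge)
  have "real (nat \<lceil>c * x\<rceil>) \<le> c * x + 1" using 0 by linarith
  also have "\<dots> \<le> (c + 1) * x" using assms by (simp add: distrib_right)
  finally show "real (nat \<lceil>c * x\<rceil>) \<le> (c + 1) * x" .
qed

text \<open>Moves a constant into the base of the power, where it no longer depends on the
  exponent.\<close>

lemma power_absorb_const:
  fixes C x y :: real
  assumes "1 \<le> C" "0 \<le> x" "x \<le> y" "0 < m"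
  shows "C * x ^ m \<le> (C * y) ^ m"
proof -
  have "C \<le> C ^ m" using assms by (intro self_le_power)
  moreover have "x ^ m \<le> y ^ m" using assms by (intro power_mono)
  ultimately show ?thesis using assms by (simp add: power_mult_distrib mult_mono)
qed

lemma cube_unconstrained_rate:
  assumes kpos: "\<kappa>1 > 0" "\<kappa>2 > 0" and sw: "sandwich_property \<kappa>1 \<kappa>2 d D" and dec: "decomposition_property d D"
    and n: "n \<ge> 3" "d \<le> n" and h: "0 < h" and est: "min_distance_estimator d n D (orthant d) Ghat"
    and C: "C = (1536 * (\<kappa>2 / \<kappa>1) + 220) * cube_const"
  shows "worst_regret d n Ghat (probs_on (euclidean_space_meas d) (cube d h))
    \<le> ennreal (real d * (21 * C * K_rate h n) ^ (d + 2) / real n)"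
  unfolding worst_regret_def
proof (rule SUP_least)
  fix G assume G: "G \<in> probs_on (euclidean_space_meas d) (cube d h)"
  interpret poisson_prior d G
    using G cube_subset_orthant by unfold_locales (auto simp: probs_on_def elim!: eventually_mono)
  have Gc: "AE \<theta> in G. \<theta> \<in> cube d h" using G by (simp add: probs_on_def)
  note K = K_rate_ge[OF n(1) h]
  define k where "k = nat \<lceil>20 * K_rate h n\<rceil>"
  have k: "20 * K_rate h n \<le> real k" "real k \<le> 21 * K_rate h n"
    using nat_ceiling_bounds[OF K(2), of 20] by (auto simp: k_def)
  have k1: "1 \<le> real k" and hk: "h \<le> real k" using k K by linarith+
  have k2: "1 \<le> (real k)\<^sup>2" using k1 by simp
  have cc: "1 \<le> cube_const" by (simp add: cube_const_def)
  have C1: "1 \<le> C"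
  proof -
    have "1 * 1 \<le> (1536 * (\<kappa>2 / \<kappa>1) + 220) * cube_const" using kpos cc by (intro mult_mono) auto
    thus ?thesis by (simp add: C)
  qed
  \<comment> \<open>For a prior on the cube, truncation at \<open>h\<close> removes nothing and both
    truncation errors vanish.\<close>
  have ind0: "AE \<theta> in G. indicator (- cube d h) \<theta> = (0 :: ennreal)"
    using Gc by eventually_elim simp
  have "regret d n Ghat G \<le> ennreal (real d * ((1536 * (\<kappa>2 / \<kappa>1) + 220) * cube_const * real k ^ (d + 2)) / n)"
  proof (rule unconstrained_regret_le[OF kpos sw dec est _ n(2) _ cc _ hk])
    fix j assume j: "j < d"
    have "tail_moment k j \<le> ennreal (cube_const / real n ^ 3)"
      by (rule tail_moment_K_rate_le[OF Gc h j n(1) k(1)])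
    also have "\<dots> \<le> ennreal (cube_const * (real k)\<^sup>2 / real n ^ 3)"
      using mult_left_mono[OF k2, of cube_const] cc by (intro ennreal_leI divide_right_mono) auto
    finally show "tail_moment k j \<le> ennreal (cube_const * (real k)\<^sup>2 / real n ^ 3)" .
    show "(\<integral>\<^sup>+\<theta>. ennreal ((\<theta> j)\<^sup>2) * indicator (- cube d h) \<theta> \<partial>G) \<le> ennreal (cube_const * (real k)\<^sup>2 / n)"
      using ind0 by (subst nn_integral_cong_AE[where v = "\<lambda>_. 0"]) (auto elim!: eventually_mono)
  next
    show "(\<integral>\<^sup>+\<theta>. indicator (- cube d h) \<theta> \<partial>G) \<le> ennreal (cube_const / n)"
      using ind0 by (subst nn_integral_cong_AE[where v = "\<lambda>_. 0"]) auto
  qed (use n h k1 in auto)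
  also have "\<dots> \<le> ennreal (real d * (21 * C * K_rate h n) ^ (d + 2) / n)"
  proof (intro ennreal_leI divide_right_mono mult_left_mono)
    show "(1536 * (\<kappa>2 / \<kappa>1) + 220) * cube_const * real k ^ (d + 2) \<le> (21 * C * K_rate h n) ^ (d + 2)"
      using power_absorb_const[OF C1 _ k(2), of "d + 2"] by (simp only: C[symmetric]) (simp add: mult_ac)
  qed auto
  finally show "regret d n Ghat G \<le> ennreal (real d * (21 * C * K_rate h n) ^ (d + 2) / n)" .
qed

lemma cube_constrained_rate:
  assumes kpos: "\<kappa>1 > 0" "\<kappa>2 > 0" and sw: "sandwich_property \<kappa>1 \<kappa>2 d D"
    and n: "n \<ge> 3" "d \<le> n" and h: "0 < h" and est: "min_distance_estimator d n D (cube d h) Gtilde"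
    and C: "C = (1536 * (\<kappa>2 / \<kappa>1) + 220) * cube_const"
  shows "worst_regret d n Gtilde (probs_on (euclidean_space_meas d) (cube d h))
    \<le> ennreal (real d * (21 * C) ^ (d + 2) * max 1 h / real n * K_rate h n ^ (d + 1))"
  unfolding worst_regret_def
proof (rule SUP_least)
  fix G assume G: "G \<in> probs_on (euclidean_space_meas d) (cube d h)"
  interpret poisson_prior d G
    using G cube_subset_orthant by unfold_locales (auto simp: probs_on_def elim!: eventually_mono)
  have Gc: "AE \<theta> in G. \<theta> \<in> cube d h" using G by (simp add: probs_on_def)
  note K = K_rate_ge[OF n(1) h]
  define k where "k = nat \<lceil>20 * K_rate h n\<rceil>"
  have k: "20 * K_rate h n \<le> real k" "real k \<le> 21 * K_rate h n"
    using nat_ceiling_bounds[OF K(2), of 20] by (auto simp: k_def)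
  have k1: "1 \<le> real k" and hk: "h \<le> real k" using k K by linarith+
  have k2: "1 \<le> (real k)\<^sup>2" using k1 by simp
  have cc: "1 \<le> cube_const" by (simp add: cube_const_def)
  have C1: "1 \<le> C"
  proof -
    have "1 * 1 \<le> (1536 * (\<kappa>2 / \<kappa>1) + 220) * cube_const" using kpos cc by (intro mult_mono) auto
    thus ?thesis by (simp add: C)
  qed
  have "regret d n Gtilde G \<le> ennreal (real d * ((1536 * (\<kappa>2 / \<kappa>1) + 16) * cube_const * h * real k ^ (d + 1)) / n)"
  proof (rule constrained_regret_le[OF kpos sw est _ n(2) _ cc _ hk _ Gc])
    fix j assume j: "j < d"
    have "tail_moment k j \<le> ennreal (cube_const / real n ^ 3)"
      by (rule tail_moment_K_rate_le[OF Gc h j n(1) k(1)])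
    also have "\<dots> \<le> ennreal (cube_const * (real k)\<^sup>2 / real n ^ 3)"
      using mult_left_mono[OF k2, of cube_const] cc by (intro ennreal_leI divide_right_mono) auto
    finally show "tail_moment k j \<le> ennreal (cube_const * (real k)\<^sup>2 / real n ^ 3)" .
  qed (use n h k1 in auto)
  also have "\<dots> \<le> ennreal (real d * ((21 * C) ^ (d + 2) * max 1 h * K_rate h n ^ (d + 1)) / n)"
  proof (intro ennreal_leI divide_right_mono mult_left_mono)
    have "(1536 * (\<kappa>2 / \<kappa>1) + 16) * cube_const \<le> C"
      unfolding C using kpos cc by (intro mult_right_mono) auto
    hence "(1536 * (\<kappa>2 / \<kappa>1) + 16) * cube_const * h * real k ^ (d + 1) \<le> C * max 1 h * real k ^ (d + 1)"
      using h C1 by (intro mult_right_mono mult_mono) auto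
    also have "\<dots> = max 1 h * (C * real k ^ (d + 1))" by (simp only: mult_ac)
    also have "\<dots> \<le> max 1 h * (C * (21 * K_rate h n)) ^ (d + 1)"
      using power_absorb_const[OF C1 _ k(2), of "d + 1"] by (intro mult_left_mono) auto
    also have "(C * (21 * K_rate h n)) ^ (d + 1) = (21 * C) ^ (d + 1) * K_rate h n ^ (d + 1)"
      by (simp only: mult.assoc mult.left_commute flip: power_mult_distrib)
    \<comment> \<open>A spare factor 21 C >= 1 raises the exponent of the constant from d + 1 to d +
      2.\<close>
    also have "max 1 h * \<dots> \<le> max 1 h * ((21 * C) ^ (d + 2) * K_rate h n ^ (d + 1))"
      using C1 K by (intro mult_left_mono mult_right_mono power_increasing) auto
    finally show "(1536 * (\<kappa>2 / \<kappa>1) + 16) * cube_const * h * real k ^ (d + 1) \<le> (21 * C) ^ (d + 2) * max 1 h * K_rate h n ^ (d + 1)"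
      by (simp only: mult_ac)
  qed auto
  finally show "regret d n Gtilde G \<le> ennreal (real d * (21 * C) ^ (d + 2) * max 1 h / n * K_rate h n ^ (d + 1))"
    by (simp only: times_divide_eq_left times_divide_eq_right mult.assoc)
qed

section \<open>Subexponential priors\<close>

text \<open>The value of the geometric series with terms 2 exp ((i + 1) / 2) exp (-i), which bounds
  the exponential moment of a marginal at rate 1 / (2 S).\<close>

definition subexp_const :: real where
  "subexp_const = 2 * exp (1/2) / (1 - exp (- 1/2))"

lemma subexp_const_pos: "0 < subexp_const"
  unfolding subexp_const_def by (intro divide_pos_pos) auto

context poisson_prior
begin

context
  fixes s S :: real and j :: nat
  assumes sub: "marginal G j \<in> SubE s" and s: "0 < s" and S: "s \<le> S" and j: "j < d"
begin

text \<open>A larger scale only weakens the tail bound; \<open>S\<close> will be max {1, s}, which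
  keeps the Chernoff parameters bounded.\<close>

lemma marginal_tail:
  assumes "0 < t"
  shows "emeasure G {\<theta> \<in> space G. t \<le> \<theta> j} \<le> ennreal (2 * exp (- t / S))"
proof -
  note [measurable] = measurable_coordinate[OF j]
  have "measure (marginal G j) {t..} \<le> 2 * exp (- t / s)"
    using sub assms by (simp add: SubE_def)
  also have "\<dots> \<le> 2 * exp (- t / S)"
    using assms s S by (simp add: frac_le)
  also have "measure (marginal G j) {t..} = measure G ((\<lambda>\<theta>. \<theta> j) -` {t..} \<inter> space G)"
    unfolding marginal_def by (rule measure_distr) auto
  also have "(\<lambda>\<theta>. \<theta> j) -` {t..} \<inter> space G = {\<theta> \<in> space G. t \<le> \<theta> j}" by auto
  finally show ?thesis by (simp add: emeasure_eq_measure ennreal_leI)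
qed

text \<open>The exponential is dominated by a step function whose steps have length \<open>S\<close>.\<close>

lemma marginal_exponential_moment:
  "(\<integral>\<^sup>+\<theta>. ennreal (exp (\<theta> j / (2 * S))) \<partial>G) \<le> ennreal subexp_const"
proof -
  have Spos: "0 < S" using s S by simp
  note [measurable] = measurable_coordinate[OF j]
  let ?I = "\<lambda>i. {\<theta> \<in> space G. real i * S \<le> \<theta> j}"
  have "(\<integral>\<^sup>+\<theta>. ennreal (exp (\<theta> j / (2 * S))) \<partial>G)
      \<le> (\<integral>\<^sup>+\<theta>. (\<Sum>i. ennreal (exp ((real i + 1) / 2)) * indicator (?I i) \<theta>) \<partial>G)"
  proof (rule nn_integral_mono_AE, use AE_orthant AE_space in eventually_elim)
    case (elim \<theta>)
    have \<theta>: "0 \<le> \<theta> j" using elim(1) j by (rule orthant_nonneg)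
    define i where "i = nat \<lfloor>\<theta> j / S\<rfloor>"
    have "0 \<le> \<theta> j / S" using \<theta> Spos by simp
    hence i: "real i \<le> \<theta> j / S" "\<theta> j / S \<le> real i + 1" unfolding i_def by linarith+
    have "ennreal (exp (\<theta> j / (2 * S))) \<le> ennreal (exp ((real i + 1) / 2)) * indicator (?I i) \<theta>"
      using i Spos elim(2) by (auto simp: field_simps intro!: ennreal_leI)
    also have "\<dots> \<le> (\<Sum>i. ennreal (exp ((real i + 1) / 2)) * indicator (?I i) \<theta>)"
    proof -
      define F :: "nat \<Rightarrow> ennreal" where "F i = ennreal (exp ((real i + 1) / 2)) * indicator (?I i) \<theta>" for i
      have "sum F {i} \<le> suminf F" by (rule sum_le_suminf) auto
      hence "F i \<le> suminf F" by simp
      thus ?thesis unfolding F_def .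
    qed
    finally show ?case .
  qed
  also have "\<dots> = (\<Sum>i. ennreal (exp ((real i + 1) / 2)) * emeasure G (?I i))"
    by (subst nn_integral_suminf) (simp_all add: nn_integral_cmult_indicator)
  also have "\<dots> \<le> (\<Sum>i. ennreal (2 * exp (1/2) * exp (- 1/2) ^ i))"
  proof (intro suminf_le summableI)
    fix i :: nat
    have "emeasure G (?I i) \<le> ennreal (2 * exp (- real i))"
    proof (cases "i = 0")
      \<comment> \<open>The tail bound is only available for t > 0; at \<open>i = 0\<close> the
        trivial bound 1 <= 2 takes its place.\<close>
      case True
      have "emeasure G (?I i) \<le> 1" by (rule emeasure_le_1)
      also have "(1::ennreal) \<le> 2" by simp
      finally show ?thesis using True by simp
    next
      case False
      thus ?thesis using marginal_tail[of "real i * S"] Spos by simp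
    qed
    hence "ennreal (exp ((real i + 1) / 2)) * emeasure G (?I i) \<le> ennreal (exp ((real i + 1) / 2)) * ennreal (2 * exp (- real i))"
      by (rule mult_left_mono) simp
    also have "\<dots> = ennreal (2 * (exp ((real i + 1) / 2) * exp (- real i)))"
      by (subst ennreal_mult[symmetric]) (auto simp: mult_ac)
    also have "exp ((real i + 1) / 2) * exp (- real i) = exp (1/2) * exp (real i * (- 1/2))"
      unfolding exp_add[symmetric] by (simp add: field_simps)
    also have "exp (real i * (- 1/2)) = exp (- 1/2) ^ i" by (rule exp_of_nat_mult)
    finally show "ennreal (exp ((real i + 1) / 2)) * emeasure G (?I i) \<le> ennreal (2 * exp (1/2) * exp (- 1/2) ^ i)"
      by (simp only: mult.assoc)
  qed
  also have "\<dots> = ennreal (\<Sum>i. 2 * exp (1/2) * exp (- 1/2) ^ i)"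
    by (rule suminf_ennreal2) (auto intro!: summable_mult summable_geometric)
  also have "(\<Sum>i. 2 * exp (1/2) * exp (- 1/2 :: real) ^ i) = subexp_const"
    by (subst suminf_mult) (auto simp: suminf_geometric summable_geometric subexp_const_def)
  finally show ?thesis .
qed

text \<open>With \<alpha> = 1 / (8 S) the rate exp (2 \<alpha>) - 1 is at most 4 \<alpha> = 1 / (2
  S), where the exponential moment is bounded. Then 2 / \<alpha>^2 = 128 S^2, and \<open>k\<close>
  of at least 24 S ln n makes \<alpha> k at least 3 ln n.\<close>

lemma tail_moment_subexp_le:
  assumes S1: "1 \<le> S" and n: "n > (0 :: nat)" and k: "24 * S * ln n \<le> real k" "S \<le> real k"
  shows "tail_moment k j \<le> ennreal (128 * subexp_const * (real k)\<^sup>2 / real n ^ 3)"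
proof -
  define \<alpha> where "\<alpha> = 1 / (8 * S)"
  have \<alpha>: "0 < \<alpha>" using S1 by (simp add: \<alpha>_def)
  have "exp (2 * \<alpha>) \<le> 1 + 2 * \<alpha> + (2 * \<alpha>)\<^sup>2"
    using S1 by (intro exp_bound) (auto simp: \<alpha>_def divide_simps)
  also have "(2 * \<alpha>)\<^sup>2 \<le> 2 * \<alpha>"
    using S1 by (simp add: \<alpha>_def power2_eq_square divide_simps)
  finally have rate: "exp (2 * \<alpha>) - 1 \<le> 1 / (2 * S)" by (simp add: \<alpha>_def)
  have "(\<integral>\<^sup>+\<theta>. ennreal (exp (\<theta> j * (exp (2 * \<alpha>) - 1))) \<partial>G) \<le> (\<integral>\<^sup>+\<theta>. ennreal (exp (\<theta> j / (2 * S))) \<partial>G)"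
  proof (rule nn_integral_mono_AE, use AE_orthant in eventually_elim)
    case (elim \<theta>)
    have "\<theta> j * (exp (2 * \<alpha>) - 1) \<le> \<theta> j * (1 / (2 * S))"
      using rate orthant_nonneg[OF elim j] by (rule mult_left_mono)
    thus ?case by (intro ennreal_leI) simp
  qed
  hence E: "(\<integral>\<^sup>+\<theta>. ennreal (exp (\<theta> j * (exp (2 * \<alpha>) - 1))) \<partial>G) \<le> ennreal subexp_const"
    using marginal_exponential_moment by (rule order_trans)
  have "tail_moment k j \<le> ennreal (2 / \<alpha>\<^sup>2 * exp (- (\<alpha> * k))) * ennreal subexp_const"
    by (rule order_trans[OF tail_moment_le[OF j \<alpha>]]) (intro mult_left_mono E; simp)
  also have "\<dots> = ennreal (128 * S\<^sup>2 * exp (- (\<alpha> * k)) * subexp_const)"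
    using subexp_const_pos by (subst ennreal_mult[symmetric]) (auto simp: \<alpha>_def power_divide power_mult_distrib)
  also have "\<dots> \<le> ennreal (128 * (real k)\<^sup>2 * (1 / real n ^ 3) * subexp_const)"
  proof (intro ennreal_leI mult_right_mono mult_mono)
    show "S\<^sup>2 \<le> (real k)\<^sup>2" using S1 k by (intro power_mono) auto
    have "3 * ln (real n) \<le> \<alpha> * real k" using k(1) S1 by (simp add: \<alpha>_def field_simps)
    hence "exp (- (\<alpha> * k)) \<le> exp (- (3 * ln (real n)))" by simp
    also have "exp (- (3 * ln (real n))) = 1 / real n ^ 3"
      using n by (simp add: exp_minus divide_inverse exp_of_nat_mult[of 3, simplified])
    finally show "exp (- (\<alpha> * k)) \<le> 1 / real n ^ 3" .
  qed (use subexp_const_pos in auto)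
  finally show ?thesis by (simp add: mult_ac)
qed

text \<open>No Poisson noise here, so \<alpha> = 1 / (4 S) hits the rate 1 / (2 S) exactly; 2 /
  \<alpha>^2 = 32 S^2, and 8 S ln n leaves ample decay.\<close>

lemma marginal_square_tail:
  assumes n: "n > (0 :: nat)" and h: "8 * S * ln n \<le> h" "0 \<le> h"
  shows "(\<integral>\<^sup>+\<theta>. ennreal ((\<theta> j)\<^sup>2) * indicator {\<theta>. h \<le> \<theta> j} \<theta> \<partial>G) \<le> ennreal (32 * subexp_const * S\<^sup>2 / n)"
proof -
  note [measurable] = measurable_coordinate[OF j]
  have Spos: "0 < S" using s S by simp
  define \<alpha> where "\<alpha> = 1 / (4 * S)"
  have \<alpha>: "0 < \<alpha>" using Spos by (simp add: \<alpha>_def)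
  have n1: "0 \<le> ln (real n)" using n by simp
  have e: "exp (- (\<alpha> * h)) \<le> 1 / n"
  proof -
    have "2 * ln (real n) \<le> \<alpha> * h" using h(1) Spos by (simp add: \<alpha>_def field_simps)
    hence "exp (- (\<alpha> * h)) \<le> exp (- ln (real n))" using n1 by simp
    thus ?thesis using n by (simp add: exp_minus divide_inverse)
  qed
  have "(\<integral>\<^sup>+\<theta>. ennreal ((\<theta> j)\<^sup>2) * indicator {\<theta>. h \<le> \<theta> j} \<theta> \<partial>G)
      \<le> (\<integral>\<^sup>+\<theta>. ennreal (32 * S\<^sup>2 / n) * ennreal (exp (\<theta> j / (2 * S))) \<partial>G)"
  proof (rule nn_integral_mono)
    fix \<theta>
    show "ennreal ((\<theta> j)\<^sup>2) * indicator {\<theta>. h \<le> \<theta> j} \<theta> \<le> ennreal (32 * S\<^sup>2 / n) * ennreal (exp (\<theta> j / (2 * S)))"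
    proof (cases "h \<le> \<theta> j")
      case True
      hence "(\<theta> j)\<^sup>2 \<le> 2 / \<alpha>\<^sup>2 * exp (- (\<alpha> * h)) * exp (2 * \<alpha> * \<theta> j)"
        using h \<alpha> by (intro square_tail_le_exp) auto
      also have "\<dots> \<le> 2 / \<alpha>\<^sup>2 * (1 / n) * exp (2 * \<alpha> * \<theta> j)"
        using e by (intro mult_right_mono mult_left_mono) auto
      also have "\<dots> = 32 * S\<^sup>2 / n * exp (\<theta> j / (2 * S))"
        by (simp add: \<alpha>_def power_divide power_mult_distrib)
      finally have "ennreal ((\<theta> j)\<^sup>2) \<le> ennreal (32 * S\<^sup>2 / n * exp (\<theta> j / (2 * S)))" by (rule ennreal_leI)
      also have "\<dots> = ennreal (32 * S\<^sup>2 / n) * ennreal (exp (\<theta> j / (2 * S)))" by (rule ennreal_mult) auto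
      finally show ?thesis using True by simp
    qed simp
  qed
  also have "\<dots> = ennreal (32 * S\<^sup>2 / n) * (\<integral>\<^sup>+\<theta>. ennreal (exp (\<theta> j / (2 * S))) \<partial>G)"
    by (intro nn_integral_cmult) measurable
  also have "\<dots> \<le> ennreal (32 * S\<^sup>2 / n) * ennreal subexp_const"
    by (intro mult_left_mono marginal_exponential_moment) simp
  also have "\<dots> = ennreal (32 * subexp_const * S\<^sup>2 / n)"
    using subexp_const_pos by (subst ennreal_mult[symmetric]) (auto simp: mult_ac)
  finally show ?thesis .
qed

end

text \<open>Union bound: each marginal tail is at most 2 n^(-4), and there are d <= n
  coordinates.\<close>

lemma outside_cube_le:
  assumes sub: "\<And>j. j < d \<Longrightarrow> marginal G j \<in> SubE s" and s: "0 < s" "s \<le> S"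
    and n: "n \<ge> 3" "d \<le> n" and h: "8 * S * ln n \<le> h"
  shows "(\<integral>\<^sup>+\<theta>. indicator (- cube d h) \<theta> \<partial>G) \<le> ennreal (2 / real n ^ 3)"
proof -
  note L = ln_ln_bounds[OF n(1)]
  have Spos: "0 < S" using s by simp
  have "0 < 8 * S * ln n" using Spos L by simp
  hence h0: "0 < h" using h by linarith
  have [measurable]: "{\<theta> \<in> space G. h \<le> \<theta> j} \<in> sets G" if "j < d" for j
    using measurable_coordinate[OF that] by measurable
  have "(\<integral>\<^sup>+\<theta>. indicator (- cube d h) \<theta> \<partial>G) \<le> (\<integral>\<^sup>+\<theta>. (\<Sum>j<d. indicator {\<theta> \<in> space G. h \<le> \<theta> j} \<theta>) \<partial>G)"
  proof (rule nn_integral_mono_AE, use AE_orthant AE_space in eventually_elim)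
    case (elim \<theta>)
    show ?case
    proof (cases "\<theta> \<in> cube d h")
      case False
      then obtain i where i: "i < d" "h < \<theta> i"
        using elim(1) by (force simp: cube_def orthant_def PiE_def Pi_def)
      have "(1::ennreal) = indicator {\<theta> \<in> space G. h \<le> \<theta> i} \<theta>" using i elim(2) by simp
      also have "\<dots> \<le> (\<Sum>j<d. indicator {\<theta> \<in> space G. h \<le> \<theta> j} \<theta>)"
        using i by (intro member_le_sum) auto
      finally show ?thesis using False by simp
    qed simp
  qed
  also have "\<dots> = (\<Sum>j<d. emeasure G {\<theta> \<in> space G. h \<le> \<theta> j})"
    by (subst nn_integral_sum) auto
  also have "\<dots> \<le> of_nat (card {..<d}) * ennreal (2 * exp (- h / S))"
    using marginal_tail[OF sub s _ h0] by (intro sum_bounded_above) auto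
  also have "\<dots> = ennreal (real d * (2 * exp (- h / S)))"
    by (simp add: ennreal_of_nat_eq_real_of_nat ennreal_mult[symmetric])
  also have "\<dots> \<le> ennreal (real n * (2 * (1 / real n ^ 4)))"
  proof (intro ennreal_leI mult_mono)
    have "4 * ln (real n) \<le> 8 * ln (real n)" using L by simp
    also have "\<dots> \<le> h / S" using h Spos by (simp add: field_simps)
    finally have "exp (- h / S) \<le> exp (- (4 * ln (real n)))" by simp
    also have "exp (- (4 * ln (real n))) = 1 / real n ^ 4"
      using n by (simp add: exp_minus divide_inverse exp_of_nat_mult[of 4, simplified])
    finally show "exp (- h / S) \<le> 1 / real n ^ 4" .
  qed (use n in auto)
  also have "real n * (2 * (1 / real n ^ 4)) = 2 / real n ^ 3"
    using n by (simp add: power_numeral_reduce)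
  finally show ?thesis .
qed

text \<open>A point may leave the cube through another coordinate while \<open>\<theta> j\<close>
  stays below \<open>h\<close>; such points are charged h^2 times the mass outside the cube.\<close>

lemma outside_cube_square_le:
  assumes sub: "\<And>j. j < d \<Longrightarrow> marginal G j \<in> SubE s" and s: "0 < s" "s \<le> S"
    and n: "n \<ge> 3" "d \<le> n" and h: "8 * S * ln n \<le> h" and j: "j < d"
  shows "(\<integral>\<^sup>+\<theta>. ennreal ((\<theta> j)\<^sup>2) * indicator (- cube d h) \<theta> \<partial>G)
    \<le> ennreal (32 * subexp_const * S\<^sup>2 / n + h\<^sup>2 * (2 / real n ^ 3))"
proof -
  note L = ln_ln_bounds[OF n(1)]
  have "0 \<le> 8 * S * ln n" using s L by simp
  hence h0: "0 \<le> h" using h by linarith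
  have "(\<integral>\<^sup>+\<theta>. ennreal ((\<theta> j)\<^sup>2) * indicator (- cube d h) \<theta> \<partial>G)
      \<le> (\<integral>\<^sup>+\<theta>. ennreal ((\<theta> j)\<^sup>2) * indicator {\<theta>. h \<le> \<theta> j} \<theta> + ennreal (h\<^sup>2) * indicator (- cube d h) \<theta> \<partial>G)"
  proof (rule nn_integral_mono_AE, use AE_orthant in eventually_elim)
    case (elim \<theta>)
    have "(\<theta> j)\<^sup>2 \<le> h\<^sup>2" if "\<theta> j \<le> h" using that orthant_nonneg[OF elim j] by (intro power_mono)
    thus ?case by (auto simp: indicator_def add_increasing2 intro!: ennreal_leI)
  qed
  also have "\<dots> = (\<integral>\<^sup>+\<theta>. ennreal ((\<theta> j)\<^sup>2) * indicator {\<theta>. h \<le> \<theta> j} \<theta> \<partial>G) + ennreal (h\<^sup>2) * (\<integral>\<^sup>+\<theta>. indicator (- cube d h) \<theta> \<partial>G)"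
  proof -
    have "(\<lambda>\<theta>. ennreal ((\<theta> j)\<^sup>2) * indicator {\<theta>. h \<le> \<theta> j} \<theta>) = (\<lambda>\<theta>. ennreal ((\<theta> j)\<^sup>2) * indicator {h..} (\<theta> j))"
      by (auto simp: indicator_def)
    also have "\<dots> \<in> borel_measurable G" using measurable_coordinate[OF j] by measurable
    finally show ?thesis by (subst nn_integral_add) (auto intro!: nn_integral_cmult)
  qed
  also have "\<dots> \<le> ennreal (32 * subexp_const * S\<^sup>2 / n) + ennreal (h\<^sup>2) * ennreal (2 / real n ^ 3)"
    using n by (intro add_mono mult_left_mono marginal_square_tail[OF sub[OF j] s j _ h h0] outside_cube_le[OF sub s n h]) auto
  also have "\<dots> = ennreal (32 * subexp_const * S\<^sup>2 / n + h\<^sup>2 * (2 / real n ^ 3))"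
    using subexp_const_pos
    by (subst ennreal_mult[symmetric], simp, simp, subst ennreal_plus[symmetric]) auto
  finally show ?thesis .
qed

end

lemma subexp_unconstrained_rate:
  assumes kpos: "\<kappa>1 > 0" "\<kappa>2 > 0" and sw: "sandwich_property \<kappa>1 \<kappa>2 d D" and dec: "decomposition_property d D"
    and n: "n \<ge> 3" "d \<le> n" and s: "0 < s" and est: "min_distance_estimator d n D (orthant d) Ghat"
    and \<G>: "\<G> \<subseteq> probs_on (euclidean_space_meas d) (orthant d)" "\<forall>G\<in>\<G>. \<forall>j<d. marginal G j \<in> SubE s"
    and C: "C = (1536 * (\<kappa>2 / \<kappa>1) + 220) * (128 * subexp_const + 2)"
  shows "worst_regret d n Ghat \<G>
    \<le> ennreal (real d * (25 * C * max 1 s) ^ (d + 2) / real n * ln (real n) ^ (d + 2))"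
  unfolding worst_regret_def
proof (rule SUP_least)
  fix G assume G: "G \<in> \<G>"
  interpret poisson_prior d G using G \<G>(1) by unfold_locales auto
  define S where "S = max 1 s"
  have S: "1 \<le> S" "s \<le> S" by (auto simp: S_def)
  have sub: "marginal G j \<in> SubE s" if "j < d" for j using G \<G>(2) that by auto
  \<comment> \<open>One constant for three demands: 128 \<open>subexp_const\<close> for the Poisson
    tail, 2 for the mass outside the cube and 32 \<open>subexp_const\<close> + 2 for its second
    moment.\<close>
  define c0 where "c0 = 128 * subexp_const + 2"
  have c0: "1 \<le> c0" "2 \<le> c0" "128 * subexp_const \<le> c0" "32 * subexp_const + 2 \<le> c0" using subexp_const_pos by (auto simp: c0_def)
  define l where "l = ln (real n)"
  have l: "1 \<le> l" using ln_ln_bounds[OF n(1)] by (simp add: l_def)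
  have "1 * 1 \<le> S * l" using S l by (intro mult_mono) auto
  hence Sl: "1 \<le> S * l" by simp
  have "S * 1 \<le> S * l" using S l by (intro mult_left_mono) auto
  hence Sl': "S \<le> S * l" by simp
  define k where "k = nat \<lceil>24 * (S * l)\<rceil>"
  have k: "24 * (S * l) \<le> real k" "real k \<le> 25 * (S * l)"
    using nat_ceiling_bounds[OF Sl, of 24] by (auto simp: k_def)
  \<comment> \<open>Two levels: the prior is truncated at 8 S ln n, as the bounds outside the cube
    require, and the observations at \<open>k\<close>, at least three times larger.\<close>
  define h where "h = 8 * (S * l)"
  have h: "0 \<le> h" "h \<le> real k" using k Sl by (auto simp: h_def)
  have hS: "8 * S * ln n \<le> h" by (simp add: h_def l_def)
  have k1: "1 \<le> real k" "S \<le> real k" using k Sl Sl' by linarith+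
  have n1: "1 \<le> real n" using n by simp
  have n3: "real n \<le> real n ^ 3" using n1 by (rule self_le_power) simp
  have C1: "1 \<le> C"
  proof -
    have "1 * 1 \<le> (1536 * (\<kappa>2 / \<kappa>1) + 220) * c0" using kpos c0 by (intro mult_mono) auto
    thus ?thesis by (simp add: C c0_def)
  qed
  have "regret d n Ghat G \<le> ennreal (real d * ((1536 * (\<kappa>2 / \<kappa>1) + 220) * c0 * real k ^ (d + 2)) / n)"
  proof (rule unconstrained_regret_le[OF kpos sw dec est _ n(2) _ c0(1) h])
    fix j assume j: "j < d"
    have "tail_moment k j \<le> ennreal (128 * subexp_const * (real k)\<^sup>2 / real n ^ 3)"
      using n k k1 by (intro tail_moment_subexp_le[OF sub[OF j] s S(2) j S(1)]) (auto simp: l_def mult.assoc)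
    also have "\<dots> \<le> ennreal (c0 * (real k)\<^sup>2 / real n ^ 3)"
      using c0 by (intro ennreal_leI divide_right_mono mult_right_mono) auto
    finally show "tail_moment k j \<le> ennreal (c0 * (real k)\<^sup>2 / real n ^ 3)" .
    have "(\<integral>\<^sup>+\<theta>. ennreal ((\<theta> j)\<^sup>2) * indicator (- cube d h) \<theta> \<partial>G)
        \<le> ennreal (32 * subexp_const * S\<^sup>2 / n + h\<^sup>2 * (2 / real n ^ 3))"
      by (rule outside_cube_square_le[OF sub s S(2) n hS j])
    also have "\<dots> \<le> ennreal (c0 * (real k)\<^sup>2 / n)"
    proof (rule ennreal_leI)
      have "S\<^sup>2 \<le> (real k)\<^sup>2" "h\<^sup>2 \<le> (real k)\<^sup>2" using S k1 h by (auto intro!: power_mono)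
      moreover have "2 / real n ^ 3 \<le> 2 / n" using n3 n1 by (intro divide_left_mono) auto
      ultimately have "32 * subexp_const * S\<^sup>2 / n + h\<^sup>2 * (2 / real n ^ 3) \<le> 32 * subexp_const * (real k)\<^sup>2 / n + (real k)\<^sup>2 * (2 / n)"
        using subexp_const_pos by (intro add_mono divide_right_mono mult_left_mono mult_mono) auto
      also have "\<dots> = (32 * subexp_const + 2) * (real k)\<^sup>2 / n"
        using n1 by (simp add: field_simps)
      also have "\<dots> \<le> c0 * (real k)\<^sup>2 / n"
        using c0 by (intro divide_right_mono mult_right_mono) auto
      finally show "32 * subexp_const * S\<^sup>2 / n + h\<^sup>2 * (2 / real n ^ 3) \<le> c0 * (real k)\<^sup>2 / n" .
    qed
    finally show "(\<integral>\<^sup>+\<theta>. ennreal ((\<theta> j)\<^sup>2) * indicator (- cube d h) \<theta> \<partial>G) \<le> ennreal (c0 * (real k)\<^sup>2 / n)" .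
  next
    have "(\<integral>\<^sup>+\<theta>. indicator (- cube d h) \<theta> \<partial>G) \<le> ennreal (2 / real n ^ 3)"
      by (rule outside_cube_le[OF sub s S(2) n hS])
    also have "\<dots> \<le> ennreal (c0 / n)"
      using c0 n3 n1 by (intro ennreal_leI frac_le) auto
    finally show "(\<integral>\<^sup>+\<theta>. indicator (- cube d h) \<theta> \<partial>G) \<le> ennreal (c0 / n)" .
  qed (use n k1 in auto)
  also have "\<dots> \<le> ennreal (real d * ((25 * C * S) ^ (d + 2) * l ^ (d + 2)) / n)"
  proof (intro ennreal_leI divide_right_mono mult_left_mono)
    have "(C * (25 * (S * l))) ^ (d + 2) = (25 * C * S) ^ (d + 2) * l ^ (d + 2)"
      by (simp only: mult_ac flip: power_mult_distrib)
    thus "(1536 * (\<kappa>2 / \<kappa>1) + 220) * c0 * real k ^ (d + 2) \<le> (25 * C * S) ^ (d + 2) * l ^ (d + 2)"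
      using power_absorb_const[OF C1 _ k(2), of "d + 2"] by (simp only: c0_def C[symmetric])
  qed auto
  finally show "regret d n Ghat G \<le> ennreal (real d * (25 * C * max 1 s) ^ (d + 2) / n * ln (real n) ^ (d + 2))"
    unfolding S_def l_def by (simp only: times_divide_eq_left times_divide_eq_right mult.assoc)
qed

theorem theorem6:
  fixes \<kappa>1 \<kappa>2 :: real
  assumes "\<kappa>1 > 0" and "\<kappa>2 > 0"
  shows "\<exists>c1>0. \<exists>c2>0. \<forall>d\<ge>1. \<forall>D n.
    generalized_distance d D \<and> decomposition_property d D \<and> sandwich_property \<kappa>1 \<kappa>2 d D \<and>
    n \<ge> 3 \<and> n \<ge> d \<longrightarrow>
      (\<forall>Ghat. min_distance_estimator d n D (orthant d) Ghat \<longrightarrow>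
         (\<forall>h>0. worst_regret d n Ghat (probs_on (euclidean_space_meas d) (cube d h))
            \<le> ennreal (real d * (c1 * K_rate h n) ^ (d + 2) / real n)) \<and>
         (\<forall>s>0. \<forall>\<G>. \<G> \<subseteq> probs_on (euclidean_space_meas d) (orthant d) \<and>
              (\<forall>G\<in>\<G>. \<forall>j<d. marginal G j \<in> SubE s) \<longrightarrow>
            worst_regret d n Ghat \<G>
              \<le> ennreal (real d * (c2 * max 1 s) ^ (d + 2) / real n * ln (real n) ^ (d + 2)))) \<and>
      (\<forall>h>0. \<forall>Gtilde. min_distance_estimator d n D (cube d h) Gtilde \<longrightarrow>
         worst_regret d n Gtilde (probs_on (euclidean_space_meas d) (cube d h))
           \<le> ennreal (real d * c1 ^ (d + 2) * max 1 h / real n * K_rate h n ^ (d + 1)))"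
proof -
  \<comment> \<open>Both constants depend on \<kappa>1 and \<kappa>2 only, through their
    ratio.\<close>
  define C1 where "C1 = (1536 * (\<kappa>2 / \<kappa>1) + 220) * cube_const"
  define C2 where "C2 = (1536 * (\<kappa>2 / \<kappa>1) + 220) * (128 * subexp_const + 2)"
  have \<rho>: "0 < 1536 * (\<kappa>2 / \<kappa>1) + 220" using assms by (intro add_pos_pos) auto
  have "0 < cube_const" by (simp add: cube_const_def add_pos_nonneg)
  hence C1: "0 < 21 * C1" using \<rho> unfolding C1_def by (intro mult_pos_pos) auto
  have C2: "0 < 25 * C2" unfolding C2_def using \<rho> subexp_const_pos by (intro mult_pos_pos[of 25] mult_pos_pos[OF \<rho>]) auto
  show ?thesis
  proof (rule exI[of _ "21 * C1"], rule conjI[OF C1], rule exI[of _ "25 * C2"], rule conjI[OF C2],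
      intro allI impI conjI; (elim conjE)?)
  qed (use cube_unconstrained_rate[OF assms _ _ _ _ _ _ C1_def] subexp_unconstrained_rate[OF assms _ _ _ _ _ _ _ _ C2_def]
      cube_constrained_rate[OF assms _ _ _ _ _ C1_def] in auto)
qed

end
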